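(* Let $F\in R\setminus k((X))$ be devoid of multiple factors in $R$ (that is, $F\neq 0$ and the ideal $FR$ is its own radical in $R$), and let $T=T(F)$ be the tree of $F$. Then the following hold. (DF1.1) For every $B\in T$ we have $$\deg_Y\Omega_B(F_Y)=D''(B)\quad\text{and}\quad \deg_Y\Omega'_B(F_Y)=D'(B)$$ and $$\Omega_B(F_Y)=\Omega'_B(F_Y)\prod_{B'\in\pi(T,B)}\Omega'_{B'}(F_Y),$$ where for every $B'\in\pi(T,B)$ we have $$\deg_Y\Omega_{B'}(F_Y)=D''(B')\quad\text{and}\quad \deg_Y\Omega'_{B'}(F_Y)=D'(B').$$ (DF1.2) In particular, taking $B=R_\infty(T)$ (the root of $T$) in (DF1.1), the monic part $(F_Y)_\infty$ of $F_Y$ satisfies $$(F_Y)_\infty=\prod_{B\in T\setminus\{R_\infty(T)\}}\Omega'_B(F_Y).$$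
   Context: Setting. $k$ is an algebraically closed field of characteristic zero, $k((X))$ is the field of formal meromorphic (Laurent) series in $X$ over $k$, and $R=k((X))[Y]$. Subscripts $X,Y$ on elements of $R$ denote partial derivatives. $R^\natural$ is the set of all monic irreducible polynomials in $Y$ over $k((X))$ (so of positive $Y$-degree). Every $H\in R$ is written $H=H_0\prod_{1\le j\le\chi(H)}H_j$ with $H_0\in k((X))$ and $H_j\in R^\natural$ (not necessarily distinct), where $\chi(H)=0$ iff $H\in k((X))$. Empty products equal $1$. The monic part of $H$ is $H_\infty=\prod_{1\le j\le\chi(H)}H_j$. Contact. For $f\in R^\natural$ with $\deg_Yf=n$, write $f(X^n,Y)=\prod_{1\le j\le n}(Y-z_j(X))$ with $z_j\in k((X))$ (Newton's Theorem). For $f,f'\in R^\natural$ of $Y$-degrees $n,n'$ with $f(X^n,Y)=\prod_{1\le j\le n}(Y-z_j(X))$ and $f'(X^{n'},Y)=\prod_{1\le j'\le n'}(Y-z'_{j'}(X))$, where $z_j,z'_{j'}\in k((X))$, the normalized contact is $\mathrm{noc}(f,f')=\max_{j,j'}\frac{1}{nn'}\mathrm{ord}_X[z_j(X^{n'})-z'_{j'}(X^n)]$ (so it is rational if $f\ne f'$ and $\infty$ if $f=f'$). Characteristic sequence. For $f\in R^\natural$ of $Y$-degree $n$, let $\mathrm{Supp}(z_1)$ be the set of exponents with nonzero coefficient in $z_1$ (it is the same for all $z_j$). Put $m_0=d_1=n$. If $f=Y$ put $h=0$. If $f\ne Y$ put $m_1=\min\mathrm{Supp}(z_1)$, $d_2=\gcd(m_0,m_1)$,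 and, for $i\ge 2$ as long as $d_i>1$, $m_i=\min(\mathrm{Supp}(z_1)\setminus d_i\mathbb Z)$ and $d_{i+1}=\gcd(m_0,\dots,m_i)$; $h\ge 1$ is the last index, so $d_{h+1}=1$. Put $c_i(f)=m_i/n$ for $1\le i\le h$. For $\lambda\in\mathbb Q$ let $p$ (resp. $p^*$) be the number of $i\in\{1,\dots,h\}$ with $c_i(f)<\lambda$ (resp. $c_i(f)\le\lambda$), and put $D(f,\lambda)=n/d_{p+1}$, $D^*(f,\lambda)=n/d_{p^*+1}$. Buds. A bud is a pair $B=(\sigma(B),\lambda(B))$ with $\emptyset\ne\sigma(B)\subset R^\natural$, $\lambda(B)\in\mathbb Q$, and $\mathrm{noc}(f,f')\ge\lambda(B)$ for all $f,f'\in\sigma(B)$. An improper bud is such a pair with $\lambda(B)=-\infty$ and $\sigma(B)$ any nonempty subset of $R^\natural$. A generalized bud is a bud or an improper bud. For a generalized bud $B$: $\tau(B)=\{f\in R^\natural:\mathrm{noc}(f,f')\ge\lambda(B)\ \forall f'\in\sigma(B)\}$, $\tau^*(B)=\{f\in\tau(B):\mathrm{noc}(f,f')>\lambda(B)\text{ for some }f'\in\sigma(B)\}$, $\tau'(B)=\tau(B)\setminus\tau^*(B)$ (for improper $B$, $\tau(B)=\tau^*(B)=R^\natural$). A strict bud is a bud with $\mathrm{noc}(f,f')>\lambda(B)$ for all $f,f'\in\sigma(B)$. For a bud $B$, $D(B)$ is the common value of $D(f,\lambda(B))$ for $f\in\tau(B)$; for a strict bud $B$, $D^*(B)$ is the common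 value of $D^*(f,\lambda(B))$ for $f\in\tau^*(B)$. For a generalized bud $B$, $R^*(B)$ is the set of all strict or improper buds $B'$ with $\lambda(B')=\lambda(B)$ and $\sigma(B')=\tau^*(B')\cap\sigma(B)$ (the stems of these $B'$ partition $\sigma(B)$). Put $D'(B)=-D(B)+\sum_{B'\in R^*(B)}D^*(B')$ if $B$ is a bud, and $D'(B)=-1+\sum_{B'\in R^*(B)}1$ if $B$ is improper (this is then $0$); $D''(B)=-D(B)+\sum_{f\in\sigma(B)}\deg_Yf$ if $B$ is a bud, and $D''(B)=-1+\sum_{f\in\sigma(B)}\deg_Yf$ if $B$ is improper. Slices. For a generalized bud $B$ and $H\in R$: $\Omega_B(H)=\prod_{1\le j\le\chi(H),\,H_j\in\tau(B)}H_j$ and $\Omega'_B(H)=\prod_{1\le j\le\chi(H),\,H_j\in\tau'(B)}H_j$. Tree of $H\in R$. The contact set is $C(H)=\{c_i(H_j): 1\le j\le\chi(H),\ 1\le i\le h\text{ for }H_j,\ c_i(H_j)\notin\mathbb Z\}\cup\{\mathrm{noc}(H_j,H_{j'}):j<j',\ H_j\ne H_{j'}\}$, a finite set of rationals. Let $\widehat\sigma=\{H_1,\dots,H_{\chi(H)}\}$ if $\chi(H)>0$ and $\widehat\sigma=\{Y\}$ if $\chi(H)=0$. The tree $T(H)$ is the finite set of generalized buds consisting of the improper bud with stem $\widehat\sigma$ (the root, denoted $R_\infty(T(H))$) and, for each $\lambda\in C(H)$, the buds $(\sigma,\lambda)$ where $\sigma$ runs over the equivalence classes of $\widehat\sigma$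 under the relation $\mathrm{noc}(f,f')\ge\lambda$. For $B$ in a tree $T$, $\pi(T,B)=\{B'\in T:\lambda(B')>\lambda(B)\text{ and }\tau(B')\subset\tau(B)\}$. *)

theory Defs
  imports
    "HOL-Computational_Algebra.Computational_Algebra"
    "HOL-Library.Extended"
begin

text \<open>
  The ring \<open>R = k((X))[Y]\<close> is the type \<open>'a fls poly\<close>, the coefficient field \<open>k\<close> being the type
  \<open>'a\<close>. Contacts and levels of buds live in \<open>rat extended\<close>, that is, in the rationals together
  with plus infinity (\<open>Pinf\<close>) and minus infinity (\<open>Minf\<close>).
\<close>

section \<open>Factorization\<close>

definition Rnat :: "'a::{alg_closed_field, field_char_0} fls poly set" where
  "Rnat = {f. lead_coeff f = 1 \<and> irreducible f}"

text \<open>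
  The multiset \<open>H\<^sub>1, \<dots>, H\<^sub>\<chi>\<close> of the factorization \<open>H = H\<^sub>0 H\<^sub>1 \<cdots> H\<^sub>\<chi>\<close> with \<open>H\<^sub>0\<close> in \<open>k((X))\<close>. The last
  conjunct matters only for \<open>H = 0\<close>.
\<close>

definition monic_factors ::
  "'a::{alg_closed_field, field_char_0} fls poly \<Rightarrow> 'a fls poly multiset" where
  "monic_factors H = (THE M. set_mset M \<subseteq> Rnat \<and> (\<exists>H0. H = [:H0:] * prod_mset M) \<and>
     (M = {#} \<longleftrightarrow> H \<in> range (\<lambda>c. [:c:])))"

definition monic_part ::
  "'a::{alg_closed_field, field_char_0} fls poly \<Rightarrow> 'a fls poly" where
  "monic_part H = prod_mset (monic_factors H)"

definition ideal_radical :: "'a::comm_ring_1 set \<Rightarrow> 'a set" where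
  "ideal_radical I = {g. \<exists>n\<ge>1. g ^ n \<in> I}"

definition devoid_of_multiple_factors :: "'a::comm_ring_1 \<Rightarrow> bool" where
  "devoid_of_multiple_factors F \<longleftrightarrow>
     F \<noteq> 0 \<and> ideal_radical (range (\<lambda>G. F * G)) = range (\<lambda>G. F * G)"

section \<open>Contact\<close>

text \<open>
  The roots \<open>z\<^sub>1, \<dots>, z\<^sub>n\<close> of \<open>f(X\<^sup>n, Y)\<close>, where \<open>n\<close> is the \<open>Y\<close>-degree of \<open>f\<close>. For \<open>f \<in> Rnat\<close>
  this polynomial splits over \<open>k((X))\<close> by Newton's theorem.
\<close>

definition newton_roots ::
  "'a::{alg_closed_field, field_char_0} fls poly \<Rightarrow> 'a fls set" where
  "newton_roots f = {z. poly (map_poly (\<lambda>c. fls_compose_power c (degree f)) f) z = 0}"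

definition scaled_ord :: "nat \<Rightarrow> 'a::zero fls \<Rightarrow> rat extended" where
  "scaled_ord N w =
     (if w = 0 then Pinf else Fin (rat_of_int (fls_subdegree w) / rat_of_nat N))"

definition noc ::
  "'a::{alg_closed_field, field_char_0} fls poly \<Rightarrow> 'a fls poly \<Rightarrow> rat extended" where
  "noc f f' = Max {scaled_ord (degree f * degree f')
       (fls_compose_power z (degree f') - fls_compose_power z' (degree f)) | z z'.
       z \<in> newton_roots f \<and> z' \<in> newton_roots f'}"

section \<open>Characteristic sequences\<close>

text \<open>The support is the same for all the roots, so any of them may be chosen.\<close>

definition newton_supp ::
  "'a::{alg_closed_field, field_char_0} fls poly \<Rightarrow> int set" where
  "newton_supp f = {e. fls_nth (SOME z. z \<in> newton_roots f) e \<noteq> 0}"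

text \<open>
  \<open>char_m f i\<close> is \<open>m\<^sub>i\<close> and \<open>char_d f i\<close> is \<open>d\<^sub>i = gcd(m\<^sub>0, \<dots>, m\<^bsub>i-1\<^esub>)\<close> for \<open>i \<ge> 1\<close>. The values
  of \<open>char_m f i\<close> for \<open>i > char_h f\<close> have no meaning and are never used.
\<close>

fun char_m :: "'a::{alg_closed_field, field_char_0} fls poly \<Rightarrow> nat \<Rightarrow> int" where
  "char_m f 0 = int (degree f)"
| "char_m f (Suc 0) = (LEAST s. s \<in> newton_supp f)"
| "char_m f (Suc (Suc i)) =
     (LEAST s. s \<in> newton_supp f \<and> \<not> Gcd (char_m f ` {..Suc i}) dvd s)"

definition char_d :: "'a::{alg_closed_field, field_char_0} fls poly \<Rightarrow> nat \<Rightarrow> int" where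
  "char_d f i = Gcd (char_m f ` {..<i})"

definition char_h :: "'a::{alg_closed_field, field_char_0} fls poly \<Rightarrow> nat" where
  "char_h f = (if f = [:0, 1:] then 0 else LEAST i. i \<ge> 1 \<and> char_d f (i + 1) = 1)"

definition char_c :: "'a::{alg_closed_field, field_char_0} fls poly \<Rightarrow> nat \<Rightarrow> rat" where
  "char_c f i = rat_of_int (char_m f i) / rat_of_nat (degree f)"

text \<open>The divisions below are exact, since \<open>char_d f i\<close> divides \<open>m\<^sub>0\<close> for \<open>i \<ge> 1\<close>.\<close>

definition D_poly ::
  "'a::{alg_closed_field, field_char_0} fls poly \<Rightarrow> rat extended \<Rightarrow> int" where
  "D_poly f l =
     int (degree f) div char_d f (card {i \<in> {1..char_h f}. Fin (char_c f i) < l} + 1)"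

definition D_star_poly ::
  "'a::{alg_closed_field, field_char_0} fls poly \<Rightarrow> rat extended \<Rightarrow> int" where
  "D_star_poly f l =
     int (degree f) div char_d f (card {i \<in> {1..char_h f}. Fin (char_c f i) \<le> l} + 1)"

section \<open>Buds\<close>

type_synonym 'a bud = "'a fls poly set \<times> rat extended"

abbreviation stem :: "'a::zero bud \<Rightarrow> 'a fls poly set" where "stem \<equiv> fst"
abbreviation level :: "'a::zero bud \<Rightarrow> rat extended" where "level \<equiv> snd"

definition is_bud :: "'a::{alg_closed_field, field_char_0} bud \<Rightarrow> bool" where
  "is_bud B \<longleftrightarrow> stem B \<noteq> {} \<and> stem B \<subseteq> Rnat \<and> level B \<in> range Fin \<and>
     (\<forall>f\<in>stem B. \<forall>f'\<in>stem B. noc f f' \<ge> level B)"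

definition is_improper_bud :: "'a::{alg_closed_field, field_char_0} bud \<Rightarrow> bool" where
  "is_improper_bud B \<longleftrightarrow> stem B \<noteq> {} \<and> stem B \<subseteq> Rnat \<and> level B = Minf"

definition is_strict_bud :: "'a::{alg_closed_field, field_char_0} bud \<Rightarrow> bool" where
  "is_strict_bud B \<longleftrightarrow> is_bud B \<and> (\<forall>f\<in>stem B. \<forall>f'\<in>stem B. noc f f' > level B)"

definition tau :: "'a::{alg_closed_field, field_char_0} bud \<Rightarrow> 'a fls poly set" where
  "tau B = {f \<in> Rnat. \<forall>f'\<in>stem B. noc f f' \<ge> level B}"

definition tau_star :: "'a::{alg_closed_field, field_char_0} bud \<Rightarrow> 'a fls poly set" where
  "tau_star B = {f \<in> tau B. \<exists>f'\<in>stem B. noc f f' > level B}"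

definition tau_prime :: "'a::{alg_closed_field, field_char_0} bud \<Rightarrow> 'a fls poly set" where
  "tau_prime B = tau B - tau_star B"

definition D_bud :: "'a::{alg_closed_field, field_char_0} bud \<Rightarrow> int" where
  "D_bud B = (THE d. \<forall>f\<in>tau B. D_poly f (level B) = d)"

definition D_star_bud :: "'a::{alg_closed_field, field_char_0} bud \<Rightarrow> int" where
  "D_star_bud B = (THE d. \<forall>f\<in>tau_star B. D_star_poly f (level B) = d)"

definition R_star :: "'a::{alg_closed_field, field_char_0} bud \<Rightarrow> 'a bud set" where
  "R_star B = {B'. (is_strict_bud B' \<or> is_improper_bud B') \<and> level B' = level B \<and>
     stem B' = tau_star B' \<inter> stem B}"

text \<open>
  The next two functions are meant for generalized buds with a finite stem, such as those of a
  tree; sums over infinite sets would be 0 by convention.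
\<close>

definition D_prime_bud :: "'a::{alg_closed_field, field_char_0} bud \<Rightarrow> int" where
  "D_prime_bud B =
     (if level B = Minf then - 1 + (\<Sum>B'\<in>R_star B. 1)
      else - D_bud B + (\<Sum>B'\<in>R_star B. D_star_bud B'))"

definition D_prime2_bud :: "'a::{alg_closed_field, field_char_0} bud \<Rightarrow> int" where
  "D_prime2_bud B =
     (if level B = Minf then - 1 + (\<Sum>f\<in>stem B. int (degree f))
      else - D_bud B + (\<Sum>f\<in>stem B. int (degree f)))"

section \<open>Slices\<close>

definition slice ::
  "'a::{alg_closed_field, field_char_0} bud \<Rightarrow> 'a fls poly \<Rightarrow> 'a fls poly" where
  "slice B H = prod_mset {#f \<in># monic_factors H. f \<in> tau B#}"

definition slice_prime ::
  "'a::{alg_closed_field, field_char_0} bud \<Rightarrow> 'a fls poly \<Rightarrow> 'a fls poly" where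
  "slice_prime B H = prod_mset {#f \<in># monic_factors H. f \<in> tau_prime B#}"

section \<open>The tree of a polynomial\<close>

definition contact_set :: "'a::{alg_closed_field, field_char_0} fls poly \<Rightarrow> rat set" where
  "contact_set H =
     {char_c f i | f i. f \<in># monic_factors H \<and> i \<in> {1..char_h f} \<and> char_c f i \<notin> \<int>} \<union>
     {l. \<exists>f f'. f \<in># monic_factors H \<and> f' \<in># monic_factors H \<and> f \<noteq> f' \<and> noc f f' = Fin l}"

definition root_stem ::
  "'a::{alg_closed_field, field_char_0} fls poly \<Rightarrow> 'a fls poly set" where
  "root_stem H = (if monic_factors H = {#} then {[:0, 1:]} else set_mset (monic_factors H))"

definition tree_root :: "'a::{alg_closed_field, field_char_0} fls poly \<Rightarrow> 'a bud" where
  "tree_root H = (root_stem H, Minf)"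

definition tree :: "'a::{alg_closed_field, field_char_0} fls poly \<Rightarrow> 'a bud set" where
  "tree H = insert (tree_root H)
     {(S, Fin l) | S l. l \<in> contact_set H \<and>
        S \<in> root_stem H // {(f, f'). f \<in> root_stem H \<and> f' \<in> root_stem H \<and> noc f f' \<ge> Fin l}}"

definition pi_tree ::
  "'a::{alg_closed_field, field_char_0} bud set \<Rightarrow> 'a bud \<Rightarrow> 'a bud set" where
  "pi_tree T B = {B' \<in> T. level B' > level B \<and> tau B' \<subseteq> tau B}"

end

theory Submission
  imports Defs
begin

text \<open>
  After the substitution \<open>X \<mapsto> X\<^sup>N\<close>, with \<open>N\<close> divisible by all the degrees that occur, every irreducible
  factor of \<open>F\<close> and of its derivative splits into linear factors over \<open>k((X))\<close> (Newton's theorem), and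
  the substitutions \<open>X \<mapsto> uX\<close> with \<open>u\<^sup>N = 1\<close> permute the roots of each factor transitively. Two series
  lie in the same ball \<open>{y. ord (y - a) \<ge> e}\<close> iff their truncations below \<open>X\<^sup>e\<close> agree. By transitivity,
  the sets of balls met by the roots of two irreducible polynomials are equal or disjoint, and
  equality means that the contact is at least \<open>e/N\<close>. So contact is an ultrametric, and the statement can
  be read off from the way in which the roots are distributed over the balls.

  Three facts carry the proof. The first is \<open>D_poly_eq_card_traces\<close>: the numbers \<open>D(f,\<lambda>)\<close> and
  \<open>D\<^sup>*(f,\<lambda>)\<close> are the numbers of closed and of open balls of radius \<open>\<lambda>\<close> that are met by the roots
  of \<open>f\<close>. The second is \<open>ball_count\<close>: a ball with \<open>r > 0\<close> roots of \<open>F\<close> contains exactly \<open>r - 1\<close> roots of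
  the derivative, since on the reduction of the rescaled polynomial modulo \<open>X\<close> differentiation
  lowers the degree by exactly one in characteristic zero. The third combines them: for a bud with
  stem \<open>\<sigma>\<close>, let \<open>d\<close> be the sum of the degrees of the members of \<open>\<sigma>\<close>. Summing over the closed balls that
  meet \<open>\<sigma>\<close> shows that the factors of the derivative in \<open>\<tau>\<close> have total degree \<open>d - D\<close>; summing over the
  open balls shows that those in \<open>\<tau>\<^sup>*\<close> have total degree \<open>d - \<Sum>D\<^sup>*\<close>. The two degree formulas
  follow, the second one by subtraction. At the root of the tree they only say that the derivative has
  degree \<open>deg F - 1\<close>.

  For the factorization of the slices, let \<open>\<lambda>\<close> be the largest contact of a factor \<open>g\<close> of the derivative
  with a factor of \<open>F\<close>. Then \<open>g\<close> lies in \<open>\<tau>'\<close> of the bud of level \<open>\<lambda>\<close> whose stem consists of the factors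
  of \<open>F\<close> at contact \<open>\<lambda>\<close> with \<open>g\<close>, and in \<open>\<tau>'\<close> of no other bud of the tree. That \<open>\<lambda>\<close> is in the contact set
  again follows from the count (\<open>critical_contact_in_contact_set\<close>): such a \<open>g\<close> exists only if some closed
  ball is met in more than one open ball, that is, if two factors have contact \<open>\<lambda>\<close> or \<open>\<lambda>\<close> is a
  characteristic exponent of a factor.
\<close>

unbundle fps_syntax

section \<open>Ring homomorphisms and polynomials\<close>

text \<open>
  The substitutions \<open>X \<mapsto> X\<^sup>N\<close> and \<open>X \<mapsto> uX\<close> on \<open>k((X))\<close>, the inclusion of \<open>k[[X]]\<close> in \<open>k((X))\<close> and the
  reduction of \<open>k[[X]]\<close> modulo \<open>X\<close> are all applied to the coefficients of polynomials in \<open>Y\<close>.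
\<close>

locale ring_morph =
  fixes \<phi> :: "'b::comm_ring_1 \<Rightarrow> 'c::comm_ring_1"
  assumes add: "\<phi> (x + y) = \<phi> x + \<phi> y"
    and mult: "\<phi> (x * y) = \<phi> x * \<phi> y"
    and one: "\<phi> 1 = 1"
begin

lemma zero: "\<phi> 0 = 0"
  using add[of 0 0] by simp

lemma sum: "\<phi> (\<Sum>i\<in>I. f i) = (\<Sum>i\<in>I. \<phi> (f i))"
  by (induction I rule: infinite_finite_induct) (auto simp: zero add)

lemma of_nat: "\<phi> (of_nat n) = of_nat n"
  by (induction n) (auto simp: zero one add)

lemma uminus: "\<phi> (- x) = - \<phi> x"
  using add[of x "- x"] by (simp add: zero eq_neg_iff_add_eq_0 add.commute)

lemma coeff_mp: "coeff (map_poly \<phi> p) i = \<phi> (coeff p i)"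
  by (simp add: coeff_map_poly zero)

lemma mp_add: "map_poly \<phi> (p + q) = map_poly \<phi> p + map_poly \<phi> q"
  by (rule poly_eqI) (simp add: coeff_mp add)

lemma mp_mult: "map_poly \<phi> (p * q) = map_poly \<phi> p * map_poly \<phi> q"
  by (rule poly_eqI) (simp add: coeff_mp coeff_mult sum mult)

lemma mp_1: "map_poly \<phi> 1 = 1"
  by (simp add: one)

lemma mp_pCons: "map_poly \<phi> (pCons a p) = pCons (\<phi> a) (map_poly \<phi> p)"
  by (simp add: map_poly_pCons zero)

lemma mp_linear: "map_poly \<phi> [:a, 1:] = [:\<phi> a, 1:]"
  by (simp add: mp_pCons one zero)

lemma mp_smult: "map_poly \<phi> (smult c p) = smult (\<phi> c) (map_poly \<phi> p)"
  by (rule poly_eqI) (simp add: coeff_mp mult)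

lemma mp_prod: "map_poly \<phi> (\<Prod>i\<in>I. f i) = (\<Prod>i\<in>I. map_poly \<phi> (f i))"
  by (induction I rule: infinite_finite_induct) (auto simp: mp_mult mp_1 one)

lemma poly_mp: "poly (map_poly \<phi> p) (\<phi> x) = \<phi> (poly p x)"
  by (induction p) (auto simp: mp_pCons mult add zero)

lemma degree_monic:
  assumes "lead_coeff p = 1"
  shows "degree (map_poly \<phi> p) = degree p" "lead_coeff (map_poly \<phi> p) = 1"
proof -
  have "degree p \<le> degree (map_poly \<phi> p)"
    by (rule le_degree) (simp add: coeff_mp assms one)
  then show d: "degree (map_poly \<phi> p) = degree p"
    by (intro order_antisym degree_le) (simp_all add: coeff_mp coeff_eq_0 zero)
  show "lead_coeff (map_poly \<phi> p) = 1"
    by (simp add: d coeff_mp assms one)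
qed

end

lemma (in ring_morph) coeff_mp_Suc:
  "\<phi> (of_nat (Suc i) * c) = of_nat (Suc i) * \<phi> c"
  by (simp add: mult of_nat add one)

lemma mp_pderiv:
  fixes \<phi> :: "'b::idom \<Rightarrow> 'c::idom"
  assumes "ring_morph \<phi>"
  shows "map_poly \<phi> (pderiv p) = pderiv (map_poly \<phi> p)"
proof -
  interpret ring_morph \<phi> by fact
  show ?thesis
    by (rule poly_eqI) (simp only: coeff_mp coeff_pderiv coeff_mp_Suc)
qed

lemma field_poly_bezout:
  fixes p q :: "'b::field poly"
  shows "\<exists>a b. (a * p + b * q) dvd p \<and> (a * p + b * q) dvd q"
proof (induction "if q = 0 then 0 else Suc (degree q)" arbitrary: p q rule: less_induct)
  case less
  show ?case
  proof (cases "q = 0")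
    case True
    then show ?thesis by (intro exI[of _ 1] exI[of _ 0]) simp
  next
    case False
    have "(if p mod q = 0 then 0 else Suc (degree (p mod q))) < (if q = 0 then 0 else Suc (degree q))"
      using False degree_mod_less'[of q p] by auto
    from less[OF this] obtain a b where
      ab: "(a * q + b * (p mod q)) dvd q" "(a * q + b * (p mod q)) dvd (p mod q)" by blast
    have eq: "a * q + b * (p mod q) = b * p + (a - b * (p div q)) * q"
      by (subst minus_div_mult_eq_mod[symmetric]) (simp add: algebra_simps)
    have "(a * q + b * (p mod q)) dvd p"
      using ab dvd_mod_iff by blast
    then show ?thesis using ab unfolding eq by blast
  qed
qed

text \<open>
  The linear equation to be solved at each step of Hensel's lemma. Reducing a Bezout solution modulo
  \<open>r\<close> bounds the degree of \<open>g\<close>, and the equation then bounds the degree of \<open>h\<close>.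
\<close>

lemma coprime_poly_solve:
  fixes r s :: "'b::field poly"
  assumes "coprime r s" "degree r > 0" "degree R < degree r + degree s"
  shows "\<exists>g h. g * s + r * h = R \<and> degree g < degree r \<and> (h = 0 \<or> degree h < degree s)"
proof -
  obtain a b where ab: "(a * r + b * s) dvd r" "(a * r + b * s) dvd s"
    using field_poly_bezout by blast
  then have "is_unit (a * r + b * s)" using assms(1) by (meson coprime_common_divisor)
  then obtain u where u: "(a * r + b * s) * u = 1" by (metis dvd_def)
  define g where "g = (b * u * R) mod r"
  define h where "h = a * u * R + (b * u * R) div r * s"
  have r: "r \<noteq> 0" using assms by auto
  have "g * s + r * h = (b * u * R) * s + r * (a * u * R)"
    unfolding g_def h_def by (subst minus_div_mult_eq_mod[symmetric]) (simp add: algebra_simps)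
  also have "\<dots> = ((a * r + b * s) * u) * R" by (simp add: algebra_simps)
  finally have eq: "g * s + r * h = R" by (simp add: u)
  have dg: "degree g < degree r" unfolding g_def using assms(2) r degree_mod_less'[of r "b * u * R"]
    by (cases "(b * u * R) mod r = 0") auto
  have "degree (r * h) < degree r + degree s"
  proof -
    have "r * h = R - g * s" using eq by (simp add: algebra_simps)
    moreover have "degree (g * s) < degree r + degree s"
      using dg degree_mult_le[of g s] by linarith
    ultimately show ?thesis using degree_diff_less[OF assms(3)] by simp
  qed
  then have "h = 0 \<or> degree h < degree s"
    using r by (cases "h = 0") (auto simp: degree_mult_eq)
  then show ?thesis using eq dg by blast
qed

section \<open>Roots of unity\<close>

text \<open>
  Integer exponents, because the exponents of a Laurent series may be negative.
\<close>

definition primitive_root :: "nat \<Rightarrow> 'b::field \<Rightarrow> bool" where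
  "primitive_root n w \<longleftrightarrow> w \<noteq> 0 \<and> (\<forall>j::int. w powi j = 1 \<longleftrightarrow> int n dvd j)"

lemma primitive_rootD:
  assumes "primitive_root n c"
  shows "c \<noteq> 0" "c powi j = 1 \<longleftrightarrow> int n dvd j"
  using assms unfolding primitive_root_def by (rule conjunct1, rule conjunct2[THEN spec])

text \<open>
  If \<open>w\<^sup>j = 1\<close>, then also \<open>w\<^sup>d = 1\<close> for \<open>d = gcd(n,j)\<close> by Bezout; if \<open>d\<close> were a proper divisor of \<open>n\<close>, it
  would divide \<open>n div p\<close> for some prime divisor \<open>p\<close> of \<open>n\<close>.
\<close>

lemma primitive_rootI:
  fixes w :: "'b::field"
  assumes "n > 0" "w ^ n = 1" "\<And>p. prime p \<Longrightarrow> p dvd n \<Longrightarrow> w ^ (n div p) \<noteq> 1"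
  shows "primitive_root n w"
  unfolding primitive_root_def
proof (intro conjI allI)
  show w0: "w \<noteq> 0" using assms(1,2) by (auto simp: power_0_left)
  fix j :: int
  show "w powi j = 1 \<longleftrightarrow> int n dvd j"
  proof
    assume "int n dvd j"
    then obtain k where "j = int n * k" by (elim dvdE)
    then show "w powi j = 1" using assms(2) by (simp add: power_int_mult)
  next
    assume j: "w powi j = 1"
    define d where "d = gcd (int n) j"
    obtain a b where "a * int n + b * j = d" unfolding d_def by (meson bezout_int)
    then have "w powi d = w powi (int n * a) * w powi (j * b)"
      using w0 by (simp add: power_int_add mult.commute flip: \<open>_ = d\<close>)
    also have "\<dots> = 1" using j assms(2) by (simp add: power_int_mult)
    finally have wd: "w powi d = 1" .
    have dpos: "d > 0" using assms(1) by (auto simp: d_def)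
    have ddvd: "nat d dvd n" unfolding d_def using assms(1)
      by (metis dpos d_def gcd_dvd1 int_dvd_int_iff int_nat_eq less_le_not_le nat_0_le)
    then obtain k where k: "n = nat d * k" by (elim dvdE)
    have "k = 1"
    proof (rule ccontr)
      assume "k \<noteq> 1"
      then obtain p where p: "prime p" "p dvd k" using prime_factor_nat by blast
      then obtain l where l: "k = p * l" by (elim dvdE)
      have "n div p = nat d * l" using p(1) by (simp add: k l prime_gt_0_nat)
      then have "w ^ (n div p) = (w powi d) ^ l" using dpos
        by (simp add: power_mult power_int_def)
      then show False using wd assms(3)[OF p(1)] p(2) k by simp
    qed
    then have "int n = d" using k dpos by simp
    then show "int n dvd j" unfolding d_def by (metis gcd_dvd2)
  qed
qed

lemma exists_nontrivial_prime_root: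
  assumes "prime p"
  shows "\<exists>w::'a::{alg_closed_field, field_char_0}. w ^ p = 1 \<and> w \<noteq> 1"
proof -
  define P where "P = (\<Sum>i<p. monom (1::'a) i)"
  have ev: "poly P x = (\<Sum>i<p. x ^ i)" for x by (simp add: P_def poly_sum poly_monom)
  have p: "p > 1" using assms by (rule prime_gt_1_nat)
  have "coeff P (p - 1) = 1" unfolding P_def using p by (simp add: coeff_sum coeff_monom)
  then have "degree P \<ge> p - 1" by (intro le_degree) simp
  then have "degree P > 0" using p by linarith
  then obtain x where x: "poly P x = 0" using alg_closed_imp_poly_has_root[of P] by auto
  have "x ^ p - 1 = (x - 1) * (\<Sum>i<p. x ^ i)" by (rule power_diff_1_eq)
  then have "x ^ p = 1" using x by (simp add: ev)
  moreover have "x \<noteq> 1" using x p by (auto simp: ev)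
  ultimately show ?thesis by blast
qed

text \<open>
  Let \<open>n = pm\<close> with \<open>p\<close> prime and let \<open>w\<close> be a primitive \<open>m\<close>-th root of unity. If \<open>p\<close> divides \<open>m\<close>, a \<open>p\<close>-th root
  of \<open>w\<close> is primitive of order \<open>n\<close>; otherwise the product of \<open>w\<close> with a nontrivial \<open>p\<close>-th root of unity is.
\<close>

lemma exists_primitive_root:
  assumes "n > 0"
  shows "\<exists>w::'a::{alg_closed_field, field_char_0}. primitive_root n w"
  using assms
proof (induction n rule: nat_less_induct)
  case (1 n)
  show ?case
  proof (cases "n = 1")
    case True
    then show ?thesis by (intro exI[of _ 1]) (simp add: primitive_root_def)
  next
    case False
    then obtain p where p: "prime p" "p dvd n" using prime_factor_nat by blast
    then obtain m where m: "n = p * m" by (elim dvdE)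
    have p1: "p > 1" using p(1) by (rule prime_gt_1_nat)
    have m0: "m > 0" "m < n" using 1(2) m p1 by auto
    then obtain w :: 'a where w: "primitive_root m w" using 1(1) by blast
    have wm: "w ^ j = 1 \<longleftrightarrow> m dvd j" for j
      using w[unfolded primitive_root_def] by (metis int_dvd_int_iff power_int_of_nat)
    show ?thesis
    proof (cases "p dvd m")
      case True
      obtain v where v: "v ^ p = w" using nth_root_exists[of p w] p1 by auto
      have "primitive_root n v"
      proof (rule primitive_rootI)
        show "n > 0" by fact
        show "v ^ n = 1" by (simp add: m power_mult v wm)
        fix q :: nat assume q: "prime q" "q dvd n"
        have qm: "q dvd m" using q True p(1) unfolding m
          by (metis prime_dvd_mult_iff primes_dvd_imp_eq)
        then obtain l where l: "m = q * l" by (elim dvdE)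
        have q0: "q > 1" using q(1) by (rule prime_gt_1_nat)
        have "n div q = p * l" using q0 by (simp add: m l)
        then have "v ^ (n div q) = w ^ l" by (simp add: power_mult v)
        moreover have "\<not> m dvd l" using l m0(1) q0 by (auto dest!: dvd_imp_le)
        ultimately show "v ^ (n div q) \<noteq> 1" using wm by simp
      qed
      then show ?thesis by blast
    next
      case False
      obtain u :: 'a where u: "u ^ p = 1" "u \<noteq> 1" using exists_nontrivial_prime_root[OF p(1)] by blast
      have "primitive_root n (w * u)"
      proof (rule primitive_rootI)
        show "n > 0" by fact
        show "(w * u) ^ n = 1" using u wm[of "p * m"] by (simp add: m power_mult_distrib power_mult)
        fix q :: nat assume q: "prime q" "q dvd n"
        have q0: "q > 1" using q(1) by (rule prime_gt_1_nat)
        show "(w * u) ^ (n div q) \<noteq> 1"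
        proof (cases "q = p")
          case True
          have "n div q = m" using True p1 by (simp add: m)
          moreover have "w ^ m = 1" by (simp add: wm)
          moreover have "u ^ m \<noteq> 1"
          proof
            assume um: "u ^ m = 1"
            have "coprime m p" using prime_imp_coprime[OF p(1) False] by (simp add: coprime_commute)
            then obtain a b :: int where "a * int m + b * int p = 1"
              by (metis bezout_int coprime_imp_gcd_eq_1 coprime_int_iff)
            moreover have "u \<noteq> 0" using u p1 by (auto simp: power_0_left)
            ultimately have "u = u powi (int m * a) * u powi (int p * b)"
              by (metis mult.commute power_int_1_right power_int_add)
            also have "\<dots> = 1" using um u(1) by (simp add: power_int_mult)
            finally show False using u(2) by simp
          qed
          ultimately show ?thesis by (simp add: power_mult_distrib)
        next
          case qp: False
          then have qm: "q dvd m" using q p(1) unfolding m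
            by (metis prime_dvd_mult_iff primes_dvd_imp_eq)
          then obtain l where l: "m = q * l" by (elim dvdE)
          have eq: "n div q = p * l" using q0 by (simp add: m l)
          have "u ^ (p * l) = 1" using u(1) by (simp add: power_mult)
          moreover have "\<not> m dvd p * l"
          proof
            assume "m dvd p * l"
            then have "q * l dvd p * l" by (simp add: l)
            then have "q dvd p" using l m0(1) by (simp add: mult.commute[of _ l])
            then show False using qp q(1) p(1) primes_dvd_imp_eq by blast
          qed
          ultimately show ?thesis using wm by (simp add: eq power_mult_distrib)
        qed
      qed
      then show ?thesis by blast
    qed
  qed
qed

section \<open>Hensel's lemma\<close>

lemma ring_morph_fps_nth_0: "ring_morph (\<lambda>c::'b::comm_ring_1 fps. fps_nth c 0)"
  by unfold_locales auto

text \<open>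
  Writing \<open>G = \<Sum>g\<^sub>m X\<^sup>m\<close> and \<open>H = \<Sum>h\<^sub>m X\<^sup>m\<close> with \<open>g\<^sub>m\<close> and \<open>h\<^sub>m\<close> in \<open>k[Y]\<close>, the coefficient of \<open>X\<^sup>m\<close> in the
  equation \<open>Q = G H\<close> expresses \<open>g\<^sub>m s + r h\<^sub>m\<close> through earlier coefficients. As \<open>r\<close> and \<open>s\<close> are coprime, this can be
  solved within the degree bounds that make \<open>G\<close> and \<open>H\<close> polynomials in \<open>Y\<close>.
\<close>

lemma hensel_factorization:
  fixes Q :: "'b::field fps poly"
  assumes lc: "lead_coeff Q = 1"
    and red: "map_poly (\<lambda>c. fps_nth c 0) Q = r * s"
    and cop: "coprime r s" and dr: "degree r > 0" and ds: "degree s > 0"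
  shows "\<exists>G H. Q = G * H \<and> degree G = degree r"
proof -
  define n where "n = degree Q"
  define q where "q m = map_poly (\<lambda>c. fps_nth c m) Q" for m
  have cq: "coeff (q m) i = fps_nth (coeff Q i) m" for m i
    by (simp add: q_def coeff_map_poly)
  have n: "n = degree r + degree s"
    using ring_morph.degree_monic(1)[OF ring_morph_fps_nth_0 lc] red dr ds
      degree_mult_eq[of r s] by (force simp: n_def)
  have dq: "degree (q m) < n" if "m > 0" for m
  proof -
    have "degree (q m) \<le> n - 1"
    proof (rule degree_le, intro allI impI)
      fix i assume "i > n - 1"
      then consider "i = n" | "i > n" using n dr by linarith
      then show "coeff (q m) i = 0"
        using lc that by cases (auto simp: cq n_def coeff_eq_0)
    qed
    then show ?thesis using n dr by linarith
  qed
  \<comment> \<open>the equation for the pair of \<open>m\<close>-th coefficients, given the function \<open>f\<close> of the earlier ones\<close>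
  define P :: "(nat \<Rightarrow> 'b poly \<times> 'b poly) \<Rightarrow> nat \<Rightarrow> 'b poly \<times> 'b poly \<Rightarrow> bool" where
    "P f m p \<longleftrightarrow> (if m = 0 then p = (r, s) else
       fst p * s + r * snd p = q m - (\<Sum>i\<in>{1..<m}. fst (f i) * snd (f (m - i))) \<and>
       degree (fst p) < degree r \<and> (snd p = 0 \<or> degree (snd p) < degree s))" for f m p
  have "\<exists>f. \<forall>m. P f m (f m)"
  proof (rule dependent_wf_choice[OF wf_less])
    fix f g :: "nat \<Rightarrow> 'b poly \<times> 'b poly" and m p
    assume eq: "\<And>z. (z, m) \<in> {(x, y). x < y} \<Longrightarrow> f z = g z"
    have "(\<Sum>i\<in>{1..<m}. fst (f i) * snd (f (m - i))) = (\<Sum>i\<in>{1..<m}. fst (g i) * snd (g (m - i)))"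
      by (rule sum.cong) (auto simp: eq)
    then show "P f m p = P g m p" by (simp add: P_def)
  next
    fix m and f :: "nat \<Rightarrow> 'b poly \<times> 'b poly"
    assume IH: "\<And>y. (y, m) \<in> {(x, y). x < y} \<Longrightarrow> P f y (f y)"
    show "\<exists>p. P f m p"
    proof (cases "m = 0")
      case True
      then show ?thesis by (simp add: P_def)
    next
      case False
      have "degree (\<Sum>i\<in>{1..<m}. fst (f i) * snd (f (m - i))) < n"
      proof (rule degree_sum_less)
        fix i assume i: "i \<in> {1..<m}"
        then have "degree (fst (f i)) < degree r" "degree (snd (f (m - i))) \<le> degree s"
          using IH[of i] IH[of "m - i"] by (auto simp: P_def)
        then show "degree (fst (f i) * snd (f (m - i))) < n"
          using degree_mult_le[of "fst (f i)" "snd (f (m - i))"] n by linarith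
      qed (use n dr in simp)
      then have "degree (q m - (\<Sum>i\<in>{1..<m}. fst (f i) * snd (f (m - i)))) < degree r + degree s"
        using dq[of m] False n by (intro degree_diff_less) auto
      from coprime_poly_solve[OF cop dr this] obtain g h where
        "g * s + r * h = q m - (\<Sum>i\<in>{1..<m}. fst (f i) * snd (f (m - i)))"
        "degree g < degree r" "h = 0 \<or> degree h < degree s" by blast
      then have "P f m (g, h)" using False by (simp add: P_def)
      then show ?thesis by blast
    qed
  qed
  then obtain f where f: "\<And>m. P f m (f m)" by blast
  define g h where "g m = fst (f m)" and "h m = snd (f m)" for m
  have g0: "g 0 = r" and h0: "h 0 = s" using f[of 0] by (auto simp: P_def g_def h_def)
  have dg: "degree (g m) \<le> degree r" and dh: "degree (h m) \<le> degree s" for m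
    using f[of m] by (auto simp: P_def g_def h_def split: if_splits)
  have gh: "(\<Sum>j=0..m. g j * h (m - j)) = q m" for m
  proof (cases "m = 0")
    case True
    then show ?thesis using red by (simp add: g0 h0 q_def)
  next
    case False
    then have "{0..m} = insert 0 (insert m {1..<m})" by auto
    then have "(\<Sum>j=0..m. g j * h (m - j)) = r * h m + (g m * s + (\<Sum>i\<in>{1..<m}. g i * h (m - i)))"
      using False by (simp add: g0 h0)
    also have "\<dots> = q m" using f[of m] False by (simp add: P_def g_def h_def algebra_simps)
    finally show ?thesis .
  qed
  define G where "G = (\<Sum>i\<le>degree r. monom (Abs_fps (\<lambda>m. coeff (g m) i)) i)"
  define H where "H = (\<Sum>i\<le>degree s. monom (Abs_fps (\<lambda>m. coeff (h m) i)) i)"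
  have cG: "coeff G i = Abs_fps (\<lambda>m. coeff (g m) i)" for i
  proof (cases "i \<le> degree r")
    case True
    then show ?thesis by (simp add: G_def coeff_sum coeff_monom)
  next
    case False
    then have "coeff (g m) i = 0" for m using dg[of m] by (intro coeff_eq_0) linarith
    then show ?thesis using False by (auto simp: G_def coeff_sum coeff_monom fps_eq_iff)
  qed
  have cH: "coeff H i = Abs_fps (\<lambda>m. coeff (h m) i)" for i
  proof (cases "i \<le> degree s")
    case True
    then show ?thesis by (simp add: H_def coeff_sum coeff_monom)
  next
    case False
    then have "coeff (h m) i = 0" for m using dh[of m] by (intro coeff_eq_0) linarith
    then show ?thesis using False by (auto simp: H_def coeff_sum coeff_monom fps_eq_iff)
  qed
  have "Q = G * H"
  proof (rule poly_eqI, rule fps_ext)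
    fix k m
    have "fps_nth (coeff (G * H) k) m = (\<Sum>i\<le>k. \<Sum>j=0..m. coeff (g j) i * coeff (h (m - j)) (k - i))"
      by (simp add: coeff_mult fps_sum_nth fps_mult_nth cG cH)
    also have "\<dots> = (\<Sum>j=0..m. coeff (g j * h (m - j)) k)"
      by (subst sum.swap) (simp add: coeff_mult)
    also have "\<dots> = coeff (q m) k" by (simp add: coeff_sum flip: gh)
    finally show "fps_nth (coeff Q k) m = fps_nth (coeff (G * H) k) m" by (simp add: cq)
  qed
  moreover have "degree G = degree r"
  proof (rule order_antisym)
    show "degree G \<le> degree r" unfolding G_def
      by (intro degree_sum_le) (auto intro: order_trans[OF degree_monom_le])
    have "fps_nth (coeff G (degree r)) 0 = lead_coeff r" by (simp add: cG g0)
    also have "\<dots> \<noteq> 0" using dr by auto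
    finally show "degree r \<le> degree G" by (intro le_degree) auto
  qed
  ultimately show ?thesis by blast
qed

section \<open>Existence of Puiseux roots\<close>

lemma ring_morph_compose_power:
  "N > 0 \<Longrightarrow> ring_morph (\<lambda>c::'b::idom fls. fls_compose_power c N)"
  by unfold_locales auto

lemma ring_morph_fps_to_fls: "ring_morph (fps_to_fls :: 'b::comm_ring_1 fps \<Rightarrow> _)"
  by unfold_locales (auto simp: fls_times_fps_to_fls)

lemma fls_compose_power_inj:
  assumes "N > 0"
  shows "fls_compose_power c N = fls_compose_power d N \<longleftrightarrow> c = d"
proof
  assume eq: "fls_compose_power c N = fls_compose_power d N"
  show "c = d"
  proof (rule fls_eqI)
    fix k
    have "fls_compose_power c N $$ (int N * k) = fls_compose_power d N $$ (int N * k)"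
      by (simp add: eq)
    then show "c $$ k = d $$ k" using assms by (simp add: fls_nth_compose_power)
  qed
qed simp

lemma fls_compose_power_eq_0_iff [simp]:
  "N > 0 \<Longrightarrow> fls_compose_power c N = 0 \<longleftrightarrow> c = 0"
  using fls_compose_power_inj[of N c 0] by simp

lemma fls_compose_power_compose:
  assumes "M > 0" "N > 0"
  shows "fls_compose_power (fls_compose_power c M) N = fls_compose_power c (M * N)"
proof (rule fls_eqI)
  fix k :: int
  show "fls_compose_power (fls_compose_power c M) N $$ k = fls_compose_power c (M * N) $$ k"
  proof (cases "int N dvd k")
    case True
    then obtain l where l: "k = int N * l" by (elim dvdE)
    then show ?thesis using assms
      by (simp add: fls_nth_compose_power mult.commute[of "int M"])
  next
    case False
    then have "\<not> int (M * N) dvd k" by (metis dvd_mult_right of_nat_mult)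
    then show ?thesis using False assms by (simp add: fls_nth_compose_power)
  qed
qed

lemma fls_subdegree_compose_power:
  assumes "N > 0"
  shows "fls_subdegree (fls_compose_power c N) = int N * fls_subdegree c"
proof (cases "c = 0")
  case False
  show ?thesis
  proof (rule fls_subdegree_eqI)
    show "fls_compose_power c N $$ (int N * fls_subdegree c) \<noteq> 0"
      using assms False by (simp add: fls_nth_compose_power)
    fix k assume k: "k < int N * fls_subdegree c"
    show "fls_compose_power c N $$ k = 0"
    proof (cases "int N dvd k")
      case True
      then obtain l where l: "k = int N * l" by (elim dvdE)
      with k assms have "l < fls_subdegree c" by simp
      then show ?thesis using assms by (simp add: fls_nth_compose_power l)
    qed (use assms in \<open>simp add: fls_nth_compose_power\<close>)
  qed
qed simp

abbreviation compose_power_poly :: "nat \<Rightarrow> 'b::idom fls poly \<Rightarrow> 'b fls poly" where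
  "compose_power_poly N \<equiv> map_poly (\<lambda>c. fls_compose_power c N)"

lemma compose_power_poly_compose:
  assumes "M > 0" "N > 0"
  shows "compose_power_poly N (compose_power_poly M p) = compose_power_poly (M * N) p"
  by (rule poly_eqI) (simp add: coeff_map_poly fls_compose_power_compose assms)

lemma (in ring_morph) mp_pcompose:
  "map_poly \<phi> (pcompose p q) = pcompose (map_poly \<phi> p) (map_poly \<phi> q)"
  by (induction p) (auto simp: pcompose_pCons mp_pCons mp_add mp_mult zero)

lemma coeff_pcompose_shift_subleading:
  fixes p :: "'b::idom poly"
  assumes n: "degree p = n" "n > 0"
  shows "coeff (pcompose p [:b, 1:]) (n - 1) = coeff p (n - 1) + of_nat n * b * coeff p n"
proof -
  have "pcompose p [:b, 1:] = (\<Sum>i\<le>n. smult (coeff p i) ([:b, 1:] ^ i))"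
    unfolding pcompose_altdef poly_altdef by (simp add: degree_map_poly coeff_map_poly n)
  then have "coeff (pcompose p [:b, 1:]) (n - 1) = (\<Sum>i\<le>n. coeff p i * coeff ([:b, 1:] ^ i) (n - 1))"
    by (simp add: coeff_sum)
  also have "\<dots> = (\<Sum>i\<in>{n - 1, n}. coeff p i * coeff ([:b, 1:] ^ i) (n - 1))"
  proof (rule sum.mono_neutral_right)
    show "\<forall>i\<in>{..n} - {n - 1, n}. coeff p i * coeff ([:b, 1:] ^ i) (n - 1) = 0"
    proof
      fix i assume "i \<in> {..n} - {n - 1, n}"
      then have "degree ([:b, 1:] ^ i) < n - 1" by (auto simp: degree_linear_power)
      then show "coeff p i * coeff ([:b, 1:] ^ i) (n - 1) = 0" by (simp add: coeff_eq_0)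
    qed
  qed auto
  also have "\<dots> = coeff p (n - 1) + of_nat n * b * coeff p n"
  proof -
    obtain m where m: "n = Suc m" using n(2) by (cases n) auto
    have "coeff ([:b, 1:] ^ Suc m) m = of_nat (Suc m) * b"
      by (subst coeff_linear_poly_power) auto
    then show ?thesis by (simp add: m coeff_linear_power mult.commute del: power_Suc)
  qed
  finally show ?thesis .
qed

text \<open>
  The step of Newton's algorithm. With \<open>p/q\<close> the minimum of \<open>ord a\<^sub>i / (n - i)\<close> over the coefficients
  \<open>a\<^sub>i\<close> with \<open>i < n\<close>, the substitution \<open>X \<mapsto> X\<^sup>q\<close>, \<open>Y \<mapsto> X\<^sup>p Y\<close> turns \<open>P\<close> into \<open>X\<^sup>p\<^sup>n\<close> times a polynomial \<open>Q\<close>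
  over \<open>k[[X]]\<close>, and a minimal index gives a coefficient of \<open>Q\<close> that survives modulo \<open>X\<close>.
\<close>

lemma newton_slope:
  fixes P :: "'b::idom fls poly"
  assumes deg: "degree P = n" and lc: "lead_coeff P = 1"
    and ex: "\<exists>i<n. coeff P i \<noteq> 0"
  shows "\<exists>q>0. \<exists>p. \<exists>Q. degree Q = n \<and> lead_coeff Q = 1 \<and>
    (\<exists>i<n. fps_nth (coeff Q i) 0 \<noteq> 0) \<and>
    (\<forall>i\<le>n. fls_compose_power (coeff P i) q = fps_to_fls (coeff Q i) * fls_X_intpow (p * int (n - i)))"
proof -
  define I where "I = {i. i < n \<and> coeff P i \<noteq> 0}"
  define v where "v i = rat_of_int (fls_subdegree (coeff P i)) / rat_of_nat (n - i)" for i
  have I: "finite I" "I \<noteq> {}" using ex by (auto simp: I_def)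
  define i0 where "i0 = arg_min_on v I"
  have i0: "i0 \<in> I" "\<And>i. i \<in> I \<Longrightarrow> v i0 \<le> v i"
    unfolding i0_def using arg_min_if_finite(1)[OF I] arg_min_least[OF I] by auto
  define q where "q = n - i0"
  define p where "p = fls_subdegree (coeff P i0)"
  have q: "q > 0" using i0(1) by (simp add: I_def q_def)
  have sub: "p * int (n - i) \<le> int q * fls_subdegree (coeff P i)" if "i \<in> I" for i
  proof -
    have "n - i > 0" using that by (simp add: I_def)
    then have "rat_of_int p * rat_of_nat (n - i) \<le> rat_of_nat q * rat_of_int (fls_subdegree (coeff P i))"
      using i0(2)[OF that] q by (simp add: v_def q_def p_def field_simps)
    then have "rat_of_int (p * int (n - i)) \<le> rat_of_int (int q * fls_subdegree (coeff P i))"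
      by simp
    then show ?thesis by (simp only: of_int_le_iff)
  qed
  define c where "c i = fls_compose_power (coeff P i) q" for i
  define Qc where "Qc i = fls_regpart (fls_shift (p * int (n - i)) (c i))" for i
  have Qc: "fps_to_fls (Qc i) * fls_X_intpow (p * int (n - i)) = c i" if "i \<le> n" for i
  proof -
    have "fls_subdegree (fls_shift (p * int (n - i)) (c i)) \<ge> 0"
    proof (cases "coeff P i = 0")
      case False
      show ?thesis
      proof (cases "i = n")
        case True
        then show ?thesis using lc deg q by (simp add: c_def)
      next
        case ne: False
        then have "i \<in> I" using False that by (simp add: I_def)
        then show ?thesis using sub[of i] False q
          by (simp add: c_def fls_subdegree_compose_power)
      qed
    qed (simp add: c_def)
    then have "fps_to_fls (Qc i) = fls_shift (p * int (n - i)) (c i)"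
      unfolding Qc_def by (rule fls_regpart_to_fls_trivial)
    then show ?thesis by (simp add: fls_X_intpow_times_conv_shift)
  qed
  define Q where "Q = (\<Sum>i\<le>n. monom (Qc i) i)"
  have cQ: "coeff Q i = (if i \<le> n then Qc i else 0)" for i
    by (simp add: Q_def coeff_sum coeff_monom)
  have Qn: "Qc n = 1" using lc deg q by (auto simp: Qc_def c_def)
  have dQ: "degree Q = n"
  proof (rule order_antisym)
    show "degree Q \<le> n" by (rule degree_le) (simp add: cQ)
    show "n \<le> degree Q" by (rule le_degree) (simp add: cQ Qn)
  qed
  have "fps_nth (coeff Q i0) 0 \<noteq> 0"
  proof -
    have "fps_nth (coeff Q i0) 0 = c i0 $$ (p * int q)"
      using i0(1) by (simp add: cQ I_def Qc_def q_def)
    also have "\<dots> = coeff P i0 $$ p"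
      using q by (simp add: c_def fls_nth_compose_power)
    also have "\<dots> \<noteq> 0" using i0(1) by (simp add: p_def I_def)
    finally show ?thesis .
  qed
  moreover have "i0 < n" using i0(1) by (simp add: I_def)
  ultimately have ex0: "\<exists>i<n. fps_nth (coeff Q i) 0 \<noteq> 0" by blast
  have lQ: "lead_coeff Q = 1" by (simp add: dQ cQ Qn)
  have "\<forall>i\<le>n. fls_compose_power (coeff P i) q = fps_to_fls (coeff Q i) * fls_X_intpow (p * int (n - i))"
    using Qc by (simp add: cQ c_def del: of_nat_diff)
  then show ?thesis using q dQ lQ ex0 by blast
qed

text \<open>
  If the reduction modulo \<open>X\<close> were a power \<open>(Y - x)\<^sup>n\<close>, its vanishing subleading coefficient \<open>- n x\<close> would force
  \<open>x = 0\<close>, against \<open>ex\<close>. So the reduction has two distinct roots, hence a coprime factorization, which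
  Hensel's lemma lifts.
\<close>

lemma fps_poly_reducible:
  fixes Q :: "'a::{alg_closed_field, field_char_0} fps poly"
  assumes deg: "degree Q = n" and lc: "lead_coeff Q = 1" and n: "n > 0"
    and sub: "coeff Q (n - 1) = 0" and ex: "\<exists>i<n. fps_nth (coeff Q i) 0 \<noteq> 0"
  shows "\<exists>G H. Q = G * H \<and> degree G > 0 \<and> degree G < n"
proof -
  define R where "R = map_poly (\<lambda>c. fps_nth c 0) Q"
  have cR: "coeff R i = fps_nth (coeff Q i) 0" for i by (simp add: R_def coeff_map_poly)
  have dR: "degree R = n" and lR: "lead_coeff R = 1"
    using ring_morph.degree_monic[OF ring_morph_fps_nth_0 lc] deg by (auto simp: R_def)
  have R0: "R \<noteq> 0" using lR by auto
  from ex obtain i where i: "i < n" "coeff R i \<noteq> 0" by (auto simp: cR)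
  have n1: "n > 1"
  proof (rule ccontr)
    assume "\<not> n > 1"
    then have "n - 1 = i" using i(1) n by simp
    then show False using i(2) sub by (simp add: cR)
  qed
  obtain A where A: "size A = n" "R = (\<Prod>x\<in>#A. [:-x, 1:])"
    using alg_closed_imp_factorization[OF R0] lR dR by auto
  obtain x where x: "x \<in># A" using A(1) n by (metis size_eq_0_iff_empty less_irrefl multiset_nonemptyE)
  have "\<exists>y\<in>#A. y \<noteq> x"
  proof (rule ccontr)
    assume "\<not> (\<exists>y\<in>#A. y \<noteq> x)"
    then have "set_mset A \<subseteq> {x}" by blast
    then have "A = replicate_mset n x" using set_mset_subset_singletonD[of A x] A(1) by simp
    then have R: "R = [:-x, 1:] ^ n" using A(2) by simp
    have "coeff ([:-x, 1:] ^ n) (n - 1) = of_nat n * (- x)"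
    proof -
      obtain m where m: "n = Suc m" using n by (cases n) auto
      have "coeff ([:-x, 1:] ^ Suc m) m = of_nat (Suc m) * (- x)"
        by (subst coeff_linear_poly_power) auto
      then show ?thesis by (simp add: m del: power_Suc)
    qed
    then have "x = 0" using sub n by (simp add: R[symmetric] cR)
    then have "R = monom 1 n" by (simp add: R monom_altdef)
    then show False using i by simp
  qed
  then obtain y where y: "y \<in># A" "y \<noteq> x" by blast
  have "poly R x = 0" "poly R y = 0" using x y by (auto simp: A(2) poly_prod_mset)
  then obtain r s where rs: "degree r > 0" "degree s > 0" "coprime r s" "R = r * s"
    using alg_closed_imp_poly_splits_coprime[of R x y] y(2) dR n1 by metis
  from hensel_factorization[OF lc rs(4)[unfolded R_def] rs(3,1,2)] obtain G H where
    "Q = G * H" "degree G = degree r" by blast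
  moreover have "r \<noteq> 0" "s \<noteq> 0" using rs(1,2) by auto
  then have "n = degree r + degree s" using rs(4) dR by (simp add: degree_mult_eq)
  ultimately show ?thesis using rs by (intro exI[of _ G] exI[of _ H]) auto
qed

text \<open>
  A translation removes the subleading coefficient, and then the slope substitution and Hensel's lemma
  lead to a polynomial of smaller degree, whose root is transported back.
\<close>

lemma puiseux_root:
  fixes P :: "'a::{alg_closed_field, field_char_0} fls poly"
  assumes "degree P > 0"
  shows "\<exists>N>0. \<exists>z. poly (compose_power_poly N P) z = 0"
  using assms
proof (induction "degree P" arbitrary: P rule: less_induct)
  case (less P)
  define n where "n = degree P"
  have n: "n > 0" using less.prems by (simp add: n_def)
  define P1 where "P1 = smult (inverse (lead_coeff P)) P"
  have P0: "P \<noteq> 0" using less.prems by auto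
  have P1: "degree P1 = n" "coeff P1 n = 1" using P0 by (auto simp: P1_def n_def)
  define b where "b = - coeff P1 (n - 1) / of_nat n"
  define P2 where "P2 = pcompose P1 [:b, 1:]"
  have dP2: "degree P2 = n" by (simp add: P2_def degree_pcompose P1)
  have lP2: "lead_coeff P2 = 1" unfolding P2_def using P1 by (subst lead_coeff_comp) auto
  have sP2: "coeff P2 (n - 1) = 0" unfolding P2_def
    using coeff_pcompose_shift_subleading[OF P1(1) n, of b] n P1(2) by (simp add: b_def)
  have "\<exists>N>0. \<exists>z. poly (compose_power_poly N P2) z = 0"
  proof (cases "\<exists>i<n. coeff P2 i \<noteq> 0")
    case False
    then have "poly (compose_power_poly 1 P2) 0 = 0"
      using n by (simp add: poly_0_coeff_0 coeff_map_poly)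
    then show ?thesis by (intro exI[of _ 1] conjI exI[of _ 0]) auto
  next
    case True
    from newton_slope[OF dP2 lP2 True] obtain q p Q where q: "q > 0"
      and Q: "degree Q = n" "lead_coeff Q = 1" "\<exists>i<n. fps_nth (coeff Q i) 0 \<noteq> 0"
      and eq: "\<And>i. i \<le> n \<Longrightarrow> fls_compose_power (coeff P2 i) q =
                fps_to_fls (coeff Q i) * fls_X_intpow (p * int (n - i))" by blast
    have "coeff Q (n - 1) = 0" using eq[of "n - 1"] sP2 by simp
    from fps_poly_reducible[OF Q(1,2) n this Q(3)] obtain G H where
      GH: "Q = G * H" "degree G > 0" "degree G < n" by blast
    have "degree (map_poly fps_to_fls G) = degree G" by (rule degree_map_poly) simp
    then obtain N w where N: "N > 0" and w: "poly (compose_power_poly N (map_poly fps_to_fls G)) w = 0"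
      using less.hyps[of "map_poly fps_to_fls G"] GH by (auto simp: n_def)
    interpret cp: ring_morph "\<lambda>c::'a fls. fls_compose_power c N" by (rule ring_morph_compose_power[OF N])
    define Q' where "Q' = compose_power_poly N (map_poly fps_to_fls Q)"
    have "poly Q' w = 0" using w unfolding Q'_def GH
      by (simp add: ring_morph.mp_mult[OF ring_morph_fps_to_fls] cp.mp_mult)
    moreover have "degree Q' = n" unfolding Q'_def using Q(1) N by (simp add: degree_map_poly)
    ultimately have rt: "(\<Sum>i\<le>n. coeff Q' i * w ^ i) = 0" by (simp add: poly_altdef)
    define T :: "'a fls" where "T = fls_X_intpow (int N * p)"
    have c: "coeff (compose_power_poly (q * N) P2) i = coeff Q' i * T ^ (n - i)" if "i \<le> n" for i
    proof -
      have "coeff (compose_power_poly (q * N) P2) i = fls_compose_power (fls_compose_power (coeff P2 i) q) N"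
        by (simp add: coeff_map_poly fls_compose_power_compose q N)
      also have "\<dots> = coeff Q' i * fls_X_intpow (int N * (p * int (n - i)))"
        using N by (simp add: eq[OF that] Q'_def coeff_map_poly)
      also have "fls_X_intpow (int N * (p * int (n - i))) = T ^ (n - i)"
        by (simp add: T_def fls_X_intpow_power mult_ac)
      finally show ?thesis .
    qed
    have "degree (compose_power_poly (q * N) P2) = n"
      using N q by (subst degree_map_poly) (auto simp: dP2)
    then have "poly (compose_power_poly (q * N) P2) (T * w) =
        (\<Sum>i\<le>n. coeff (compose_power_poly (q * N) P2) i * (T * w) ^ i)" by (simp add: poly_altdef)
    also have "\<dots> = (\<Sum>i\<le>n. T ^ n * (coeff Q' i * w ^ i))"
    proof (rule sum.cong[OF refl])
      fix i assume "i \<in> {..n}"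
      then have i: "i \<le> n" by simp
      then have Tn: "T ^ n = T ^ (n - i) * T ^ i" by (simp flip: power_add)
      show "coeff (compose_power_poly (q * N) P2) i * (T * w) ^ i = T ^ n * (coeff Q' i * w ^ i)"
        unfolding c[OF i] power_mult_distrib Tn by (simp only: mult_ac)
    qed
    also have "\<dots> = 0" using rt by (simp flip: sum_distrib_left)
    finally show ?thesis using N q by (intro exI[of _ "q * N"]) auto
  qed
  then obtain N z where N: "N > 0" and z: "poly (compose_power_poly N P2) z = 0" by blast
  interpret cp: ring_morph "\<lambda>c::'a fls. fls_compose_power c N" by (rule ring_morph_compose_power[OF N])
  have "poly (compose_power_poly N P1) (fls_compose_power b N + z) = 0"
    using z unfolding P2_def cp.mp_pcompose by (simp add: poly_pcompose cp.mp_linear)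
  then have "poly (compose_power_poly N P) (fls_compose_power b N + z) = 0"
    using P0 N by (simp add: P1_def cp.mp_smult)
  then show ?case using N by blast
qed

section \<open>Newton's theorem\<close>

text \<open>
  The substitution \<open>X \<mapsto> cX\<close>. For \<open>c\<^sup>N = 1\<close> these are the automorphisms of \<open>k((X))\<close> over \<open>k((X\<^sup>N))\<close>.
\<close>

definition twist :: "'b::field \<Rightarrow> 'b fls \<Rightarrow> 'b fls" where
  "twist c z = fls_compose_fps z (fps_const c * fps_X)"

lemma nth_twist: "c \<noteq> 0 \<Longrightarrow> twist c z $$ k = z $$ k * c powi k"
  by (simp add: twist_def fls_nth_fls_compose_fps_linear)

lemma ring_morph_twist: "c \<noteq> 0 \<Longrightarrow> ring_morph (twist c)"
  unfolding twist_def by unfold_locales (auto simp: fls_compose_fps_add fls_compose_fps_mult)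

lemma twist_twist: "c \<noteq> 0 \<Longrightarrow> d \<noteq> 0 \<Longrightarrow> twist c (twist d z) = twist (c * d) z"
  by (rule fls_eqI) (simp add: nth_twist power_int_mult_distrib mult_ac)

lemma twist_1 [simp]: "twist 1 z = z"
  by (rule fls_eqI) (simp add: nth_twist)

lemma twist_compose_power:
  assumes "c \<noteq> 0" "K > 0"
  shows "twist c (fls_compose_power z K) = fls_compose_power (twist (c ^ K) z) K"
proof (rule fls_eqI)
  fix k
  show "twist c (fls_compose_power z K) $$ k = fls_compose_power (twist (c ^ K) z) K $$ k"
  proof (cases "int K dvd k")
    case True
    then obtain l where "k = int K * l" by (elim dvdE)
    then show ?thesis using assms by (simp add: nth_twist fls_nth_compose_power power_int_mult)
  qed (use assms in \<open>simp add: nth_twist fls_nth_compose_power\<close>)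
qed

lemma twist_compose_power_fixed:
  assumes "c ^ K = 1" "K > 0"
  shows "twist c (fls_compose_power z K) = fls_compose_power z K"
  using assms by (subst twist_compose_power) (auto simp: power_0_left)

lemma twist_root:
  fixes x :: "'b::field fls"
  assumes "N > 0" "c ^ N = 1" "poly (compose_power_poly N f) x = 0"
  shows "poly (compose_power_poly N f) (twist c x) = 0"
proof -
  have c: "c \<noteq> 0" using assms by (auto simp: power_0_left)
  interpret t: ring_morph "twist c" by (rule ring_morph_twist[OF c])
  have "map_poly (twist c) (compose_power_poly N f) = compose_power_poly N f"
    by (rule poly_eqI) (simp add: t.coeff_mp coeff_map_poly twist_compose_power_fixed assms)
  then show ?thesis using t.poly_mp[of "compose_power_poly N f" x] assms(3) by (simp add: t.zero)
qed

lemma fls_descend: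
  fixes z :: "'b::zero fls"
  assumes e: "e > 0" and dvd: "\<And>s. z $$ s \<noteq> 0 \<Longrightarrow> int e dvd s"
  shows "\<exists>w. z = fls_compose_power w e"
proof -
  define w where "w = Abs_fls (\<lambda>k. z $$ (int e * k))"
  have w: "w $$ k = z $$ (int e * k)" for k
    unfolding w_def
  proof (rule nth_Abs_fls_lower_bound, intro allI impI)
    fix k assume k: "k < min 0 (fls_subdegree z)"
    then have "int e * k \<le> 1 * k" using e by (intro mult_right_mono_neg) auto
    then have "int e * k < fls_subdegree z" using k by linarith
    then show "z $$ (int e * k) = 0" by (rule fls_eq0_below_subdegree)
  qed
  have "z = fls_compose_power w e"
  proof (rule fls_eqI)
    fix s show "z $$ s = fls_compose_power w e $$ s"
      using dvd[of s] e by (cases "int e dvd s") (auto simp: fls_nth_compose_power w)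
  qed
  then show ?thesis by blast
qed

text \<open>
  A greatest common divisor of \<open>f\<close> and \<open>g\<close> over \<open>k((X))\<close> is a combination of them, so it keeps the common
  root after the substitution and cannot be constant.
\<close>

lemma irreducible_dvd_of_common_root:
  fixes f g :: "'b::field fls poly"
  assumes "irreducible f" "N > 0"
    and "poly (compose_power_poly N f) x = 0" "poly (compose_power_poly N g) x = 0"
  shows "f dvd g"
proof -
  interpret cp: ring_morph "\<lambda>c::'b fls. fls_compose_power c N" by (rule ring_morph_compose_power[OF assms(2)])
  obtain a b where ab: "(a * f + b * g) dvd f" "(a * f + b * g) dvd g"
    using field_poly_bezout by blast
  define d where "d = a * f + b * g"
  have root: "poly (compose_power_poly N d) x = 0"
    using assms by (simp add: d_def cp.mp_add cp.mp_mult)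
  have "\<not> is_unit d"
  proof
    assume "is_unit d"
    then obtain e where "d * e = 1" by (metis dvd_def)
    then have "poly (compose_power_poly N (d * e)) x = 1" by (simp add: cp.one)
    then show False using root by (simp add: cp.mp_mult)
  qed
  then have "f dvd d" using ab(1) assms(1) irreducibleD' unfolding d_def by blast
  then show ?thesis using ab(2) unfolding d_def by (rule dvd_trans)
qed

lemma monic_dvd_same_degree:
  fixes f g :: "'b::idom poly"
  assumes "f dvd g" "lead_coeff f = 1" "lead_coeff g = 1" "degree g \<le> degree f"
  shows "f = g"
proof -
  obtain h where h: "g = f * h" using assms(1) by (elim dvdE)
  have nz: "f \<noteq> 0" "h \<noteq> 0" using assms(2,3) h by auto
  then have "degree h = 0" using assms(4) h by (simp add: degree_mult_eq)
  then obtain c where "h = [:c:]" by (elim degree_eq_zeroE)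
  then show ?thesis using assms(2,3) h nz by (cases "c = 0") auto
qed

lemma degree_prod_linear: "degree (\<Prod>j\<in>I. [:- a j, 1 :: 'b::idom:]) = card I"
  by (subst degree_prod_eq_sum_degree) (cases "finite I", auto)

lemma lead_coeff_prod_linear: "lead_coeff (\<Prod>j\<in>I. [:- a j, 1 :: 'b::idom:]) = 1"
  by (simp add: lead_coeff_prod)

text \<open>
  Dividing \<open>N\<close> and all the exponents of the series by their greatest common divisor \<open>e\<close>. Coprimality of \<open>M\<close> with
  the remaining exponents is stated in the form that makes the \<open>M\<close> conjugates of \<open>w\<close> distinct.
\<close>

lemma fls_compose_power_minimal:
  fixes z0 :: "'b::zero fls"
  assumes N: "N > 0"
  shows "\<exists>M>0. \<exists>e>0. \<exists>w. N = M * e \<and> z0 = fls_compose_power w e \<and>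
    (\<forall>j::int. (\<forall>s. w $$ s \<noteq> 0 \<longrightarrow> int M dvd j * s) \<longrightarrow> int M dvd j)"
proof -
  define A where "A = insert (int N) {s. z0 $$ s \<noteq> 0}"
  define e where "e = nat (Gcd A)"
  have e: "int e = Gcd A" by (simp add: e_def)
  have epos: "e > 0"
  proof -
    have "Gcd A \<noteq> 0" using N by (auto simp: A_def Gcd_0_iff)
    moreover have "Gcd A \<ge> 0" by simp
    ultimately have "Gcd A > 0" by linarith
    then show ?thesis by (simp add: e_def)
  qed
  have dvdA: "int e dvd a" if "a \<in> A" for a using that by (simp add: e)
  obtain w where w: "z0 = fls_compose_power w e"
    using fls_descend[OF epos, of z0] dvdA by (auto simp: A_def)
  have "e dvd N" using dvdA[of "int N"] by (simp add: A_def)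
  then obtain M where M: "N = M * e" by (metis dvdE mult.commute)
  have Mpos: "M > 0" using M N by (cases M) auto
  have "int M dvd j" if j: "\<forall>s. w $$ s \<noteq> 0 \<longrightarrow> int M dvd j * s" for j
  proof -
    have "int N dvd j * a" if a: "a \<in> A" for a
    proof (cases "a = int N")
      case False
      then have nz: "z0 $$ a \<noteq> 0" using a by (simp add: A_def)
      obtain l where l: "a = int e * l" using dvdA[OF a] by (elim dvdE)
      have "w $$ l \<noteq> 0" using nz epos by (simp add: w l fls_nth_compose_power)
      then have "int M dvd j * l" using j by simp
      then have "int M * int e dvd (j * l) * int e" by (rule mult_dvd_mono) simp
      then show ?thesis by (simp add: M l mult_ac)
    qed simp
    then have "int N dvd Gcd ((*) j ` A)" by (intro Gcd_greatest) auto
    then have "int N dvd j * int e" by (simp add: Gcd_mult e)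
    then have "int M * int e dvd j * int e" by (simp add: M)
    then show ?thesis using epos by simp
  qed
  then show ?thesis using epos Mpos M w by blast
qed

lemma int_dvd_diff_imp_eq:
  assumes "int n dvd int i - int j" "i < n" "j < n"
  shows "i = j"
  using dvd_imp_le_int[of "int i - int j" "int n"] assms by (cases "i = j") auto

text \<open>
  Let \<open>w\<close> be a Puiseux root of \<open>f\<close> with minimal ramification \<open>M\<close>. The product of the factors \<open>Y - w(c\<^sup>j X)\<close> over the
  \<open>M\<close> distinct conjugates is invariant under \<open>X \<mapsto> cX\<close>, hence of the form \<open>g(X\<^sup>M,Y)\<close>. By irreducibility \<open>f\<close>
  divides \<open>g\<close>, and since all the conjugates are roots of \<open>f(X\<^sup>M,Y)\<close>, the degree of \<open>f\<close> is at least \<open>M\<close>.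
\<close>

theorem newton_theorem:
  fixes f :: "'a::{alg_closed_field, field_char_0} fls poly"
  assumes f: "f \<in> Rnat"
  shows "\<exists>c z. primitive_root (degree f) c \<and>
    compose_power_poly (degree f) f = (\<Prod>j<degree f. [:- twist (c ^ j) z, 1:]) \<and>
    (\<forall>j::int. (\<forall>s. z $$ s \<noteq> 0 \<longrightarrow> int (degree f) dvd j * s) \<longrightarrow> int (degree f) dvd j)"
proof -
  define n where "n = degree f"
  have lf: "lead_coeff f = 1" and irr: "irreducible f" using f by (auto simp: Rnat_def)
  have n: "n > 0"
  proof (rule ccontr)
    assume "\<not> n > 0"
    then obtain a where "f = [:a:]" unfolding n_def by (auto elim: degree_eq_zeroE)
    then have "f = 1" using lf by (simp add: one_pCons)
    then have "is_unit f" by simp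
    then show False using irr by (simp add: irreducible_def)
  qed
  obtain N z0 where N: "N > 0" and z0: "poly (compose_power_poly N f) z0 = 0"
    using puiseux_root[of f] n by (auto simp: n_def)
  obtain M e w where M: "M > 0" and e: "e > 0" and NMe: "N = M * e"
    and w: "z0 = fls_compose_power w e"
    and cop: "\<And>j. (\<forall>s. w $$ s \<noteq> 0 \<longrightarrow> int M dvd j * s) \<Longrightarrow> int M dvd j"
    using fls_compose_power_minimal[OF N] by meson
  interpret ce: ring_morph "\<lambda>c::'a fls. fls_compose_power c e" by (rule ring_morph_compose_power[OF e])
  interpret cM: ring_morph "\<lambda>c::'a fls. fls_compose_power c M" by (rule ring_morph_compose_power[OF M])
  have "fls_compose_power (poly (compose_power_poly M f) w) e = 0"
    using z0 ce.poly_mp[of "compose_power_poly M f" w]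
    by (simp add: w NMe compose_power_poly_compose M e)
  then have wroot: "poly (compose_power_poly M f) w = 0" using e by simp
  obtain c :: 'a where c: "primitive_root M c" using exists_primitive_root[OF M] by blast
  have c0: "c \<noteq> 0" using c by (simp add: primitive_root_def)
  have cM1: "c ^ M = 1" using c unfolding primitive_root_def by (metis dvd_refl power_int_of_nat)
  define t where "t j = twist (c ^ j) w" for j
  have t_inj: "inj_on t {..<M}"
  proof (rule inj_onI)
    fix i j assume ij: "i \<in> {..<M}" "j \<in> {..<M}" "t i = t j"
    have "int M dvd (int i - int j)"
    proof (rule cop, intro allI impI)
      fix s assume s: "w $$ s \<noteq> 0"
      have "t i $$ s = t j $$ s" using ij by simp
      then have "c powi (int i * s) = c powi (int j * s)"
        using s c0 by (simp add: t_def nth_twist power_int_mult)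
      then have "c powi ((int i - int j) * s) = 1"
        using c0 by (simp add: left_diff_distrib power_int_diff)
      then show "int M dvd (int i - int j) * s" using c by (simp add: primitive_root_def)
    qed
    then show "i = j" using int_dvd_diff_imp_eq[of M i j] ij by simp
  qed
  define G where "G = (\<Prod>j<M. [:- t j, 1:])"
  have dG: "degree G = M" by (simp add: G_def degree_prod_linear)
  have lG: "lead_coeff G = 1" unfolding G_def by (rule lead_coeff_prod_linear)
  interpret tc: ring_morph "twist c" by (rule ring_morph_twist[OF c0])
  have "map_poly (twist c) G = (\<Prod>j<M. [:- t (Suc j), 1:])"
    unfolding G_def tc.mp_prod
    by (intro prod.cong refl) (simp add: tc.mp_linear tc.uminus t_def twist_twist c0)
  moreover have "[:- t 0, 1:] * (\<Prod>j<M. [:- t (Suc j), 1:]) = [:- t 0, 1:] * G"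
  proof -
    have "[:- t 0, 1:] * (\<Prod>j<M. [:- t (Suc j), 1:]) = (\<Prod>j<Suc M. [:- t j, 1:])"
      by (simp only: prod.lessThan_Suc_shift)
    also have "\<dots> = [:- t M, 1:] * G" by (simp only: prod.lessThan_Suc G_def mult.commute)
    also have "t M = t 0" by (simp add: t_def cM1)
    finally show ?thesis .
  qed
  then have "(\<Prod>j<M. [:- t (Suc j), 1:]) = G"
    by (subst (asm) mult_left_cancel) simp_all
  ultimately have Ginv: "map_poly (twist c) G = G" by simp
  have "\<exists>d. coeff G k = fls_compose_power d M" for k
  proof (rule fls_descend[OF M])
    fix s assume s: "coeff G k $$ s \<noteq> 0"
    have "twist c (coeff G k) = coeff G k" using Ginv tc.coeff_mp by metis
    then have "coeff G k $$ s * c powi s = coeff G k $$ s" using nth_twist[OF c0] by metis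
    then have "c powi s = 1" using s by simp
    then show "int M dvd s" using c by (simp add: primitive_root_def)
  qed
  then obtain d where d: "\<And>k. coeff G k = fls_compose_power (d k) M" by metis
  define g where "g = (\<Sum>k\<le>M. monom (d k) k)"
  have cg: "coeff g k = d k" for k
  proof (cases "k \<le> M")
    case False
    then have "coeff G k = 0" using dG by (intro coeff_eq_0) simp
    then have "d k = 0" using d[of k] M by simp
    then show ?thesis using False by (simp add: g_def coeff_sum coeff_monom)
  qed (simp add: g_def coeff_sum coeff_monom)
  have gG: "compose_power_poly M g = G"
    by (rule poly_eqI) (simp add: coeff_map_poly cg d)
  have dg: "degree g = M" using dG M unfolding gG[symmetric] by (subst (asm) degree_map_poly) auto
  have lg: "lead_coeff g = 1"
  proof -
    have "fls_compose_power (coeff g M) M = fls_compose_power 1 M"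
      using lG M by (simp add: dG d cg)
    then show ?thesis unfolding fls_compose_power_inj[OF M] by (simp add: dg)
  qed
  have "poly G w = 0"
    unfolding G_def poly_prod using M by (intro prod_zero) (auto simp: t_def intro!: bexI[of _ 0])
  then have fg: "f dvd g"
    using irreducible_dvd_of_common_root[OF irr M wroot] by (simp add: gG)
  have "M \<le> n"
  proof -
    have df: "degree (compose_power_poly M f) = n" using cM.degree_monic(1)[OF lf] by (simp add: n_def)
    then have f0: "compose_power_poly M f \<noteq> 0" using n by auto
    have "(c ^ j) ^ M = 1" for j using cM1 by (simp add: mult.commute flip: power_mult) (simp add: power_mult)
    then have "t ` {..<M} \<subseteq> {x. poly (compose_power_poly M f) x = 0}"
      using twist_root[OF M _ wroot] by (auto simp: t_def)
    then have "card (t ` {..<M}) \<le> card {x. poly (compose_power_poly M f) x = 0}"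
      by (intro card_mono poly_roots_finite f0)
    also have "\<dots> \<le> n" using card_poly_roots_bound[OF f0] df by simp
    finally show ?thesis using t_inj by (simp add: card_image)
  qed
  then have fgeq: "f = g" using monic_dvd_same_degree[OF fg lf lg] by (simp add: dg n_def)
  then have nM: "degree f = M" using dg by simp
  have "compose_power_poly M f = (\<Prod>j<M. [:- twist (c ^ j) w, 1:])"
    using gG by (simp only: fgeq G_def t_def)
  then show ?thesis unfolding nM using c cop by blast
qed

section \<open>Conjugate roots and their truncations\<close>

text \<open>
  The roots of \<open>f(X\<^sup>N,Y)\<close>. A common \<open>N\<close> for several polynomials puts all their Puiseux roots into one field.
\<close>

definition ramified_roots :: "nat \<Rightarrow> 'b::field fls poly \<Rightarrow> 'b fls set" where
  "ramified_roots N f = {x. poly (compose_power_poly N f) x = 0}"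

lemma newton_roots_eq: "newton_roots f = ramified_roots (degree f) f"
  by (simp add: newton_roots_def ramified_roots_def)

lemma Rnat_degree_pos:
  assumes "f \<in> Rnat"
  shows "degree f > 0"
proof (rule ccontr)
  assume "\<not> degree f > 0"
  then obtain a where "f = [:a:]" by (auto elim: degree_eq_zeroE)
  then have "f = 1" using assms by (simp add: one_pCons Rnat_def)
  then show False using assms by (simp add: Rnat_def)
qed

lemma dvd_pos_factor:
  assumes "(m::nat) dvd N" "N > 0"
  shows "\<exists>K. N = m * K \<and> K > 0"
proof -
  obtain K where K: "N = m * K" using assms(1) by (rule dvdE)
  then have "K > 0" using assms(2) by (cases K) auto
  then show ?thesis using K by blast
qed

text \<open>
  The conjugate \<open>z(c\<^sup>j X)\<close>, rewritten from ramification \<open>n\<close> to ramification \<open>nK\<close>.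
\<close>

definition conjugate :: "nat \<Rightarrow> 'b::field \<Rightarrow> 'b fls \<Rightarrow> nat \<Rightarrow> 'b fls" where
  "conjugate K c z j = fls_compose_power (twist (c ^ j) z) K"

definition newton_data :: "'b::field fls poly \<Rightarrow> 'b \<Rightarrow> 'b fls \<Rightarrow> bool" where
  "newton_data f c z \<longleftrightarrow> primitive_root (degree f) c \<and>
    compose_power_poly (degree f) f = (\<Prod>j<degree f. [:- twist (c ^ j) z, 1:]) \<and>
    (\<forall>j::int. (\<forall>s. z $$ s \<noteq> 0 \<longrightarrow> int (degree f) dvd j * s) \<longrightarrow> int (degree f) dvd j)"

lemma nth_conjugate:
  assumes "c \<noteq> 0" "K > 0"
  shows "conjugate K c z j $$ (int K * s) = z $$ s * c powi (int j * s)"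
  using assms by (simp add: conjugate_def fls_nth_compose_power nth_twist power_int_mult)

lemma newton_data_factorization:
  fixes f :: "'b::field fls poly"
  assumes "newton_data f c z" "K > 0"
  shows "compose_power_poly (degree f * K) f = (\<Prod>j<degree f. [:- conjugate K c z j, 1:])"
proof (cases "degree f = 0")
  case True
  then show ?thesis using assms(1) by (simp add: newton_data_def)
next
  case False
  interpret cp: ring_morph "\<lambda>c::'b fls. fls_compose_power c K" by (rule ring_morph_compose_power[OF assms(2)])
  have "compose_power_poly (degree f * K) f = compose_power_poly K (compose_power_poly (degree f) f)"
    using assms(2) False by (simp add: compose_power_poly_compose)
  also have "\<dots> = (\<Prod>j<degree f. [:- conjugate K c z j, 1:])"
    using assms(1) unfolding newton_data_def
    by (simp add: cp.mp_prod cp.mp_linear conjugate_def)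
  finally show ?thesis .
qed

lemma newton_data_roots:
  fixes f :: "'b::field fls poly"
  assumes "newton_data f c z" "K > 0"
  shows "ramified_roots (degree f * K) f = conjugate K c z ` {..<degree f}"
  using newton_data_factorization[OF assms] by (auto simp: ramified_roots_def poly_prod)

lemma newton_data_conjugate_eq_iff:
  assumes "newton_data f c z" "K > 0"
  shows "(\<forall>s. Q s \<longrightarrow> conjugate K c z i $$ (int K * s) = conjugate K c z j $$ (int K * s)) \<longleftrightarrow>
    (\<forall>s. z $$ s \<noteq> 0 \<and> Q s \<longrightarrow> int (degree f) dvd (int i - int j) * s)"
proof -
  have c: "primitive_root (degree f) c" "c \<noteq> 0"
    using assms unfolding newton_data_def primitive_root_def by blast+
  have "z $$ s * c powi (int i * s) = z $$ s * c powi (int j * s) \<longleftrightarrow>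
     (z $$ s \<noteq> 0 \<longrightarrow> int (degree f) dvd (int i - int j) * s)" for s
  proof -
    have "c powi (int i * s) = c powi (int j * s) \<longleftrightarrow> c powi ((int i - int j) * s) = 1"
      using c(2) by (simp add: left_diff_distrib power_int_diff)
    then show ?thesis by (cases "z $$ s = 0") (simp_all add: primitive_rootD(2)[OF c(1)])
  qed
  then have "conjugate K c z i $$ (int K * s) = conjugate K c z j $$ (int K * s) \<longleftrightarrow>
      (z $$ s \<noteq> 0 \<longrightarrow> int (degree f) dvd (int i - int j) * s)" for s
    by (simp only: nth_conjugate[OF c(2) assms(2)])
  then show ?thesis by blast
qed

lemma newton_data_inj:
  assumes "newton_data f c z" "K > 0"
  shows "inj_on (conjugate K c z) {..<degree f}"
proof (rule inj_onI)
  fix i j assume ij: "i \<in> {..<degree f}" "j \<in> {..<degree f}" "conjugate K c z i = conjugate K c z j"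
  then have "\<forall>s. z $$ s \<noteq> 0 \<and> True \<longrightarrow> int (degree f) dvd (int i - int j) * s"
    by (subst newton_data_conjugate_eq_iff[OF assms, symmetric]) (simp add: ij(3))
  then have "int (degree f) dvd (int i - int j)"
    using assms(1) unfolding newton_data_def by blast
  then show "i = j" using int_dvd_diff_imp_eq[of "degree f" i j] ij by simp
qed

lemma newton_data_exists:
  assumes "f \<in> Rnat"
  obtains c z where "newton_data f c z"
  using newton_theorem[OF assms] unfolding newton_data_def by blast

lemma ramified_roots_splitting:
  assumes "f \<in> Rnat" "degree f dvd N" "N > 0"
  shows "compose_power_poly N f = (\<Prod>x\<in>ramified_roots N f. [:- x, 1:])"
    "card (ramified_roots N f) = degree f" "finite (ramified_roots N f)"
proof -
  obtain K where K: "N = degree f * K" "K > 0" using dvd_pos_factor[OF assms(2,3)] by blast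
  obtain c z where cz: "newton_data f c z" using newton_data_exists[OF assms(1)] .
  note inj = newton_data_inj[OF cz K(2)] and rt = newton_data_roots[OF cz K(2)]
  show "compose_power_poly N f = (\<Prod>x\<in>ramified_roots N f. [:- x, 1:])"
    unfolding K rt newton_data_factorization[OF cz K(2)] by (simp add: prod.reindex[OF inj])
  show "card (ramified_roots N f) = degree f"
    unfolding K rt by (simp add: card_image[OF inj])
  show "finite (ramified_roots N f)" unfolding K rt by simp
qed

text \<open>
  Transitivity of the Galois group, which is the group of \<open>N\<close>-th roots of unity.
\<close>

lemma ramified_roots_conjugate:
  fixes f :: "'a::{alg_closed_field, field_char_0} fls poly"
  assumes "f \<in> Rnat" "degree f dvd N" "N > 0" "x \<in> ramified_roots N f" "y \<in> ramified_roots N f"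
  shows "\<exists>u. u ^ N = 1 \<and> y = twist u x"
proof -
  obtain K where K: "N = degree f * K" "K > 0" using dvd_pos_factor[OF assms(2,3)] by blast
  obtain c z where cz: "newton_data f c z" using newton_data_exists[OF assms(1)] .
  have pr: "primitive_root (degree f) c" using cz unfolding newton_data_def by blast
  have c: "c \<noteq> 0" using pr by (rule primitive_rootD)
  have cn: "c ^ degree f = 1" using primitive_rootD(2)[OF pr, of "int (degree f)"] by simp
  obtain i j where ij: "x = conjugate K c z i" "y = conjugate K c z j"
    using assms(4,5) unfolding K newton_data_roots[OF cz K(2)] by auto
  define v where "v = c ^ j / c ^ i"
  obtain u where u: "u ^ K = v" using nth_root_exists[OF K(2)] by blast
  have "(c ^ l) ^ degree f = 1" for l
    using cn by (metis mult.commute power_mult power_one)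
  then have "v ^ degree f = 1" by (simp add: v_def power_divide)
  then have uN: "u ^ N = 1" unfolding K mult.commute[of "degree f"] by (simp add: power_mult u)
  then have u0: "u \<noteq> 0" using assms(3) by (auto simp: power_0_left)
  have v: "v \<noteq> 0" "v * c ^ i = c ^ j" using c by (auto simp: v_def)
  have "twist v (twist (c ^ i) z) = twist (c ^ j) z"
    using v c by (simp add: twist_twist)
  then have "twist u x = conjugate K c z j"
    using u0 K(2) by (simp add: ij conjugate_def twist_compose_power u)
  then have "y = twist u x" by (simp only: ij(2))
  with uN show ?thesis by (intro exI[of _ u] conjI)
qed

lemma ramified_roots_scale:
  assumes "f \<in> Rnat" "degree f dvd N" "N > 0"
  shows "ramified_roots N f = (\<lambda>z. fls_compose_power z (N div degree f)) ` newton_roots f"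
proof -
  have d: "degree f > 0" using Rnat_degree_pos[OF assms(1)] .
  obtain K where K: "N = degree f * K" "K > 0" using dvd_pos_factor[OF assms(2,3)] by blast
  obtain c z where cz: "newton_data f c z" using newton_data_exists[OF assms(1)] .
  have "newton_roots f = conjugate 1 c z ` {..<degree f}"
    using newton_data_roots[OF cz, of 1] by (simp add: newton_roots_eq)
  moreover have "fls_compose_power (conjugate 1 c z j) K = conjugate K c z j" for j
    using K by (simp add: conjugate_def fls_compose_power_compose)
  moreover have "N div degree f = K" using K d by simp
  ultimately show ?thesis unfolding K newton_data_roots[OF cz K(2)] by (simp add: image_image)
qed

lemma ramified_roots_disjoint:
  fixes f g :: "'a::{alg_closed_field, field_char_0} fls poly"
  assumes "f \<in> Rnat" "g \<in> Rnat" "N > 0" "x \<in> ramified_roots N f" "x \<in> ramified_roots N g"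
  shows "f = g"
proof -
  have fg: "irreducible f" "irreducible g" "lead_coeff f = 1" "lead_coeff g = 1"
    using assms by (auto simp: Rnat_def)
  have "f dvd g" "g dvd f"
    using irreducible_dvd_of_common_root[OF _ assms(3)] fg assms(4,5) by (auto simp: ramified_roots_def)
  moreover have "degree g \<le> degree f"
    using \<open>g dvd f\<close> fg(3) by (intro dvd_imp_degree_le) auto
  ultimately show ?thesis using monic_dvd_same_degree fg by blast
qed

definition truncation :: "int \<Rightarrow> 'b::zero fls \<Rightarrow> int \<Rightarrow> 'b" where
  "truncation e x = (\<lambda>k. if k < e then x $$ k else 0)"

lemma truncation_eq_iff:
  "truncation e x = truncation e y \<longleftrightarrow> (\<forall>k<e. x $$ k = y $$ k)"
  by (auto simp: truncation_def fun_eq_iff)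

lemma truncation_eq_iff_subdegree:
  fixes x y :: "'b::group_add fls"
  shows "truncation e x = truncation e y \<longleftrightarrow> x = y \<or> e \<le> fls_subdegree (x - y)"
proof
  assume eq: "truncation e x = truncation e y"
  show "x = y \<or> e \<le> fls_subdegree (x - y)"
    using eq by (cases "x = y") (auto simp: truncation_eq_iff intro!: fls_subdegree_geI)
next
  assume "x = y \<or> e \<le> fls_subdegree (x - y)"
  then show "truncation e x = truncation e y"
  proof
    assume le: "e \<le> fls_subdegree (x - y)"
    have "(x - y) $$ k = 0" if "k < e" for k using that le by (intro fls_eq0_below_subdegree) simp
    then show ?thesis by (simp add: truncation_eq_iff)
  qed simp
qed

lemma truncation_twist:
  assumes "c \<noteq> 0" "truncation e x = truncation e y"
  shows "truncation e (twist c x) = truncation e (twist c y)"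
  using assms by (simp add: truncation_eq_iff nth_twist)

text \<open>
  The set of balls of order \<open>e\<close> met by the roots of \<open>f\<close>, each ball being represented by the common
  truncation of its members.
\<close>

definition traces :: "nat \<Rightarrow> int \<Rightarrow> 'b::field fls poly \<Rightarrow> (int \<Rightarrow> 'b) set" where
  "traces N e f = truncation e ` ramified_roots N f"

lemma traces_nonempty:
  assumes "f \<in> Rnat" "degree f dvd N" "N > 0"
  shows "traces N e f \<noteq> {}"
  using ramified_roots_splitting(2)[OF assms] Rnat_degree_pos[OF assms(1)] by (auto simp: traces_def)

text \<open>
  The Galois group permutes the balls and acts transitively on the roots of each of the two polynomials.
\<close>

lemma traces_eq_if_meet:
  fixes f g :: "'a::{alg_closed_field, field_char_0} fls poly"
  assumes f: "f \<in> Rnat" "degree f dvd N" and g: "g \<in> Rnat" "degree g dvd N" and N: "N > 0"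
    and meet: "traces N e f \<inter> traces N e g \<noteq> {}"
  shows "traces N e f = traces N e g"
proof -
  have *: "traces N e p \<subseteq> traces N e q"
    if p: "p \<in> Rnat" "degree p dvd N" and pq: "traces N e p \<inter> traces N e q \<noteq> {}"
    for p q :: "'a fls poly"
  proof
    obtain x y where xy: "x \<in> ramified_roots N p" "y \<in> ramified_roots N q" "truncation e x = truncation e y"
      using pq by (auto simp: traces_def)
    fix v assume "v \<in> traces N e p"
    then obtain x' where x': "x' \<in> ramified_roots N p" "v = truncation e x'" by (auto simp: traces_def)
    obtain u where u: "u ^ N = 1" "x' = twist u x"
      using ramified_roots_conjugate[OF p N xy(1) x'(1)] by blast
    have u0: "u \<noteq> 0" using u(1) N by (auto simp: power_0_left)
    have "twist u y \<in> ramified_roots N q"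
      using twist_root[OF N u(1)] xy(2) by (simp add: ramified_roots_def)
    moreover have "v = truncation e (twist u y)"
      using truncation_twist[OF u0 xy(3)] by (simp add: x'(2) u(2))
    ultimately show "v \<in> traces N e q" by (simp add: traces_def)
  qed
  show ?thesis using *[OF f meet] *[OF g] meet by blast
qed

section \<open>Contact in terms of truncations\<close>

lemma scaled_ord_compose_power:
  fixes w :: "'b::idom fls"
  assumes "K > 0"
  shows "scaled_ord (N * K) (fls_compose_power w K) = scaled_ord N w"
  using assms by (simp add: scaled_ord_def fls_subdegree_compose_power)

text \<open>
  The definition of the contact uses the ramification \<open>nn'\<close>; orders divided by the ramification do not
  depend on which common multiple \<open>N\<close> of the degrees is used.
\<close>

lemma noc_eq:
  fixes f g :: "'a::{alg_closed_field, field_char_0} fls poly"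
  assumes f: "f \<in> Rnat" "degree f dvd N" and g: "g \<in> Rnat" "degree g dvd N" and N: "N > 0"
  shows "noc f g = Max ((\<lambda>(x, y). scaled_ord N (x - y)) ` (ramified_roots N f \<times> ramified_roots N g))"
proof -
  define n m K L where "n = degree f" and "m = degree g" and "K = N div n" and "L = N div m"
  have nm: "n > 0" "m > 0" using Rnat_degree_pos f g by (auto simp: n_def m_def)
  have NK: "N = n * K" "N = m * L" using f g by (auto simp: n_def m_def K_def L_def)
  have KL: "K > 0" "L > 0" using N NK by (auto intro: gr0I)
  \<comment> \<open>both sides are compared in ramification \<open>nmN\<close>\<close>
  have so: "scaled_ord (n * m) (fls_compose_power x m - fls_compose_power y n) =
      scaled_ord N (fls_compose_power x K - fls_compose_power y L)" for x y :: "'a fls"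
  proof -
    have "scaled_ord (n * m) (fls_compose_power x m - fls_compose_power y n) =
        scaled_ord (n * m * N) (fls_compose_power (fls_compose_power x m - fls_compose_power y n) N)"
      using N by (simp only: scaled_ord_compose_power)
    also have "fls_compose_power (fls_compose_power x m - fls_compose_power y n) N =
        fls_compose_power x (m * N) - fls_compose_power y (n * N)"
      using N nm by (simp add: fls_compose_power_compose)
    also have "\<dots> = fls_compose_power x (K * (n * m)) - fls_compose_power y (L * (n * m))"
    proof -
      have "m * N = K * (n * m)" using NK(1) by (simp add: mult_ac)
      moreover have "n * N = L * (n * m)" using NK(2) by (simp add: mult_ac)
      ultimately show ?thesis by (simp only:)
    qed
    also have "\<dots> = fls_compose_power (fls_compose_power x K - fls_compose_power y L) (n * m)"
      using KL nm by (simp add: fls_compose_power_compose)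
    also have "scaled_ord (n * m * N) \<dots> = scaled_ord (N * (n * m)) \<dots>" by (simp only: mult.commute)
    also have "\<dots> = scaled_ord N (fls_compose_power x K - fls_compose_power y L)"
      using nm by (intro scaled_ord_compose_power) simp
    finally show ?thesis .
  qed
  have "{scaled_ord (n * m) (fls_compose_power z m - fls_compose_power z' n) | z z'.
       z \<in> newton_roots f \<and> z' \<in> newton_roots g} =
     (\<lambda>(x, y). scaled_ord N (x - y)) ` (ramified_roots N f \<times> ramified_roots N g)"
    unfolding so ramified_roots_scale[OF f N] ramified_roots_scale[OF g N]
    by (force simp: n_def m_def K_def L_def)
  then show ?thesis unfolding noc_def by (simp add: n_def m_def)
qed

lemma scaled_ord_ge_iff:
  fixes x y :: "'b::idom fls"
  assumes "N > 0"
  shows "scaled_ord N (x - y) \<ge> Fin l \<longleftrightarrow>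
    truncation \<lceil>l * rat_of_nat N\<rceil> x = truncation \<lceil>l * rat_of_nat N\<rceil> y"
  using assms unfolding truncation_eq_iff_subdegree scaled_ord_def
  by (auto simp: ceiling_le_iff pos_le_divide_eq)

lemma scaled_ord_gt_iff:
  fixes x y :: "'b::idom fls"
  assumes "N > 0"
  shows "scaled_ord N (x - y) > Fin l \<longleftrightarrow>
    truncation (\<lfloor>l * rat_of_nat N\<rfloor> + 1) x = truncation (\<lfloor>l * rat_of_nat N\<rfloor> + 1) y"
proof -
  have "Fin l < Fin (rat_of_int s / rat_of_nat N) \<longleftrightarrow> \<lfloor>l * rat_of_nat N\<rfloor> + 1 \<le> s" for s
  proof -
    have "Fin l < Fin (rat_of_int s / rat_of_nat N) \<longleftrightarrow> l * rat_of_nat N < rat_of_int s"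
      using assms by (simp add: pos_less_divide_eq)
    also have "\<dots> \<longleftrightarrow> \<lfloor>l * rat_of_nat N\<rfloor> < s" by (simp only: floor_less_iff)
    finally show ?thesis by linarith
  qed
  then show ?thesis
    unfolding truncation_eq_iff_subdegree scaled_ord_def by auto
qed

context
  fixes f g :: "'a::{alg_closed_field, field_char_0} fls poly" and N :: nat
  assumes f: "f \<in> Rnat" "degree f dvd N" and g: "g \<in> Rnat" "degree g dvd N" and N: "N > 0"
begin

lemma noc_image_finite:
  "finite ((\<lambda>(x, y). scaled_ord N (x - y)) ` (ramified_roots N f \<times> ramified_roots N g))"
  "(\<lambda>(x, y). scaled_ord N (x - y)) ` (ramified_roots N f \<times> ramified_roots N g) \<noteq> {}"
proof -
  have "card (ramified_roots N f) > 0" "card (ramified_roots N g) > 0"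
    using ramified_roots_splitting(2)[OF f N] ramified_roots_splitting(2)[OF g N]
      Rnat_degree_pos f g by auto
  then show "finite ((\<lambda>(x, y). scaled_ord N (x - y)) ` (ramified_roots N f \<times> ramified_roots N g))"
    "(\<lambda>(x, y). scaled_ord N (x - y)) ` (ramified_roots N f \<times> ramified_roots N g) \<noteq> {}"
    by (auto simp: card_gt_0_iff)
qed

text \<open>
  As levels \<open>l\<close> need not be multiples of \<open>1/N\<close>, orders are rounded: \<open>e \<ge> lN\<close> iff \<open>e \<ge> \<lceil>lN\<rceil>\<close>, and \<open>e > lN\<close> iff
  \<open>e \<ge> \<lfloor>lN\<rfloor> + 1\<close>. Open balls thus become closed balls of a larger order.
\<close>

lemma noc_ge_iff:
  "noc f g \<ge> Fin l \<longleftrightarrow> traces N \<lceil>l * rat_of_nat N\<rceil> f = traces N \<lceil>l * rat_of_nat N\<rceil> g"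
proof -
  let ?e = "\<lceil>l * rat_of_nat N\<rceil>"
  have "noc f g \<ge> Fin l \<longleftrightarrow> traces N ?e f \<inter> traces N ?e g \<noteq> {}"
    unfolding noc_eq[OF f g N] Max_ge_iff[OF noc_image_finite]
    by (auto simp: scaled_ord_ge_iff[OF N] traces_def)
  also have "\<dots> \<longleftrightarrow> traces N ?e f = traces N ?e g"
    using traces_eq_if_meet[OF f g N, of ?e] traces_nonempty[OF f N, of ?e] by auto
  finally show ?thesis .
qed

lemma noc_gt_iff:
  "noc f g > Fin l \<longleftrightarrow>
     traces N (\<lfloor>l * rat_of_nat N\<rfloor> + 1) f = traces N (\<lfloor>l * rat_of_nat N\<rfloor> + 1) g"
proof -
  let ?e = "\<lfloor>l * rat_of_nat N\<rfloor> + 1"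
  have "noc f g > Fin l \<longleftrightarrow> traces N ?e f \<inter> traces N ?e g \<noteq> {}"
    unfolding noc_eq[OF f g N] Max_gr_iff[OF noc_image_finite]
    by (auto simp: scaled_ord_gt_iff[OF N] traces_def)
  also have "\<dots> \<longleftrightarrow> traces N ?e f = traces N ?e g"
    using traces_eq_if_meet[OF f g N, of ?e] traces_nonempty[OF f N, of ?e] by auto
  finally show ?thesis .
qed

lemma noc_cases: "(\<exists>l. noc f g = Fin l) \<or> noc f g = Pinf \<and> f = g"
proof -
  have "noc f g \<in> (\<lambda>(x, y). scaled_ord N (x - y)) ` (ramified_roots N f \<times> ramified_roots N g)"
    unfolding noc_eq[OF f g N] by (rule Max_in[OF noc_image_finite])
  then obtain x y where xy: "x \<in> ramified_roots N f" "y \<in> ramified_roots N g" "noc f g = scaled_ord N (x - y)"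
    by auto
  then show ?thesis using ramified_roots_disjoint[OF f(1) g(1) N xy(1)]
    by (cases "x = y") (auto simp: scaled_ord_def)
qed

end

section \<open>Characteristic sequences and the numbers D\<close>

lemma int_Least:
  fixes P :: "int \<Rightarrow> bool"
  assumes "P s0" "\<And>s. P s \<Longrightarrow> b \<le> s"
  shows "P (LEAST s. P s)" "P s \<Longrightarrow> (LEAST s. P s) \<le> s"
proof -
  obtain x where x: "P x" "\<And>y. P y \<Longrightarrow> nat (x - b) \<le> nat (y - b)"
    using ex_has_least_nat[of P s0 "\<lambda>s. nat (s - b)"] assms(1) by blast
  have le: "x \<le> y" if "P y" for y
    using x(2)[OF that] assms(2)[OF that] assms(2)[OF x(1)] by linarith
  have eq: "(LEAST s. P s) = x" by (rule Least_equality) (use x(1) le in auto)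
  show "P (LEAST s. P s)" using x(1) by (simp add: eq)
  show "(LEAST s. P s) \<le> s" if "P s" using le[OF that] by (simp add: eq)
qed

lemma newton_supp_eq:
  fixes f :: "'a::{alg_closed_field, field_char_0} fls poly"
  assumes "f \<in> Rnat" "newton_data f c z"
  shows "newton_supp f = {s. z $$ s \<noteq> 0}"
proof -
  have c: "c \<noteq> 0" using assms(2) unfolding newton_data_def by (blast dest: primitive_rootD(1))
  have rt: "newton_roots f = conjugate 1 c z ` {..<degree f}"
    using newton_data_roots[OF assms(2), of 1] by (simp add: newton_roots_eq)
  have "newton_roots f \<noteq> {}" using Rnat_degree_pos[OF assms(1)] by (auto simp: rt)
  then have "(SOME z. z \<in> newton_roots f) \<in> newton_roots f" by (simp add: some_in_eq)
  then obtain j where j: "(SOME z. z \<in> newton_roots f) = conjugate 1 c z j" using rt by auto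
  have "conjugate 1 c z j $$ s = z $$ s * c powi (int j * s)" for s
    using nth_conjugate[OF c, of 1 z j s] by simp
  then show ?thesis using c by (simp add: newton_supp_def j)
qed

text \<open>
  The support is bounded below, so that least elements exist, and coprime to the degree, so that the
  characteristic sequence terminates.
\<close>

lemma newton_supp_properties:
  fixes f :: "'a::{alg_closed_field, field_char_0} fls poly"
  assumes f: "f \<in> Rnat" and cz: "newton_data f c z"
  shows "\<exists>b. \<forall>s\<in>newton_supp f. b \<le> s"
    and "Gcd (insert (int (degree f)) (newton_supp f)) = 1"
    and "newton_supp f = {} \<Longrightarrow> f = [:0, 1:]"
proof -
  have S: "newton_supp f = {s. z $$ s \<noteq> 0}" by (rule newton_supp_eq[OF f cz])
  have n: "degree f > 0" by (rule Rnat_degree_pos[OF f])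
  show "\<exists>b. \<forall>s\<in>newton_supp f. b \<le> s"
    unfolding S by (intro exI[of _ "fls_subdegree z"]) (auto intro: fls_subdegree_leI)
  have cop: "int (degree f) dvd j" if "\<forall>s. z $$ s \<noteq> 0 \<longrightarrow> int (degree f) dvd j * s" for j
    using cz that unfolding newton_data_def by blast
  define g where "g = Gcd (insert (int (degree f)) (newton_supp f))"
  have "g dvd int (degree f)" unfolding g_def by (rule Gcd_dvd) simp
  then obtain j where j: "int (degree f) = g * j" by (elim dvdE)
  have g0: "g \<ge> 0" by (simp add: g_def)
  have "int (degree f) dvd j"
  proof (rule cop, intro allI impI)
    fix s assume "z $$ s \<noteq> 0"
    then have "g dvd s" unfolding g_def by (intro Gcd_dvd) (simp add: S)
    then show "int (degree f) dvd j * s" by (simp add: j mult.commute)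
  qed
  then have "g * j dvd 1 * j" by (simp add: j)
  moreover have "j \<noteq> 0" using j n by auto
  ultimately have "g dvd 1" by (subst (asm) dvd_mult_cancel_right) simp
  then show "Gcd (insert (int (degree f)) (newton_supp f)) = 1"
    using g0 unfolding g_def[symmetric] by simp
  assume e: "newton_supp f = {}"
  then have z0: "z = 0" by (auto simp: S fls_eq_iff)
  have "int (degree f) dvd 1" by (rule cop) (simp add: z0)
  then have n1: "degree f = 1" by simp
  have "compose_power_poly 1 f = [:0, 1:]"
    using cz unfolding newton_data_def n1 by (simp add: z0)
  moreover have "compose_power_poly 1 f = f"
    by (rule poly_eqI) (simp add: coeff_map_poly fls_eq_iff fls_nth_compose_power)
  ultimately show "f = [:0, 1:]" by simp
qed

lemma char_m_rec:
  "char_m f (Suc (Suc i)) = (LEAST s. s \<in> newton_supp f \<and> \<not> char_d f (Suc (Suc i)) dvd s)"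
  by (simp add: char_d_def lessThan_Suc_atMost)

declare char_m.simps(3) [simp del]

lemma char_d_Suc: "char_d f (Suc i) = gcd (char_m f i) (char_d f i)"
  by (simp add: char_d_def lessThan_Suc)

lemma char_d_dvd_degree: "i \<ge> 1 \<Longrightarrow> char_d f i dvd int (degree f)"
  unfolding char_d_def by (intro Gcd_dvd image_eqI[where x = 0]) simp_all

lemma char_d_nonneg: "char_d f i \<ge> 0"
  by (simp add: char_d_def)

context
  fixes f :: "'a::{alg_closed_field, field_char_0} fls poly" and b :: int
  assumes n: "degree f > 0"
    and bound: "\<And>s. s \<in> newton_supp f \<Longrightarrow> b \<le> s"
    and coprime: "Gcd (insert (int (degree f)) (newton_supp f)) = 1"
    and nonempty: "newton_supp f \<noteq> {}"
    and not_Y: "f \<noteq> [:0, 1:]"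
begin

private lemma d_pos: "i \<ge> 1 \<Longrightarrow> char_d f i > 0"
  using char_d_dvd_degree[of i f] char_d_nonneg[of f i] n by (cases "char_d f i = 0") auto

private lemma m_1: "char_m f 1 \<in> newton_supp f" "s \<in> newton_supp f \<Longrightarrow> char_m f 1 \<le> s"
proof -
  obtain s0 where s0: "s0 \<in> newton_supp f" using nonempty by blast
  show "char_m f 1 \<in> newton_supp f" "s \<in> newton_supp f \<Longrightarrow> char_m f 1 \<le> s"
    using int_Least[where P = "\<lambda>s. s \<in> newton_supp f", OF s0 bound] by simp_all
qed

private lemma m_i:
  assumes "i \<ge> 2" "char_d f i \<noteq> 1"
  shows "char_m f i \<in> newton_supp f" "\<not> char_d f i dvd char_m f i"
    "s \<in> newton_supp f \<Longrightarrow> \<not> char_d f i dvd s \<Longrightarrow> char_m f i \<le> s"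
proof -
  obtain k where k: "i = Suc (Suc k)" using assms(1) by (metis Suc_le_D numeral_2_eq_2 Suc_le_mono)
  have "\<exists>s\<in>newton_supp f. \<not> char_d f i dvd s"
  proof (rule ccontr)
    assume "\<not> ?thesis"
    then have "char_d f i dvd Gcd (insert (int (degree f)) (newton_supp f))"
      using char_d_dvd_degree[of i f] assms(1) by (intro Gcd_greatest) auto
    then have "char_d f i dvd 1" by (simp only: coprime)
    then show False using assms(2) char_d_nonneg[of f i] by simp
  qed
  then obtain s0 where s0: "s0 \<in> newton_supp f \<and> \<not> char_d f i dvd s0" by blast
  note L = int_Least[where P = "\<lambda>s. s \<in> newton_supp f \<and> \<not> char_d f i dvd s" and b = b, OF s0]
  have m: "char_m f i = (LEAST s. s \<in> newton_supp f \<and> \<not> char_d f i dvd s)"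
    unfolding k by (rule char_m_rec)
  show "char_m f i \<in> newton_supp f" "\<not> char_d f i dvd char_m f i"
    using L(1) bound unfolding m[symmetric] by blast+
  show "s \<in> newton_supp f \<Longrightarrow> \<not> char_d f i dvd s \<Longrightarrow> char_m f i \<le> s"
    using L(2) bound unfolding m[symmetric] by blast
qed

private lemma h_exists: "\<exists>i\<ge>1. char_d f (i + 1) = 1"
proof (rule ccontr)
  assume none: "\<not> ?thesis"
  \<comment> \<open>the sequence \<open>d\<^sub>i\<close> strictly decreases as long as it is not 1\<close>
  have "char_d f (i + 2) \<le> int (degree f) - int i" for i
  proof (induction i)
    case 0
    have "char_d f 2 \<le> int (degree f)" using char_d_dvd_degree[of 2 f] n by (intro zdvd_imp_le) auto
    then show ?case by (simp only: add_0 of_nat_0 diff_zero)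
  next
    case (Suc i)
    have ne: "char_d f (i + 2) \<noteq> 1" using none[simplified, rule_format, of "i + 1"] by simp
    have "char_d f (Suc i + 2) = gcd (char_m f (i + 2)) (char_d f (i + 2))"
      using char_d_Suc[of f "i + 2"] by simp
    moreover have "\<not> char_d f (i + 2) dvd char_m f (i + 2)" using m_i(2)[of "i + 2"] ne by simp
    ultimately have "char_d f (Suc i + 2) \<noteq> char_d f (i + 2)" "char_d f (Suc i + 2) dvd char_d f (i + 2)"
      by (metis gcd_dvd1, simp)
    then have "char_d f (Suc i + 2) < char_d f (i + 2)"
      using zdvd_imp_le[of "char_d f (Suc i + 2)" "char_d f (i + 2)"] d_pos[of "i + 2"] by simp
    then show ?case using Suc by simp
  qed
  from this[of "degree f"] d_pos[of "degree f + 2"] show False by simp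
qed

private lemma h: "char_h f \<ge> 1" "char_d f (char_h f + 1) = 1"
  "1 \<le> i \<Longrightarrow> i < char_h f \<Longrightarrow> char_d f (i + 1) \<noteq> 1"
proof -
  have eq: "char_h f = (LEAST i. i \<ge> 1 \<and> char_d f (i + 1) = 1)" by (simp add: char_h_def not_Y)
  obtain i0 where "i0 \<ge> 1 \<and> char_d f (i0 + 1) = 1" using h_exists by blast
  from LeastI[where P = "\<lambda>i. i \<ge> 1 \<and> char_d f (i + 1) = 1", OF this]
  show "char_h f \<ge> 1" "char_d f (char_h f + 1) = 1" unfolding eq by blast+
  show "1 \<le> i \<Longrightarrow> i < char_h f \<Longrightarrow> char_d f (i + 1) \<noteq> 1"
    unfolding eq using not_less_Least[where P = "\<lambda>i. i \<ge> 1 \<and> char_d f (i + 1) = 1"] by blast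
qed

private lemma m_mem:
  assumes "1 \<le> i" "i \<le> char_h f"
  shows "char_m f i \<in> newton_supp f"
proof (cases "i = 1")
  case True
  then show ?thesis using m_1(1) by simp
next
  case False
  then show ?thesis using m_i(1)[of i] h(3)[of "i - 1"] assms by simp
qed

private lemma m_step:
  assumes "1 \<le> i" "i < char_h f"
  shows "char_m f i \<le> char_m f (Suc i)"
proof (cases "i = 1")
  case True
  then show ?thesis using m_1(2) m_mem[of "Suc i"] assms by simp
next
  case False
  have 1: "char_d f i \<noteq> 1" using h(3)[of "i - 1"] False assms by simp
  have 2: "char_d f (Suc i) \<noteq> 1" using h(3)[of i] assms by simp
  have "\<not> char_d f (Suc i) dvd char_m f (Suc i)" using m_i(2)[OF _ 2] assms by simp
  moreover have "char_d f (Suc i) dvd char_d f i" by (simp add: char_d_Suc)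
  ultimately have "\<not> char_d f i dvd char_m f (Suc i)" by (meson dvd_trans)
  then show ?thesis using m_i(3)[OF _ 1] m_mem[of "Suc i"] False assms by simp
qed

private lemma m_mono:
  assumes "1 \<le> i" "i \<le> j" "j \<le> char_h f"
  shows "char_m f i \<le> char_m f j"
  using assms(2,3)
proof (induction j rule: dec_induct)
  case (step k)
  then show ?case using m_step[of k] assms(1) by simp
qed simp

lemma char_d_below_nonempty:
  assumes down: "\<And>s t. Q s \<Longrightarrow> t \<le> s \<Longrightarrow> Q t"
  shows "char_d f (card {i \<in> {1..char_h f}. Q (char_m f i)} + 1) =
    Gcd (insert (int (degree f)) {s \<in> newton_supp f. Q s})" (is "char_d f (card ?A + 1) = Gcd ?B")
proof -
  define p where "p = Max (insert 0 ?A)"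
  have p_in: "p \<in> insert 0 ?A" unfolding p_def by (rule Max_in) auto
  have p_max: "i \<le> p" if "i \<in> ?A" for i unfolding p_def using that by (intro Max_ge) auto
  have Aeq: "?A = {1..p}"
  proof (intro equalityI subsetI)
    fix i assume i: "i \<in> {1..p}"
    then have "p \<in> ?A" using p_in by auto
    then show "i \<in> ?A" using i m_mono[of i p] down by auto
  qed (use p_max in auto)
  have p: "card ?A = p" "p \<le> char_h f"
    unfolding Aeq using p_in by auto
  have pA: "Q (char_m f i)" if "1 \<le> i" "i \<le> p" for i
  proof -
    have "i \<in> ?A" unfolding Aeq using that by simp
    then show ?thesis by blast
  qed
  have "Gcd ?B dvd char_d f (p + 1)"
    unfolding char_d_def
  proof (rule Gcd_greatest)
    fix a assume "a \<in> char_m f ` {..<p + 1}"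
    then obtain i where i': "i \<in> {..<p + 1}" "a = char_m f i" by (rule imageE)
    then have i: "i \<le> p" "a = char_m f i" by simp_all
    have "a \<in> ?B"
    proof (cases "i = 0")
      case False
      then show ?thesis using i pA[of i] m_mem[of i] p(2) by simp
    qed (simp add: i)
    then show "Gcd ?B dvd a" by (rule Gcd_dvd)
  qed
  moreover have "char_d f (p + 1) dvd Gcd ?B"
  proof (rule Gcd_greatest)
    fix a assume "a \<in> ?B"
    then consider "a = int (degree f)" | "a \<in> newton_supp f" "Q a" by auto
    then show "char_d f (p + 1) dvd a"
    proof cases
      case 1
      then show ?thesis using char_d_dvd_degree[of "p + 1" f] by simp
    next
      case 2
      show ?thesis
      proof (cases "p = char_h f")
        case True
        then show ?thesis using h(2) by simp
      next
        case False
        then have p1: "Suc p \<le> char_h f" using p(2) by simp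
        have nQ: "\<not> Q (char_m f (Suc p))"
        proof
          assume "Q (char_m f (Suc p))"
          then have "Suc p \<in> ?A" using p1 by simp
          then show False using p_max by fastforce
        qed
        show ?thesis
        proof (cases "p = 0")
          case True
          then show ?thesis using nQ m_1(2)[OF 2(1)] down[OF 2(2)] by simp
        next
          case p0: False
          have "char_d f (Suc p) \<noteq> 1" using h(3)[of p] p0 p1 by simp
          then show ?thesis using nQ m_i(3)[of "Suc p" a] 2 down[OF 2(2)] p0 by auto
        qed
      qed
    qed
  qed
  ultimately show ?thesis unfolding p(1)
    using char_d_nonneg[of f "p + 1"] by (intro zdvd_antisym_nonneg) auto
qed

end

text \<open>
  Each \<open>m\<^sub>i\<close> is the least exponent that is not divisible by the gcd of the previous ones, so all exponents
  before \<open>m\<^sub>i\<close> are already divisible by that gcd. The predicate \<open>Q\<close> stands for \<open>s < n\<lambda>\<close> and for \<open>s \<le> n\<lambda>\<close>.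
\<close>

lemma char_d_below:
  fixes f :: "'a::{alg_closed_field, field_char_0} fls poly"
  assumes f: "f \<in> Rnat" and down: "\<And>s t. Q s \<Longrightarrow> t \<le> s \<Longrightarrow> Q t"
  shows "char_d f (card {i \<in> {1..char_h f}. Q (char_m f i)} + 1) =
    Gcd (insert (int (degree f)) {s \<in> newton_supp f. Q s})"
proof (cases "f = [:0, 1:]")
  case True
  then have "degree f = 1" "char_h f = 0" by (simp_all add: char_h_def)
  then show ?thesis by (simp add: char_d_def lessThan_Suc)
next
  case False
  obtain c z where cz: "newton_data f c z" using newton_data_exists[OF f] .
  note P = newton_supp_properties[OF f cz]
  obtain b where b: "\<And>s. s \<in> newton_supp f \<Longrightarrow> b \<le> s" using P(1) by blast
  have ne: "newton_supp f \<noteq> {}" using P(3) False by blast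
  show ?thesis
    by (rule char_d_below_nonempty[OF Rnat_degree_pos[OF f] b P(2) ne False]) (assumption, erule down, assumption)
qed

lemma card_image_congruence:
  assumes "m dvd n" "n > 0"
    and eq: "\<And>i j. i < n \<Longrightarrow> j < n \<Longrightarrow> \<phi> i = \<phi> j \<longleftrightarrow> int m dvd int i - int j"
  shows "card (\<phi> ` {..<n}) = m"
proof -
  have m: "m > 0" "m \<le> n" using assms(1,2) by (auto intro: gr0I dvd_imp_le)
  have "\<phi> ` {..<n} = \<phi> ` {..<m}"
  proof (intro equalityI subsetI)
    fix v assume "v \<in> \<phi> ` {..<n}"
    then obtain i where i: "i < n" "v = \<phi> i" by auto
    have im: "i mod m < m" using m by simp
    have "int m dvd int i - int (i mod m)" by (simp add: of_nat_mod mod_eq_dvd_iff[symmetric])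
    then have "\<phi> i = \<phi> (i mod m)" using i(1) im m(2) by (subst eq) auto
    then show "v \<in> \<phi> ` {..<m}" using im i by auto
  qed (use m in auto)
  moreover have "inj_on \<phi> {..<m}"
  proof (rule inj_onI)
    fix i j assume "i \<in> {..<m}" "j \<in> {..<m}" "\<phi> i = \<phi> j"
    then show "i = j" using eq[of i j] m int_dvd_diff_imp_eq[of m i j] by simp
  qed
  ultimately show ?thesis by (simp add: card_image)
qed

text \<open>
  The conjugates numbered \<open>i\<close> and \<open>j\<close> agree below order \<open>e\<close> iff \<open>n\<close> divides \<open>(i - j)s\<close> for all exponents \<open>s\<close> below
  \<open>e\<close>, that is, iff \<open>i - j\<close> is divisible by \<open>n/g\<close>, where \<open>g\<close> is the gcd of \<open>n\<close> and these exponents.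
\<close>

lemma card_traces:
  fixes f :: "'a::{alg_closed_field, field_char_0} fls poly"
  assumes f: "f \<in> Rnat" "degree f dvd N" and N: "N > 0"
  shows "int (card (traces N e f)) =
    int (degree f) div Gcd (insert (int (degree f)) {s \<in> newton_supp f. int (N div degree f) * s < e})"
proof -
  define n where "n = degree f"
  have n: "n > 0" using Rnat_degree_pos[OF f(1)] by (simp add: n_def)
  obtain K where K: "N = degree f * K" "K > 0" using dvd_pos_factor[OF f(2) N] by blast
  have NK: "N div degree f = K" using K n by (simp add: n_def)
  obtain c z where cz: "newton_data f c z" using newton_data_exists[OF f(1)] .
  have c: "c \<noteq> 0" using cz unfolding newton_data_def by (blast dest: primitive_rootD(1))
  have S: "newton_supp f = {s. z $$ s \<noteq> 0}" by (rule newton_supp_eq[OF f(1) cz])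
  define A where "A = insert (int n) {s \<in> newton_supp f. int K * s < e}"
  define g where "g = nat (Gcd A)"
  have g: "int g = Gcd A" by (simp add: g_def)
  have "int g dvd int n" unfolding g by (rule Gcd_dvd) (simp add: A_def)
  then obtain m where m: "n = g * m" unfolding int_dvd_int_iff by (elim dvdE)
  have g0: "g > 0" "m > 0" using m n by (auto intro: gr0I)
  have tr: "traces N e f = (\<lambda>j. truncation e (conjugate K c z j)) ` {..<n}"
    by (simp add: traces_def K(1) newton_data_roots[OF cz K(2)] image_image n_def)
  have "card (traces N e f) = m"
    unfolding tr
  proof (rule card_image_congruence)
    show "m dvd n" by (simp add: m)
    fix i j assume "i < n" "j < n"
    have "truncation e (conjugate K c z i) = truncation e (conjugate K c z j) \<longleftrightarrow>
      (\<forall>s. int K * s < e \<longrightarrow> conjugate K c z i $$ (int K * s) = conjugate K c z j $$ (int K * s))"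
      unfolding truncation_eq_iff
    proof (intro iffI allI impI)
      fix k assume H: "\<forall>s. int K * s < e \<longrightarrow> conjugate K c z i $$ (int K * s) = conjugate K c z j $$ (int K * s)"
        and k: "k < e"
      show "conjugate K c z i $$ k = conjugate K c z j $$ k"
      proof (cases "int K dvd k")
        case True
        then obtain l where "k = int K * l" by (elim dvdE)
        then show ?thesis using H k by simp
      next
        case False
        then show ?thesis using K(2) by (simp add: conjugate_def fls_nth_compose_power)
      qed
    qed simp
    also have "\<dots> \<longleftrightarrow> (\<forall>s. z $$ s \<noteq> 0 \<and> int K * s < e \<longrightarrow> int n dvd (int i - int j) * s)"
      unfolding newton_data_conjugate_eq_iff[OF cz K(2)] by (simp only: n_def)
    also have "\<dots> \<longleftrightarrow> (\<forall>a\<in>A. int n dvd (int i - int j) * a)"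
      unfolding A_def S by auto
    also have "\<dots> \<longleftrightarrow> int n dvd Gcd ((*) (int i - int j) ` A)"
      by (simp add: dvd_Gcd_iff)
    also have "\<dots> \<longleftrightarrow> int g * int m dvd int g * (int i - int j)"
      by (subst Gcd_mult) (simp add: m mult.commute flip: g)
    also have "\<dots> \<longleftrightarrow> int m dvd (int i - int j)" using g0 by simp
    finally show "truncation e (conjugate K c z i) = truncation e (conjugate K c z j) \<longleftrightarrow>
      int m dvd (int i - int j)" .
  qed (rule n)
  moreover have "int n div Gcd A = int m" using g0 unfolding g[symmetric] by (simp add: m)
  ultimately show ?thesis by (simp add: A_def NK n_def)
qed

lemma D_poly_eq_card_traces:
  fixes f :: "'a::{alg_closed_field, field_char_0} fls poly"
  assumes f: "f \<in> Rnat" "degree f dvd N" and N: "N > 0"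
  shows "D_poly f (Fin l) = int (card (traces N \<lceil>l * rat_of_nat N\<rceil> f))"
    and "D_star_poly f (Fin l) = int (card (traces N (\<lfloor>l * rat_of_nat N\<rfloor> + 1) f))"
proof -
  have n: "degree f > 0" by (rule Rnat_degree_pos[OF f(1)])
  obtain K where K: "N = degree f * K" "K > 0" using dvd_pos_factor[OF f(2) N] by blast
  have NK: "N div degree f = K" using K n by simp
  have lt: "Fin (rat_of_int s / rat_of_nat (degree f)) < Fin l \<longleftrightarrow> int K * s < \<lceil>l * rat_of_nat N\<rceil>" for s
  proof -
    have "rat_of_int s / rat_of_nat (degree f) < l \<longleftrightarrow> rat_of_int s < l * rat_of_nat (degree f)"
      using n by (simp add: pos_divide_less_eq)
    also have "\<dots> \<longleftrightarrow> rat_of_nat K * rat_of_int s < rat_of_nat K * (l * rat_of_nat (degree f))"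
      using K(2) by simp
    also have "\<dots> \<longleftrightarrow> rat_of_int (int K * s) < l * rat_of_nat N" by (simp add: K(1) mult_ac)
    also have "\<dots> \<longleftrightarrow> int K * s < \<lceil>l * rat_of_nat N\<rceil>" by (simp only: less_ceiling_iff)
    finally show ?thesis by simp
  qed
  have le: "Fin (rat_of_int s / rat_of_nat (degree f)) \<le> Fin l \<longleftrightarrow> int K * s < \<lfloor>l * rat_of_nat N\<rfloor> + 1" for s
  proof -
    have "rat_of_int s / rat_of_nat (degree f) \<le> l \<longleftrightarrow> rat_of_int s \<le> l * rat_of_nat (degree f)"
      using n by (simp add: pos_divide_le_eq)
    also have "\<dots> \<longleftrightarrow> rat_of_nat K * rat_of_int s \<le> rat_of_nat K * (l * rat_of_nat (degree f))"
      using K(2) by simp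
    also have "\<dots> \<longleftrightarrow> rat_of_int (int K * s) \<le> l * rat_of_nat N" by (simp add: K(1) mult_ac)
    also have "\<dots> \<longleftrightarrow> int K * s \<le> \<lfloor>l * rat_of_nat N\<rfloor>" by (simp only: le_floor_iff)
    finally show ?thesis by simp
  qed
  have Kmono: "int K * t \<le> int K * s" if "t \<le> s" for s t using that by (intro mult_left_mono) auto
  show "D_poly f (Fin l) = int (card (traces N \<lceil>l * rat_of_nat N\<rceil> f))"
    unfolding D_poly_def char_c_def lt card_traces[OF f N] NK
    by (subst char_d_below[OF f(1), where Q = "\<lambda>s. int K * s < \<lceil>l * rat_of_nat N\<rceil>"])
       (auto dest: Kmono)
  show "D_star_poly f (Fin l) = int (card (traces N (\<lfloor>l * rat_of_nat N\<rfloor> + 1) f))"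
    unfolding D_star_poly_def char_c_def le card_traces[OF f N] NK
    by (subst char_d_below[OF f(1), where Q = "\<lambda>s. int K * s < \<lfloor>l * rat_of_nat N\<rfloor> + 1"])
       (auto dest: Kmono)
qed

text \<open>
  The two numbers are computed from the \<open>c\<^sub>i < l\<close> and the \<open>c\<^sub>i \<le> l\<close>. If \<open>l\<close> is an integer, the exponent \<open>nl\<close> is
  divisible by \<open>n\<close> and does not change the gcd.
\<close>

lemma D_jump_char_c:
  fixes f :: "'a::{alg_closed_field, field_char_0} fls poly"
  assumes f: "f \<in> Rnat" and ne: "D_poly f (Fin l) \<noteq> D_star_poly f (Fin l)"
  shows "\<exists>i\<in>{1..char_h f}. char_c f i = l \<and> l \<notin> \<int>"
proof -
  define A B where "A = {i \<in> {1..char_h f}. Fin (char_c f i) < Fin l}"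
    and "B = {i \<in> {1..char_h f}. Fin (char_c f i) \<le> Fin l}"
  have n: "degree f > 0" by (rule Rnat_degree_pos[OF f])
  have "A \<noteq> B" using ne by (auto simp: D_poly_def D_star_poly_def A_def B_def)
  then obtain i where i: "i \<in> {1..char_h f}" "char_c f i = l"
    unfolding A_def B_def by force
  have "l \<notin> \<int>"
  proof
    assume "l \<in> \<int>"
    then obtain k where k: "l = rat_of_int k" by (elim Ints_cases)
    have lt: "Fin (rat_of_int s / rat_of_nat (degree f)) < Fin l \<longleftrightarrow> s < k * int (degree f)" for s
    proof -
      have "rat_of_int s / rat_of_nat (degree f) < l \<longleftrightarrow> rat_of_int s < rat_of_int (k * int (degree f))"
        using n by (simp add: pos_divide_less_eq k)
      then show ?thesis by (simp only: of_int_less_iff less_extended_simps)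
    qed
    have le: "Fin (rat_of_int s / rat_of_nat (degree f)) \<le> Fin l \<longleftrightarrow> s \<le> k * int (degree f)" for s
    proof -
      have "rat_of_int s / rat_of_nat (degree f) \<le> l \<longleftrightarrow> rat_of_int s \<le> rat_of_int (k * int (degree f))"
        using n by (simp add: pos_divide_le_eq k)
      then show ?thesis by (simp only: of_int_le_iff less_eq_extended.simps)
    qed
    let ?L = "insert (int (degree f)) {s \<in> newton_supp f. s < k * int (degree f)}"
    let ?R = "insert (int (degree f)) {s \<in> newton_supp f. s \<le> k * int (degree f)}"
    have "Gcd ?L dvd Gcd ?R"
    proof (rule Gcd_greatest)
      fix a assume a: "a \<in> ?R"
      show "Gcd ?L dvd a"
      proof (cases "a = k * int (degree f)")
        case True
        have "Gcd ?L dvd int (degree f)" by (rule Gcd_dvd) simp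
        then show ?thesis by (simp add: True)
      next
        case False
        then show ?thesis using a by (intro Gcd_dvd) auto
      qed
    qed
    moreover have "Gcd ?R dvd Gcd ?L" 
    proof (rule Gcd_greatest)
      fix a assume "a \<in> ?L"
      then have "a \<in> ?R" by auto
      then show "Gcd ?R dvd a" by (rule Gcd_dvd)
    qed
    ultimately have "Gcd ?L = Gcd ?R" by (intro zdvd_antisym_nonneg) auto
    moreover have "char_d f (card A + 1) = Gcd ?L"
      unfolding A_def char_c_def lt by (rule char_d_below[OF f]) simp
    moreover have "char_d f (card B + 1) = Gcd ?R"
      unfolding B_def char_c_def le by (rule char_d_below[OF f]) simp
    ultimately show False using ne by (simp add: D_poly_def D_star_poly_def A_def B_def)
  qed
  then show ?thesis using i by blast
qed

section \<open>Roots of the derivative in a ball\<close>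

text \<open>
  The degree of the reduction modulo \<open>X\<close>, for a polynomial over \<open>k[[X]]\<close> with nonzero reduction. If the
  polynomial splits over \<open>k((X))\<close>, it is the number of roots of nonnegative order.
\<close>

definition residual_degree :: "'b::field fls poly \<Rightarrow> nat \<Rightarrow> bool" where
  "residual_degree P r \<longleftrightarrow> (\<exists>q. P = map_poly fps_to_fls q \<and>
     map_poly (\<lambda>c. fps_nth c 0) q \<noteq> 0 \<and> degree (map_poly (\<lambda>c. fps_nth c 0) q) = r)"

lemma residual_degree_1: "residual_degree 1 0"
  unfolding residual_degree_def by (intro exI[of _ 1]) simp

lemma residual_degree_mult:
  assumes "residual_degree P r" "residual_degree Q s"
  shows "residual_degree (P * Q) (r + s)"
proof -
  obtain p where p: "P = map_poly fps_to_fls p" "map_poly (\<lambda>c. fps_nth c 0) p \<noteq> 0"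
    "degree (map_poly (\<lambda>c. fps_nth c 0) p) = r" using assms(1) unfolding residual_degree_def by blast
  obtain q where q: "Q = map_poly fps_to_fls q" "map_poly (\<lambda>c. fps_nth c 0) q \<noteq> 0"
    "degree (map_poly (\<lambda>c. fps_nth c 0) q) = s" using assms(2) unfolding residual_degree_def by blast
  show ?thesis unfolding residual_degree_def
    by (rule exI[of _ "p * q"])
       (simp add: p q ring_morph.mp_mult[OF ring_morph_fps_to_fls] ring_morph.mp_mult[OF ring_morph_fps_nth_0]
         degree_mult_eq)
qed

lemma residual_degree_linear:
  assumes "fls_subdegree a \<ge> 0"
  shows "residual_degree [:- a, 1:] 1"
proof -
  have a: "fps_to_fls (fls_regpart a) = a" using assms by simp
  show ?thesis unfolding residual_degree_def
    by (rule exI[of _ "[:- fls_regpart a, 1:]"]) (simp add: map_poly_pCons a)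
qed

lemma residual_degree_inverse_linear:
  assumes "fls_subdegree a < 0"
  shows "residual_degree (smult (- inverse a) [:- a, 1:]) 0"
proof -
  define b where "b = fls_regpart (inverse a)"
  have a0: "a \<noteq> 0" using assms by auto
  have s: "fls_subdegree (inverse a) > 0" using assms by simp
  then have b: "fps_to_fls b = inverse a" by (simp add: b_def)
  have "fps_nth b 0 = 0" using s by (simp add: b_def)
  then show ?thesis unfolding residual_degree_def using a0
    by (intro exI[of _ "[:1, - b:]"]) (auto simp: map_poly_pCons b)
qed

lemma residual_degree_pderiv:
  fixes P :: "'b::field_char_0 fls poly"
  assumes "residual_degree P r" "r > 0"
  shows "residual_degree (pderiv P) (r - 1)"
proof -
  obtain p where p: "P = map_poly fps_to_fls p" "degree (map_poly (\<lambda>c. fps_nth c 0) p) = r"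
    using assms(1) unfolding residual_degree_def by blast
  have 1: "map_poly (\<lambda>c. fps_nth c 0) (pderiv p) = pderiv (map_poly (\<lambda>c. fps_nth c 0) p)"
    by (rule mp_pderiv[OF ring_morph_fps_nth_0])
  have 2: "pderiv P = map_poly fps_to_fls (pderiv p)"
    unfolding p(1) by (rule mp_pderiv[OF ring_morph_fps_to_fls, symmetric])
  have "pderiv (map_poly (\<lambda>c. fps_nth c 0) p) \<noteq> 0"
    using p(2) assms(2) by (simp add: pderiv_eq_0_iff)
  then show ?thesis unfolding residual_degree_def 2
    by (intro exI[of _ "pderiv p"]) (simp add: 1 degree_pderiv p(2))
qed

lemma residual_degree_scale_integral:
  assumes "residual_degree P r" "residual_degree (smult c P) s" "fls_subdegree c \<ge> 0"
  shows "r = s"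
proof -
  obtain p where p: "P = map_poly fps_to_fls p" "degree (map_poly (\<lambda>c. fps_nth c 0) p) = r"
    using assms(1) unfolding residual_degree_def by blast
  obtain q where q: "smult c P = map_poly fps_to_fls q" "map_poly (\<lambda>c. fps_nth c 0) q \<noteq> 0"
    "degree (map_poly (\<lambda>c. fps_nth c 0) q) = s"
    using assms(2) unfolding residual_degree_def by blast
  define d where "d = fls_regpart c"
  have d: "fps_to_fls d = c" using assms(3) by (simp add: d_def)
  have "fps_to_fls (coeff q i) = fps_to_fls (d * coeff p i)" for i
  proof -
    have "fps_to_fls (coeff q i) = coeff (smult c P) i"
      by (simp only: q(1) ring_morph.coeff_mp[OF ring_morph_fps_to_fls])
    also have "\<dots> = fps_to_fls (d * coeff p i)"
      by (simp add: p(1) d fls_times_fps_to_fls coeff_map_poly)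
    finally show ?thesis .
  qed
  then have "q = smult d p" by (intro poly_eqI) simp
  then have "map_poly (\<lambda>c. fps_nth c 0) q = smult (fps_nth d 0) (map_poly (\<lambda>c. fps_nth c 0) p)"
    by (simp add: ring_morph.mp_smult[OF ring_morph_fps_nth_0])
  then show ?thesis using q(2,3) p(2) by auto
qed

text \<open>
  A scaling that preserves integrality and a nonzero reduction is by a unit of \<open>k[[X]]\<close>.
\<close>

lemma residual_degree_scale:
  assumes "residual_degree P r" "residual_degree (smult c P) s"
  shows "r = s"
proof (cases "fls_subdegree c \<ge> 0")
  case True
  then show ?thesis using residual_degree_scale_integral assms by blast
next
  case False
  then have c: "c \<noteq> 0" by auto
  have "residual_degree (smult (inverse c) (smult c P)) r" using assms(1) c by simp
  moreover have "fls_subdegree (inverse c) \<ge> 0" using False by simp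
  ultimately have "s = r" using residual_degree_scale_integral assms(2) by blast
  then show ?thesis by simp
qed

text \<open>
  For a root \<open>x\<close> of negative order the factor is rescaled to \<open>1 - Y/x\<close>, whose reduction is \<open>1\<close>.
\<close>

lemma residual_degree_prod_linear:
  "\<exists>c. c \<noteq> 0 \<and> residual_degree (smult c (\<Prod>x\<in>#A. [:- x, 1:])) (size {#x\<in>#A. fls_subdegree x \<ge> 0#})"
proof (induction A)
  case empty
  show ?case using residual_degree_1 by (intro exI[of _ 1]) (simp add: one_pCons)
next
  case (add x A)
  then obtain c where c: "c \<noteq> 0"
    "residual_degree (smult c (\<Prod>x\<in>#A. [:- x, 1:])) (size {#x\<in>#A. fls_subdegree x \<ge> 0#})" by blast
  show ?case
  proof (cases "fls_subdegree x \<ge> 0")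
    case True
    show ?thesis
      using residual_degree_mult[OF residual_degree_linear[OF True] c(2)] c(1) True
      by (intro exI[of _ c]) (simp del: mult_pCons_left)
  next
    case False
    then have s: "fls_subdegree x < 0" by simp
    have "smult (- inverse x) [:- x, 1:] * smult c (\<Prod>x\<in>#A. [:- x, 1:]) =
      smult (- inverse x * c) (\<Prod>x\<in>#add_mset x A. [:- x, 1:])"
      by (simp only: image_mset_add_mset prod_mset.add_mset mult_smult_left mult_smult_right smult_smult
          mult.commute[of c])
    moreover have "- inverse x * c \<noteq> 0" using c(1) s by auto
    ultimately show ?thesis
      using residual_degree_mult[OF residual_degree_inverse_linear[OF s] c(2)] False
      by (intro exI[of _ "- inverse x * c"]) simp
  qed
qed

lemma unit_ball_count:
  fixes A B :: "'b::field_char_0 fls multiset"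
  assumes deriv: "pderiv (\<Prod>x\<in>#A. [:- x, 1:]) = smult k (\<Prod>x\<in>#B. [:- x, 1:])"
    and pos: "size {#x\<in>#A. fls_subdegree x \<ge> 0#} > 0"
  shows "size {#x\<in>#B. fls_subdegree x \<ge> 0#} = size {#x\<in>#A. fls_subdegree x \<ge> 0#} - 1"
proof -
  obtain c where c: "c \<noteq> 0"
    "residual_degree (smult c (\<Prod>x\<in>#A. [:- x, 1:])) (size {#x\<in>#A. fls_subdegree x \<ge> 0#})"
    using residual_degree_prod_linear by blast
  obtain d where d: "d \<noteq> 0"
    "residual_degree (smult d (\<Prod>x\<in>#B. [:- x, 1:])) (size {#x\<in>#B. fls_subdegree x \<ge> 0#})"
    using residual_degree_prod_linear by blast
  have "residual_degree (smult (c * k) (\<Prod>x\<in>#B. [:- x, 1:])) (size {#x\<in>#A. fls_subdegree x \<ge> 0#} - 1)"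
    using residual_degree_pderiv[OF c(2) pos] by (simp add: pderiv_smult deriv)
  moreover have "smult (c * k) (\<Prod>x\<in>#B. [:- x, 1:]) =
      smult (c * k / d) (smult d (\<Prod>x\<in>#B. [:- x, 1:]))" using d(1) by simp
  ultimately show ?thesis using residual_degree_scale[OF d(2)] by metis
qed

lemma pcompose_prod_linear:
  fixes t :: "'b::field"
  assumes "t \<noteq> 0"
  shows "pcompose (\<Prod>x\<in>#A. [:- x, 1:]) [:a, t:] =
    smult (t ^ size A) (\<Prod>x\<in>#image_mset (\<lambda>x. (x - a) / t) A. [:- x, 1:])"
proof (induction A)
  case (add x A)
  have "pcompose [:- x, 1:] [:a, t:] = smult t [:- ((x - a) / t), 1:]"
    using assms by (simp add: pcompose_pCons field_simps)
  then show ?case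
    by (simp only: image_mset_add_mset prod_mset.add_mset pcompose_mult add.IH size_add_mset power_Suc
        mult_smult_left mult_smult_right smult_smult mult.commute[of "t ^ size A"])
qed (simp add: one_pCons)

text \<open>
  The substitution \<open>Y \<mapsto> a + X\<^sup>e Y\<close> turns the ball into the set of series of nonnegative order, where the number
  of roots is the residual degree. This drops by one under differentiation.
\<close>

theorem ball_count:
  fixes A B :: "'b::field_char_0 fls multiset"
  assumes deriv: "pderiv (\<Prod>x\<in>#A. [:- x, 1:]) = smult k (\<Prod>x\<in>#B. [:- x, 1:])"
    and a: "a \<in># A"
  shows "size {#x\<in>#B. truncation e x = truncation e a#} + 1 = size {#x\<in>#A. truncation e x = truncation e a#}"
proof -
  define t :: "'b fls" where "t = fls_X_intpow e"
  have t: "t \<noteq> 0" by (simp add: t_def)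
  define \<psi> where "\<psi> x = (x - a) / t" for x
  have \<psi>: "fls_subdegree (\<psi> x) \<ge> 0 \<longleftrightarrow> truncation e x = truncation e a" for x
  proof (cases "x = a")
    case False
    then have "fls_subdegree (\<psi> x) = fls_subdegree (x - a) - e"
      using t by (simp add: \<psi>_def t_def fls_divide_subdegree)
    then show ?thesis using False by (simp add: truncation_eq_iff_subdegree)
  qed (simp add: \<psi>_def)
  have sz: "size {#x\<in>#image_mset \<psi> C. fls_subdegree x \<ge> 0#} = size {#x\<in>#C. truncation e x = truncation e a#}" for C
    by (simp add: filter_mset_image_mset \<psi>)
  let ?P = "\<Prod>x\<in>#A. [:- x, 1:]" and ?Q = "\<Prod>x\<in>#B. [:- x, 1:]"
  let ?P' = "\<Prod>x\<in>#image_mset \<psi> A. [:- x, 1:]" and ?Q' = "\<Prod>x\<in>#image_mset \<psi> B. [:- x, 1:]"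
  have P: "pcompose ?P [:a, t:] = smult (t ^ size A) ?P'" "pcompose ?Q [:a, t:] = smult (t ^ size B) ?Q'"
    unfolding \<psi>_def by (rule pcompose_prod_linear[OF t])+
  have "smult (t ^ size A) (pderiv ?P') = pderiv (pcompose ?P [:a, t:])" by (simp add: P pderiv_smult)
  also have "\<dots> = pcompose (smult k ?Q) [:a, t:] * [:t:]"
    by (simp add: pderiv_pcompose deriv pderiv_pCons)
  also have "\<dots> = smult (t * k * t ^ size B) ?Q'"
    by (simp add: pcompose_smult P(2) mult_ac)
  finally have "smult (t ^ size A) (pderiv ?P') = smult (t * k * t ^ size B) ?Q'" .
  then have "smult (inverse (t ^ size A)) (smult (t ^ size A) (pderiv ?P')) =
      smult (inverse (t ^ size A)) (smult (t * k * t ^ size B) ?Q')" by (simp only:)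
  then have eq: "pderiv ?P' = smult (inverse (t ^ size A) * (t * k * t ^ size B)) ?Q'"
    using t by simp
  have "a \<in># {#x\<in>#A. truncation e x = truncation e a#}" using a by simp
  then have pos: "size {#x\<in>#A. truncation e x = truncation e a#} > 0"
    by (metis nonempty_has_size empty_iff set_mset_empty)
  show ?thesis using unit_ball_count[OF eq] pos unfolding sz by simp
qed

section \<open>Monic factorization\<close>

lemma Rnat_nonzero_monic: "f \<in> Rnat \<Longrightarrow> f \<noteq> 0" "f \<in> Rnat \<Longrightarrow> lead_coeff f = 1"
  by (auto simp: Rnat_def)

lemma Rnat_dvd_eq:
  fixes f g :: "'a::{alg_closed_field, field_char_0} fls poly"
  assumes "f \<in> Rnat" "g \<in> Rnat" "f dvd g"
  shows "f = g"
proof -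
  have irr: "irreducible f" "irreducible g" using assms by (auto simp: Rnat_def)
  have "g dvd f" using irreducibleD'[OF irr(2) assms(3)] irreducible_not_unit[OF irr(1)] by blast
  then have "degree g \<le> degree f" using Rnat_nonzero_monic(1)[OF assms(1)] by (rule dvd_imp_degree_le)
  then show ?thesis
    using monic_dvd_same_degree[OF assms(3)] Rnat_nonzero_monic(2) assms(1,2) by blast
qed

lemma degree_prod_mset_Rnat:
  assumes "set_mset M \<subseteq> Rnat"
  shows "degree (prod_mset M) = (\<Sum>f\<in>#M. degree f)" "lead_coeff (prod_mset M) = 1"
proof -
  have "degree (prod_mset M) = (\<Sum>f\<in>#M. degree f) \<and> lead_coeff (prod_mset M) = 1"
    using assms
  proof (induction M)
    case (add f M)
    then have IH: "degree (prod_mset M) = (\<Sum>f\<in>#M. degree f)" "lead_coeff (prod_mset M) = 1"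
      and f: "f \<in> Rnat" by auto
    have "prod_mset M \<noteq> 0" using IH(2) by (metis leading_coeff_0_iff zero_neq_one)
    then have "degree (f * prod_mset M) = degree f + (\<Sum>f\<in>#M. degree f)"
      using Rnat_nonzero_monic(1)[OF f] IH(1) by (simp add: degree_mult_eq)
    moreover have "lead_coeff (f * prod_mset M) = 1"
      by (simp only: lead_coeff_mult IH(2) Rnat_nonzero_monic(2)[OF f] mult_1)
    ultimately show ?case by simp
  qed simp
  then show "degree (prod_mset M) = (\<Sum>f\<in>#M. degree f)" "lead_coeff (prod_mset M) = 1" by blast+
qed

lemma monic_factorization_exists:
  fixes H :: "'a::{alg_closed_field, field_char_0} fls poly"
  assumes "H \<noteq> 0"
  shows "\<exists>M. set_mset M \<subseteq> Rnat \<and> H = smult (lead_coeff H) (prod_mset M)"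
  using assms
proof (induction "degree H" arbitrary: H rule: less_induct)
  case (less H)
  show ?case
  proof (cases "degree H = 0")
    case True
    then obtain c where "H = [:c:]" by (elim degree_eq_zeroE)
    then show ?thesis by (intro exI[of _ "{#}"]) simp
  next
    case deg: False
    have lc: "lead_coeff H \<noteq> 0" using less.prems by simp
    show ?thesis
    proof (cases "irreducible H")
      case True
      define f where "f = [:inverse (lead_coeff H):] * H"
      have "is_unit [:inverse (lead_coeff H):]" using lc by (simp add: is_unit_const_poly_iff dvd_field_iff)
      then have "irreducible f" unfolding f_def using True by (simp only: irreducible_mult_unit_left)
      moreover have "lead_coeff f = 1" using lc by (simp add: f_def)
      ultimately have "f \<in> Rnat" by (simp add: Rnat_def)
      moreover have "H = smult (lead_coeff H) f" using lc by (simp add: f_def)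
      ultimately show ?thesis by (intro exI[of _ "{#f#}"]) simp
    next
      case False
      have "\<not> is_unit H" using deg less.prems by (simp add: is_unit_iff_degree)
      then obtain a b where ab: "H = a * b" "\<not> is_unit a" "\<not> is_unit b"
        using False less.prems by (auto simp: irreducible_def)
      have nz: "a \<noteq> 0" "b \<noteq> 0" using ab(1) less.prems by auto
      have "degree a > 0" "degree b > 0" using ab(2,3) nz by (auto simp: is_unit_iff_degree)
      moreover have "degree H = degree a + degree b" using nz by (simp add: ab(1) degree_mult_eq)
      ultimately obtain M1 M2 where M12: "set_mset M1 \<subseteq> Rnat" "set_mset M2 \<subseteq> Rnat"
        and a: "a = smult (lead_coeff a) (prod_mset M1)" and b: "b = smult (lead_coeff b) (prod_mset M2)"
        using less.hyps[of a] less.hyps[of b] nz by auto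
      have "H = smult (lead_coeff a) (prod_mset M1) * smult (lead_coeff b) (prod_mset M2)"
        using ab(1) a b by simp
      also have "\<dots> = smult (lead_coeff H) (prod_mset (M1 + M2))"
        unfolding ab(1) lead_coeff_mult by (simp add: mult.commute)
      finally show ?thesis using M12 by (intro exI[of _ "M1 + M2"]) auto
    qed
  qed
qed

lemma prod_mset_Rnat_inj:
  fixes M :: "'a::{alg_closed_field, field_char_0} fls poly multiset"
  assumes "set_mset M \<subseteq> Rnat" "set_mset M' \<subseteq> Rnat" "prod_mset M = prod_mset M'"
  shows "M = M'"
  using assms
proof (induction M arbitrary: M')
  case empty
  have "M' = {#}"
  proof (rule ccontr)
    assume "M' \<noteq> {#}"
    then obtain f where f: "f \<in># M'" by blast
    then have "degree f \<le> (\<Sum>f\<in>#M'. degree f)" by (metis image_eqI set_image_mset sum_mset.remove le_add1 image_mset_single in_image_mset)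
    also have "\<dots> = 0" using degree_prod_mset_Rnat(1)[OF empty(2)] empty(3)[symmetric] by simp
    finally show False using Rnat_degree_pos[of f] f empty(2) by auto
  qed
  then show ?case by simp
next
  case (add f M)
  have f: "f \<in> Rnat" using add.prems by simp
  then have "prime_elem f" by (auto simp: Rnat_def intro: field_poly_irreducible_imp_prime)
  moreover have "f dvd prod_mset M'" using add.prems(3) by (metis dvd_triv_left prod_mset.add_mset)
  ultimately obtain g where g: "g \<in># M'" "f dvd g" by (rule prime_elem_dvd_prod_msetE)
  have gR: "g \<in> Rnat" using g add.prems by auto
  have fg: "f = g" by (rule Rnat_dvd_eq[OF f gR g(2)])
  obtain M'' where M'': "M' = add_mset f M''" using g(1) fg by (metis mset_add)
  have "f * prod_mset M = f * prod_mset M''" using add.prems(3) M'' by simp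
  then have "prod_mset M = prod_mset M''" using Rnat_nonzero_monic(1)[OF f] by simp
  then have "M = M''" using add.IH[of M''] add.prems M'' by simp
  then show ?case by (simp add: M'')
qed

lemma monic_factors:
  fixes H :: "'a::{alg_closed_field, field_char_0} fls poly"
  assumes H: "H \<noteq> 0"
  shows "set_mset (monic_factors H) \<subseteq> Rnat" "H = smult (lead_coeff H) (prod_mset (monic_factors H))"
proof -
  obtain M where M: "set_mset M \<subseteq> Rnat" "H = smult (lead_coeff H) (prod_mset M)"
    using monic_factorization_exists[OF H] by blast
  let ?P = "\<lambda>M. set_mset M \<subseteq> Rnat \<and> (\<exists>H0. H = [:H0:] * prod_mset M) \<and>
     (M = {#} \<longleftrightarrow> H \<in> range (\<lambda>c. [:c:]))"
  have "monic_factors H = M"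
    unfolding monic_factors_def
  proof (rule the_equality)
    have "M = {#} \<longleftrightarrow> H \<in> range (\<lambda>c. [:c:])"
    proof
      assume "M = {#}"
      then have "H = [:lead_coeff H:]" using M(2) by simp
      then show "H \<in> range (\<lambda>c. [:c:])" by (rule range_eqI)
    next
      assume "H \<in> range (\<lambda>c. [:c:])"
      then have "degree H = 0" by auto
      then have "degree (prod_mset M) = 0" using M(2) H by (metis degree_smult_eq leading_coeff_0_iff)
      then have "(\<Sum>f\<in>#M. degree f) = 0" by (simp add: degree_prod_mset_Rnat(1)[OF M(1)])
      then have "\<forall>f\<in>#M. degree f = 0" by (simp add: sum_mset_0_iff)
      then show "M = {#}" using M(1) Rnat_degree_pos by (metis less_irrefl multiset_nonemptyE subsetD)
    qed
    moreover have "H = [:lead_coeff H:] * prod_mset M" using M(2) by simp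
    ultimately show "?P M" using M(1) by blast
    fix M' assume M': "?P M'"
    then obtain H0 where H0: "H = smult H0 (prod_mset M')" by auto
    have "lead_coeff H = H0" using degree_prod_mset_Rnat(2)[of M'] M' by (simp add: H0)
    then have "smult (lead_coeff H) (prod_mset M') = smult (lead_coeff H) (prod_mset M)"
      using H0 M(2) by metis
    then have "[:lead_coeff H:] * prod_mset M' = [:lead_coeff H:] * prod_mset M" by simp
    then have "prod_mset M' = prod_mset M" using H by (subst (asm) mult_left_cancel) simp_all
    then show "M' = M" using prod_mset_Rnat_inj M' M(1) by blast
  qed
  then show "set_mset (monic_factors H) \<subseteq> Rnat" "H = smult (lead_coeff H) (prod_mset (monic_factors H))"
    using M by simp_all
qed

text \<open>
  If \<open>f\<^sup>2\<close> divided \<open>F\<close>, the square of \<open>F/f\<close> would be a multiple of \<open>F\<close>, but \<open>F/f\<close> is not.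
\<close>

lemma squarefree_monic_factors:
  fixes F :: "'a::{alg_closed_field, field_char_0} fls poly"
  assumes F: "devoid_of_multiple_factors F"
  shows "monic_factors F = mset_set (set_mset (monic_factors F))"
proof -
  have F0: "F \<noteq> 0" using F by (simp add: devoid_of_multiple_factors_def)
  define M c where "M = monic_factors F" and "c = lead_coeff F"
  have M: "set_mset M \<subseteq> Rnat" "F = smult c (prod_mset M)" and c: "c \<noteq> 0"
    using monic_factors[OF F0] F0 by (auto simp: M_def c_def)
  have "count M f \<le> 1" for f
  proof (rule ccontr)
    assume "\<not> count M f \<le> 1"
    then have "{#f, f#} \<subseteq># M" by (simp add: subseteq_mset_def)
    then obtain L where L: "M = {#f, f#} + L" by (auto simp: mset_subset_eq_exists_conv)
    define g where "g = f * prod_mset L"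
    have "g ^ 2 = F * smult (inverse c) (prod_mset L)"
      using c by (simp add: g_def M(2) L power2_eq_square mult_ac)
    then have "g ^ 2 \<in> range (\<lambda>G. F * G)" by (rule range_eqI)
    then have "g \<in> ideal_radical (range (\<lambda>G. F * G))"
      unfolding ideal_radical_def by (intro CollectI exI[of _ 2] conjI) simp_all
    then have "F dvd g" using F unfolding devoid_of_multiple_factors_def by auto
    moreover have g0: "g \<noteq> 0" using F0 by (auto simp: g_def M(2) L)
    ultimately have "degree F \<le> degree g" by (rule dvd_imp_degree_le)
    moreover have "degree F = degree f + degree g"
      using c g0 F0 by (simp add: M(2) L g_def degree_mult_eq)
    moreover have "degree f > 0" using Rnat_degree_pos[of f] M(1) by (simp add: L)
    ultimately show False by simp
  qed
  then have "M = mset_set (set_mset M)"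
    by (intro multiset_eqI) (metis count_greater_zero_iff count_mset_set(1,3) finite_set_mset le_less
        less_one not_in_iff le_antisym One_nat_def Suc_leI)
  then show ?thesis by (simp add: M_def)
qed

section \<open>Contact as an ultrametric\<close>

context
  fixes f g :: "'a::{alg_closed_field, field_char_0} fls poly"
  assumes f: "f \<in> Rnat" and g: "g \<in> Rnat"
begin

private lemma N: "degree f * degree g > 0"
  using Rnat_degree_pos[OF f] Rnat_degree_pos[OF g] by simp

lemma noc_sym: "noc f g \<ge> Fin l \<longleftrightarrow> noc g f \<ge> Fin l" "noc f g > Fin l \<longleftrightarrow> noc g f > Fin l"
  using noc_ge_iff[OF f _ g _ N] noc_ge_iff[OF g _ f _ N]
    noc_gt_iff[OF f _ g _ N] noc_gt_iff[OF g _ f _ N] by auto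

lemma noc_Minf: "noc f g > Minf"
  using noc_cases[OF f _ g _ N] by auto

lemma noc_finite_or_eq: "(\<exists>l. noc f g = Fin l) \<or> noc f g = Pinf \<and> f = g"
  using noc_cases[OF f _ g _ N] by auto

lemma D_poly_cong: "noc f g \<ge> Fin l \<Longrightarrow> D_poly f (Fin l) = D_poly g (Fin l)"
  using noc_ge_iff[OF f _ g _ N] D_poly_eq_card_traces(1)[OF f _ N] D_poly_eq_card_traces(1)[OF g _ N]
  by simp

lemma D_star_poly_cong: "noc f g > Fin l \<Longrightarrow> D_star_poly f (Fin l) = D_star_poly g (Fin l)"
  using noc_gt_iff[OF f _ g _ N] D_poly_eq_card_traces(2)[OF f _ N] D_poly_eq_card_traces(2)[OF g _ N]
  by simp

end

lemma noc_self: "f \<in> Rnat \<Longrightarrow> noc f f > Fin l"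
  using noc_gt_iff[of f "degree f" f l] Rnat_degree_pos[of f] by simp

lemma noc_trans:
  fixes f g h :: "'a::{alg_closed_field, field_char_0} fls poly"
  assumes f: "f \<in> Rnat" and g: "g \<in> Rnat" and h: "h \<in> Rnat"
  shows "noc f g \<ge> Fin l \<Longrightarrow> noc g h \<ge> Fin l \<Longrightarrow> noc f h \<ge> Fin l"
    "noc f g > Fin l \<Longrightarrow> noc g h > Fin l \<Longrightarrow> noc f h > Fin l"
proof -
  define N where "N = degree f * degree g * degree h"
  have N: "N > 0" using Rnat_degree_pos[OF f] Rnat_degree_pos[OF g] Rnat_degree_pos[OF h] by (simp add: N_def)
  have d: "degree f dvd N" "degree g dvd N" "degree h dvd N" by (simp_all add: N_def)
  show "noc f g \<ge> Fin l \<Longrightarrow> noc g h \<ge> Fin l \<Longrightarrow> noc f h \<ge> Fin l"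
    unfolding noc_ge_iff[OF f d(1) g d(2) N] noc_ge_iff[OF g d(2) h d(3) N] noc_ge_iff[OF f d(1) h d(3) N]
    by simp
  show "noc f g > Fin l \<Longrightarrow> noc g h > Fin l \<Longrightarrow> noc f h > Fin l"
    unfolding noc_gt_iff[OF f d(1) g d(2) N] noc_gt_iff[OF g d(2) h d(3) N] noc_gt_iff[OF f d(1) h d(3) N]
    by simp
qed

section \<open>Counting the factors of the derivative\<close>

definition root_mset :: "nat \<Rightarrow> 'b::field fls poly multiset \<Rightarrow> 'b fls multiset" where
  "root_mset N M = (\<Sum>f\<in>#M. mset_set (ramified_roots N f))"

lemma prod_mset_root_mset:
  fixes M :: "'a::{alg_closed_field, field_char_0} fls poly multiset"
  assumes M: "set_mset M \<subseteq> Rnat" "\<And>f. f \<in># M \<Longrightarrow> degree f dvd N" and N: "N > 0"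
  shows "compose_power_poly N (prod_mset M) = (\<Prod>x\<in>#root_mset N M. [:- x, 1:])"
  using M
proof (induction M)
  case (add f M)
  interpret cp: ring_morph "\<lambda>c::'a fls. fls_compose_power c N" by (rule ring_morph_compose_power[OF N])
  have "compose_power_poly N f = (\<Prod>x\<in>#mset_set (ramified_roots N f). [:- x, 1:])"
    using ramified_roots_splitting(1)[of f N] add.prems N by (simp add: prod_unfold_prod_mset)
  then show ?case using add by (simp add: root_mset_def cp.mp_mult)
qed (simp add: root_mset_def N)

text \<open>
  The balls met by \<open>s\<close> contain all the roots of a factor or none of them.
\<close>

lemma size_root_mset_in:
  fixes M :: "'a::{alg_closed_field, field_char_0} fls poly multiset"
  assumes M: "set_mset M \<subseteq> Rnat" "\<And>f. f \<in># M \<Longrightarrow> degree f dvd N" and N: "N > 0"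
    and s: "s \<subseteq> Rnat" "\<And>f. f \<in> s \<Longrightarrow> degree f dvd N"
  shows "size {#x\<in>#root_mset N M. truncation e x \<in> (\<Union>h\<in>s. traces N e h)#} =
    degree (prod_mset {#f\<in>#M. \<exists>h\<in>s. traces N e f = traces N e h#})"
proof -
  let ?T = "\<Union>h\<in>s. traces N e h"
  let ?Q = "\<lambda>f. \<exists>h\<in>s. traces N e f = traces N e h"
  have "size {#x\<in>#root_mset N M. truncation e x \<in> ?T#} = (\<Sum>f\<in>#{#f\<in>#M. ?Q f#}. degree f)"
    using M
  proof (induction M)
    case (add f M)
    have f: "f \<in> Rnat" "degree f dvd N" using add.prems by auto
    note split = ramified_roots_splitting[OF f N]
    have "size {#x\<in>#mset_set (ramified_roots N f). truncation e x \<in> ?T#} = (if ?Q f then degree f else 0)"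
    proof (cases "?Q f")
      case True
      then have "\<forall>x\<in>ramified_roots N f. truncation e x \<in> ?T" by (auto simp: traces_def)
      then have "{x \<in> ramified_roots N f. truncation e x \<in> ?T} = ramified_roots N f" by blast
      then show ?thesis using True split by simp
    next
      case False
      have "truncation e x \<notin> ?T" if x: "x \<in> ramified_roots N f" for x
      proof
        assume "truncation e x \<in> ?T"
        then obtain h where h: "h \<in> s" "truncation e x \<in> traces N e h" by blast
        have "truncation e x \<in> traces N e f" using x by (simp add: traces_def)
        then have "traces N e f \<inter> traces N e h \<noteq> {}" using h(2) by blast
        then have "traces N e f = traces N e h"
          using traces_eq_if_meet[OF f _ _ N] s h(1) by blast
        then show False using False h(1) by blast
      qed
      then have "{x \<in> ramified_roots N f. truncation e x \<in> ?T} = {}" by blast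
      then show ?thesis using False split(3) by simp
    qed
    then show ?case using add by (simp add: root_mset_def)
  qed (simp add: root_mset_def)
  also have "\<dots> = degree (prod_mset {#f\<in>#M. ?Q f#})"
    using M(1) by (subst degree_prod_mset_Rnat(1)) auto
  finally show ?thesis .
qed

lemma size_filter_fibres:
  assumes "finite T"
  shows "size {#x\<in>#A. \<phi> x \<in> T#} = (\<Sum>u\<in>T. size {#x\<in>#A. \<phi> x = u#})"
proof (induction A)
  case (add a A)
  have "(\<Sum>u\<in>T. size {#x\<in>#add_mset a A. \<phi> x = u#}) = (\<Sum>u\<in>T. (if \<phi> a = u then 1 else 0) + size {#x\<in>#A. \<phi> x = u#})"
    by (rule sum.cong) auto
  then show ?case using add assms by (simp add: sum.distrib)
qed simp

lemma derivative_roots: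
  fixes F :: "'a::{alg_closed_field, field_char_0} fls poly"
  assumes F: "F \<noteq> 0" "pderiv F \<noteq> 0" and N: "N > 0"
    and M: "\<And>f. f \<in># monic_factors F \<Longrightarrow> degree f dvd N"
    and M': "\<And>f. f \<in># monic_factors (pderiv F) \<Longrightarrow> degree f dvd N"
  shows "\<exists>k. pderiv (\<Prod>x\<in>#root_mset N (monic_factors F). [:- x, 1:]) =
    smult k (\<Prod>x\<in>#root_mset N (monic_factors (pderiv F)). [:- x, 1:])"
proof -
  interpret cp: ring_morph "\<lambda>c::'a fls. fls_compose_power c N" by (rule ring_morph_compose_power[OF N])
  let ?p = "prod_mset (monic_factors F)" and ?q = "prod_mset (monic_factors (pderiv F))"
  have "smult (lead_coeff F) (pderiv ?p) = pderiv F"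
    using monic_factors(2)[OF F(1)] by (metis pderiv_smult)
  also have "\<dots> = smult (lead_coeff (pderiv F)) ?q" by (rule monic_factors(2)[OF F(2)])
  finally have "smult (inverse (lead_coeff F)) (smult (lead_coeff F) (pderiv ?p)) =
      smult (inverse (lead_coeff F)) (smult (lead_coeff (pderiv F)) ?q)" by (simp only:)
  then have p: "pderiv ?p = smult (inverse (lead_coeff F) * lead_coeff (pderiv F)) ?q" (is "_ = smult ?c _")
    using F(1) by simp
  have "pderiv (compose_power_poly N ?p) = compose_power_poly N (pderiv ?p)"
    by (rule mp_pderiv[OF ring_morph_compose_power[OF N], symmetric])
  also have "\<dots> = smult (fls_compose_power ?c N) (compose_power_poly N ?q)"
    unfolding p by (rule cp.mp_smult)
  finally show ?thesis
    using prod_mset_root_mset[OF monic_factors(1)[OF F(1)] M N]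
      prod_mset_root_mset[OF monic_factors(1)[OF F(2)] M' N] by metis
qed

text \<open>
  The sum of \<open>ball_count\<close> over all the balls met by \<open>s\<close>.
\<close>

theorem derivative_count:
  fixes F :: "'a::{alg_closed_field, field_char_0} fls poly"
  assumes F: "F \<noteq> 0" "pderiv F \<noteq> 0" and N: "N > 0"
    and M: "\<And>f. f \<in># monic_factors F \<Longrightarrow> degree f dvd N"
    and M': "\<And>f. f \<in># monic_factors (pderiv F) \<Longrightarrow> degree f dvd N"
    and s: "s \<subseteq> set_mset (monic_factors F)"
  shows "degree (prod_mset {#g\<in>#monic_factors (pderiv F). \<exists>h\<in>s. traces N e g = traces N e h#})
      + card (\<Union>h\<in>s. traces N e h) =
    degree (prod_mset {#g\<in>#monic_factors F. \<exists>h\<in>s. traces N e g = traces N e h#})"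
proof -
  let ?T = "\<Union>h\<in>s. traces N e h"
  let ?A = "root_mset N (monic_factors F)" and ?B = "root_mset N (monic_factors (pderiv F))"
  note R = monic_factors(1)[OF F(1)] monic_factors(1)[OF F(2)]
  have sR: "s \<subseteq> Rnat" "\<And>f. f \<in> s \<Longrightarrow> degree f dvd N" using s R(1) M by auto
  have fin: "finite ?T"
    using finite_subset[OF s] ramified_roots_splitting(3)[OF _ _ N] sR by (auto simp: traces_def)
  obtain k where k: "pderiv (\<Prod>x\<in>#?A. [:- x, 1:]) = smult k (\<Prod>x\<in>#?B. [:- x, 1:])"
    using derivative_roots[OF F N M M'] by blast
  have each: "size {#x\<in>#?B. truncation e x = u#} + 1 = size {#x\<in>#?A. truncation e x = u#}" if u: "u \<in> ?T" for u
  proof -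
    obtain h x where hx: "h \<in> s" "x \<in> ramified_roots N h" "u = truncation e x"
      using u by (auto simp: traces_def)
    have "finite (ramified_roots N h)" using ramified_roots_splitting(3)[OF _ _ N] sR hx(1) by blast
    then have "x \<in># ?A" using hx s by (auto simp: root_mset_def intro!: bexI[of _ h])
    from ball_count[OF k this] show ?thesis by (simp add: hx(3))
  qed
  have "size {#x\<in>#?B. truncation e x \<in> ?T#} + card ?T =
      (\<Sum>u\<in>?T. size {#x\<in>#?B. truncation e x = u#} + 1)"
    unfolding size_filter_fibres[OF fin] by (simp only: sum.distrib card_eq_sum)
  also have "\<dots> = size {#x\<in>#?A. truncation e x \<in> ?T#}"
    unfolding size_filter_fibres[OF fin] by (rule sum.cong[OF refl each])
  finally show ?thesis
    by (simp only: size_root_mset_in[OF R(1) M N sR] size_root_mset_in[OF R(2) M' N sR])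
qed

section \<open>The tree of a squarefree polynomial\<close>

locale squarefree_polynomial =
  fixes F :: "'a::{alg_closed_field, field_char_0} fls poly"
  assumes nonconst: "F \<notin> range (\<lambda>c. [:c:])"
    and squarefree: "devoid_of_multiple_factors F"
begin

definition factors where "factors = set_mset (monic_factors F)"
definition critical where "critical = monic_factors (pderiv F)"

text \<open>
  A common multiple of the degrees of all the factors of \<open>F\<close> and of its derivative.
\<close>

definition N :: nat where "N = fact (degree F)"
definition closed_traces where "closed_traces l f = traces N \<lceil>l * rat_of_nat N\<rceil> f"
definition open_traces where "open_traces l f = traces N (\<lfloor>l * rat_of_nat N\<rfloor> + 1) f"
definition relevant where "relevant = factors \<union> set_mset critical"

lemma F_nonzero: "F \<noteq> 0"
  using squarefree by (simp add: devoid_of_multiple_factors_def)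

lemma degree_F: "degree F > 0"
proof (rule ccontr)
  assume "\<not> degree F > 0"
  then obtain c where "F = [:c:]" by (auto elim: degree_eq_zeroE)
  then show False using nonconst by blast
qed

lemma pderiv_F: "pderiv F \<noteq> 0"
  using degree_F by (simp add: pderiv_eq_0_iff)

lemma N_pos: "N > 0"
  by (simp add: N_def)

lemma finite_factors: "finite factors"
  by (simp add: factors_def)

lemma factors_F: "monic_factors F = mset_set factors"
  unfolding factors_def by (rule squarefree_monic_factors[OF squarefree])

lemma factors_Rnat: "f \<in> factors \<Longrightarrow> f \<in> Rnat"
  using monic_factors(1)[OF F_nonzero] by (auto simp: factors_def)

lemma critical_Rnat: "g \<in># critical \<Longrightarrow> g \<in> Rnat"
  using monic_factors(1)[OF pderiv_F] by (auto simp: critical_def)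

lemma relevant_Rnat: "f \<in> relevant \<Longrightarrow> f \<in> Rnat"
  using factors_Rnat critical_Rnat by (auto simp: relevant_def)

lemma factors_relevant: "f \<in> factors \<Longrightarrow> f \<in> relevant" and critical_relevant: "g \<in># critical \<Longrightarrow> g \<in> relevant"
  by (auto simp: relevant_def)

lemma dvd_F: "f \<in> factors \<Longrightarrow> f dvd F"
proof -
  assume "f \<in> factors"
  then have "f dvd prod_mset (monic_factors F)" unfolding factors_def by (rule dvd_prod_mset)
  then show "f dvd F" by (subst monic_factors(2)[OF F_nonzero]) (rule dvd_smult)
qed

lemma dvd_pderiv_F: "g \<in># critical \<Longrightarrow> g dvd pderiv F"
proof -
  assume "g \<in># critical"
  then have "g dvd prod_mset (monic_factors (pderiv F))" unfolding critical_def by (rule dvd_prod_mset)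
  then show "g dvd pderiv F" by (subst monic_factors(2)[OF pderiv_F]) (rule dvd_smult)
qed

lemma relevant_dvd: assumes "f \<in> relevant" shows "degree f dvd N"
proof -
  have "degree f \<le> degree F"
    using assms dvd_F dvd_pderiv_F dvd_imp_degree_le[OF _ F_nonzero, of f]
      dvd_imp_degree_le[OF _ pderiv_F, of f] degree_pderiv[of F]
    unfolding relevant_def by fastforce
  moreover have "degree f > 0" using Rnat_degree_pos[OF relevant_Rnat[OF assms]] .
  ultimately show ?thesis unfolding N_def by (intro dvd_fact) auto
qed

lemma factors_nonempty: "factors \<noteq> {}"
proof
  assume "factors = {}"
  then have "F = [:lead_coeff F:]" using monic_factors(2)[OF F_nonzero] by (simp add: factors_def)
  then show False using nonconst by (metis rangeI)
qed

lemma ge_iff: "f \<in> relevant \<Longrightarrow> g \<in> relevant \<Longrightarrow> noc f g \<ge> Fin l \<longleftrightarrow> closed_traces l f = closed_traces l g"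
  unfolding closed_traces_def by (rule noc_ge_iff[OF relevant_Rnat relevant_dvd relevant_Rnat relevant_dvd N_pos])

lemma gt_iff: "f \<in> relevant \<Longrightarrow> g \<in> relevant \<Longrightarrow> noc f g > Fin l \<longleftrightarrow> open_traces l f = open_traces l g"
  unfolding open_traces_def by (rule noc_gt_iff[OF relevant_Rnat relevant_dvd relevant_Rnat relevant_dvd N_pos])

lemma closed_traces_if_open_traces: "f \<in> relevant \<Longrightarrow> g \<in> relevant \<Longrightarrow> open_traces l f = open_traces l g \<Longrightarrow> closed_traces l f = closed_traces l g"
  using ge_iff gt_iff by (metis less_imp_le)

lemma D_poly_closed_traces: "f \<in> relevant \<Longrightarrow> D_poly f (Fin l) = int (card (closed_traces l f))"
  unfolding closed_traces_def by (rule D_poly_eq_card_traces(1)[OF relevant_Rnat relevant_dvd N_pos])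

lemma D_star_poly_open_traces: "f \<in> relevant \<Longrightarrow> D_star_poly f (Fin l) = int (card (open_traces l f))"
  unfolding open_traces_def by (rule D_poly_eq_card_traces(2)[OF relevant_Rnat relevant_dvd N_pos])

text \<open>
  Write \<open>F = c g P\<close>. If \<open>g\<close> divides the derivative, then it divides \<open>P g'\<close>, but \<open>g\<close> divides neither \<open>P\<close>, as \<open>F\<close> is
  squarefree, nor \<open>g'\<close>, for reasons of degree.
\<close>

lemma critical_not_factors: assumes "g \<in># critical" shows "g \<notin> factors"
proof
  assume g: "g \<in> factors"
  have gR: "g \<in> Rnat" using factors_Rnat[OF g] .
  then have prime: "prime_elem g" by (auto simp: Rnat_def intro: field_poly_irreducible_imp_prime)
  define P where "P = prod_mset (mset_set (factors - {g}))"
  have "mset_set factors = add_mset g (mset_set (factors - {g}))" using g finite_factors by (simp add: mset_set.remove)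
  then have F: "F = smult (lead_coeff F) (g * P)"
    using monic_factors(2)[OF F_nonzero] by (simp add: factors_F P_def)
  have "pderiv F = smult (lead_coeff F) (pderiv (g * P))" by (subst F) (rule pderiv_smult)
  then have "g dvd smult (lead_coeff F) (pderiv (g * P))" using dvd_pderiv_F[OF assms] by simp
  then have "g dvd pderiv (g * P)" using F_nonzero by (subst (asm) dvd_smult_iff) auto
  then have "g dvd g * pderiv P + P * pderiv g" by (simp only: pderiv_mult)
  then have "g dvd P * pderiv g" by (subst (asm) dvd_add_right_iff) auto
  then consider "g dvd P" | "g dvd pderiv g" using prime by (meson prime_elem_dvd_multD)
  then show False
  proof cases
    case 1
    then obtain f where "f \<in># mset_set (factors - {g})" "g dvd f"
      unfolding P_def by (rule prime_elem_dvd_prod_msetE[OF prime])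
    then have f: "f \<in> factors" "f \<noteq> g" "g dvd f" using finite_factors by auto
    then show False using Rnat_dvd_eq[OF gR factors_Rnat[OF f(1)] f(3)] by simp
  next
    case 2
    have d: "degree g > 0" using Rnat_degree_pos[OF gR] .
    then have "pderiv g \<noteq> 0" by (simp add: pderiv_eq_0_iff)
    with 2 have "degree g \<le> degree (pderiv g)" by (rule dvd_imp_degree_le)
    then show False using d by (simp add: degree_pderiv)
  qed
qed

text \<open>
  The stems of the buds of level \<open>l\<close> in the tree.
\<close>

definition contact_class where "contact_class l f0 = {f \<in> factors. closed_traces l f = closed_traces l f0}"

lemma degree_factors_F:
  "degree (prod_mset {#f \<in># monic_factors F. P f#}) = (\<Sum>f\<in>{f \<in> factors. P f}. degree f)"
proof -
  have "set_mset {#f \<in># monic_factors F. P f#} \<subseteq> Rnat" using monic_factors(1)[OF F_nonzero] by auto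
  then show ?thesis
    by (simp add: degree_prod_mset_Rnat(1) factors_F finite_factors sum_unfold_sum_mset)
qed

lemma degree_critical:
  "degree (prod_mset {#f \<in># critical. P f#}) = (\<Sum>f\<in>#{#f \<in># critical. P f#}. degree f)"
  by (rule degree_prod_mset_Rnat(1)) (use critical_Rnat in auto)

lemma count_traces:
  assumes "s \<subseteq> factors"
  shows "degree (prod_mset {#g\<in>#critical. \<exists>h\<in>s. traces N e g = traces N e h#})
      + card (\<Union>h\<in>s. traces N e h) = (\<Sum>f\<in>{f \<in> factors. \<exists>h\<in>s. traces N e f = traces N e h}. degree f)"
  unfolding degree_factors_F[symmetric] critical_def
  by (rule derivative_count[OF F_nonzero pderiv_F N_pos])
     (use relevant_dvd assms in \<open>auto simp: relevant_def factors_def critical_def\<close>)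

lemma contact_class_self: "f0 \<in> factors \<Longrightarrow> f0 \<in> contact_class l f0"
  by (simp add: contact_class_def)

lemma count_closed_traces:
  assumes "f0 \<in> factors"
  shows "degree (prod_mset {#g\<in>#critical. closed_traces l g = closed_traces l f0#}) + card (closed_traces l f0) =
    (\<Sum>f\<in>contact_class l f0. degree f)"
proof -
  have 1: "(\<exists>h\<in>contact_class l f0. closed_traces l g = closed_traces l h) \<longleftrightarrow> closed_traces l g = closed_traces l f0" for g
    using contact_class_self[OF assms] by (auto simp: contact_class_def)
  have 2: "(\<Union>h\<in>contact_class l f0. closed_traces l h) = closed_traces l f0"
    using contact_class_self[OF assms] by (auto simp: contact_class_def)
  have 3: "{f \<in> factors. closed_traces l f = closed_traces l f0} = contact_class l f0" by (simp add: contact_class_def)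
  have "contact_class l f0 \<subseteq> factors" by (auto simp: contact_class_def)
  from count_traces[OF this, of "\<lceil>l * rat_of_nat N\<rceil>"] show ?thesis
    unfolding closed_traces_def[symmetric] 1 2 3 .
qed

lemma count_open_traces:
  assumes "f0 \<in> factors"
  shows "degree (prod_mset {#g\<in>#critical. \<exists>h\<in>contact_class l f0. open_traces l g = open_traces l h#})
    + card (\<Union>h\<in>contact_class l f0. open_traces l h) = (\<Sum>f\<in>contact_class l f0. degree f)"
proof -
  have 3: "{f \<in> factors. \<exists>h\<in>contact_class l f0. open_traces l f = open_traces l h} = contact_class l f0"
  proof (intro equalityI subsetI)
    fix f assume "f \<in> {f \<in> factors. \<exists>h\<in>contact_class l f0. open_traces l f = open_traces l h}"
    then obtain h where f: "f \<in> factors" and h: "h \<in> factors" "closed_traces l h = closed_traces l f0" "open_traces l f = open_traces l h"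
      by (auto simp: contact_class_def)
    then show "f \<in> contact_class l f0"
      using closed_traces_if_open_traces[OF factors_relevant[OF f] factors_relevant[OF h(1)] h(3)] by (simp add: contact_class_def)
  qed (auto simp: contact_class_def)
  have "contact_class l f0 \<subseteq> factors" by (auto simp: contact_class_def)
  from count_traces[OF this, of "\<lfloor>l * rat_of_nat N\<rfloor> + 1"] show ?thesis
    unfolding open_traces_def[symmetric] 3 .
qed

lemma tau_contact_class:
  assumes "f0 \<in> factors" "g \<in> relevant"
  shows "g \<in> tau (contact_class l f0, Fin l) \<longleftrightarrow> closed_traces l g = closed_traces l f0"
proof -
  have "g \<in> tau (contact_class l f0, Fin l) \<longleftrightarrow> (\<forall>h\<in>contact_class l f0. closed_traces l g = closed_traces l h)"
    using ge_iff[OF assms(2) factors_relevant] relevant_Rnat[OF assms(2)] by (auto simp: tau_def contact_class_def)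
  then show ?thesis using contact_class_self[OF assms(1)] by (auto simp: contact_class_def)
qed

lemma tau_star_contact_class:
  assumes "f0 \<in> factors" "g \<in> relevant"
  shows "g \<in> tau_star (contact_class l f0, Fin l) \<longleftrightarrow> (\<exists>h\<in>contact_class l f0. open_traces l g = open_traces l h)"
proof -
  have "g \<in> tau_star (contact_class l f0, Fin l) \<longleftrightarrow>
      closed_traces l g = closed_traces l f0 \<and> (\<exists>h\<in>contact_class l f0. open_traces l g = open_traces l h)"
    using gt_iff[OF assms(2) factors_relevant] tau_contact_class[OF assms] by (auto simp: tau_star_def contact_class_def)
  moreover have "closed_traces l g = closed_traces l f0" if "h \<in> contact_class l f0" "open_traces l g = open_traces l h" for h
    using closed_traces_if_open_traces[OF assms(2) factors_relevant that(2)] that(1) by (auto simp: contact_class_def)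
  ultimately show ?thesis by blast
qed

lemma slice_eq: "slice B (pderiv F) = prod_mset {#g\<in>#critical. g \<in> tau B#}"
  by (simp add: slice_def critical_def)

lemma slice_prime_eq: "slice_prime B (pderiv F) = prod_mset {#g\<in>#critical. g \<in> tau_prime B#}"
  by (simp add: slice_prime_def critical_def)

lemma degree_slice_contact_class:
  assumes "f0 \<in> factors"
  shows "degree (slice (contact_class l f0, Fin l) (pderiv F)) + card (closed_traces l f0) = (\<Sum>f\<in>contact_class l f0. degree f)"
proof -
  have "{#g\<in>#critical. g \<in> tau (contact_class l f0, Fin l)#} = {#g\<in>#critical. closed_traces l g = closed_traces l f0#}"
    by (rule filter_mset_cong) (simp_all add: tau_contact_class[OF assms critical_relevant])
  then show ?thesis using count_closed_traces[OF assms, of l] by (simp add: slice_eq)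
qed

lemma degree_slice_prime:
  "degree (slice B (pderiv F)) = degree (slice_prime B (pderiv F)) +
     degree (prod_mset {#g\<in>#critical. g \<in> tau_star B#})"
proof -
  have sub: "tau_star B \<subseteq> tau B" by (auto simp: tau_star_def)
  have "{#g\<in>#critical. g \<in> tau B#} = {#g\<in>#critical. g \<in> tau_prime B#} + {#g\<in>#critical. g \<in> tau_star B#}"
    using sub by (intro multiset_eqI) (auto simp: tau_prime_def)
  then show ?thesis unfolding slice_eq slice_prime_eq degree_critical by simp
qed

lemma degree_slice_prime_contact_class:
  assumes "f0 \<in> factors"
  shows "degree (slice_prime (contact_class l f0, Fin l) (pderiv F)) + card (closed_traces l f0) =
    card (\<Union>h\<in>contact_class l f0. open_traces l h)"
proof -
  have "{#g\<in>#critical. g \<in> tau_star (contact_class l f0, Fin l)#} =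
      {#g\<in>#critical. \<exists>h\<in>contact_class l f0. open_traces l g = open_traces l h#}"
    by (rule filter_mset_cong) (simp_all add: tau_star_contact_class[OF assms critical_relevant])
  then show ?thesis
    using count_open_traces[OF assms, of l] degree_slice_contact_class[OF assms, of l]
      degree_slice_prime[of "(contact_class l f0, Fin l)"] by simp
qed

lemma D_bud_contact_class:
  assumes "f0 \<in> factors"
  shows "D_bud (contact_class l f0, Fin l) = int (card (closed_traces l f0))"
proof -
  have "\<forall>f\<in>tau (contact_class l f0, Fin l). D_poly f (Fin l) = int (card (closed_traces l f0))"
  proof
    fix f assume "f \<in> tau (contact_class l f0, Fin l)"
    then have "f \<in> Rnat" "noc f f0 \<ge> Fin l" using contact_class_self[OF assms] by (auto simp: tau_def)
    then show "D_poly f (Fin l) = int (card (closed_traces l f0))"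
      using D_poly_cong[OF _ factors_Rnat[OF assms]] D_poly_closed_traces[OF factors_relevant[OF assms]] by simp
  qed
  moreover have "f0 \<in> tau (contact_class l f0, Fin l)" using tau_contact_class[OF assms factors_relevant[OF assms]] by simp
  ultimately show ?thesis unfolding D_bud_def by (intro the_equality) auto
qed

definition open_class where "open_class l v = {f \<in> factors. open_traces l f = v}"

text \<open>
  The strict buds in \<open>R\<^sup>*\<close> correspond to the classes of the stem under contact greater than \<open>l\<close>; such a class is
  determined by the set of open balls that its members meet.
\<close>

lemma R_star_contact_class:
  assumes f0: "f0 \<in> factors"
  shows "R_star (contact_class l f0, Fin l) = (\<lambda>v. (open_class l v, Fin l)) ` open_traces l ` contact_class l f0"
proof (intro equalityI subsetI)
  have cS: "contact_class l f0 \<subseteq> factors" by (auto simp: contact_class_def)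
  fix B assume B: "B \<in> R_star (contact_class l f0, Fin l)"
  then obtain k where Bk: "B = (k, Fin l)" by (cases B) (auto simp: R_star_def)
  have strict: "k \<noteq> {}" "\<And>f h. f \<in> k \<Longrightarrow> h \<in> k \<Longrightarrow> noc f h > Fin l"
    and k: "k = tau_star (k, Fin l) \<inter> contact_class l f0"
    using B by (auto simp: Bk R_star_def is_improper_bud_def is_strict_bud_def is_bud_def)
  have kc: "k \<subseteq> contact_class l f0" using k by blast
  then have kS: "f \<in> k \<Longrightarrow> f \<in> factors" for f using cS by blast
  obtain h where h: "h \<in> k" using strict(1) by blast
  have "k = open_class l (open_traces l h)"
  proof (intro equalityI subsetI)
    fix f assume f: "f \<in> k"
    then show "f \<in> open_class l (open_traces l h)"
      using strict(2)[OF f h] gt_iff[OF factors_relevant factors_relevant] kS h by (auto simp: open_class_def)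
  next
    fix f assume "f \<in> open_class l (open_traces l h)"
    then have f: "f \<in> factors" "open_traces l f = open_traces l h" by (auto simp: open_class_def)
    have hc: "h \<in> contact_class l f0" using h kc by blast
    have fc: "f \<in> contact_class l f0"
      using closed_traces_if_open_traces[OF factors_relevant[OF f(1)] factors_relevant[OF kS[OF h]] f(2)] f(1) hc by (auto simp: contact_class_def)
    have "noc f x \<ge> Fin l" if "x \<in> k" for x
      using ge_iff[OF factors_relevant[OF f(1)] factors_relevant[OF kS[OF that]]] fc that kc by (auto simp: contact_class_def)
    moreover have "noc f h > Fin l" using gt_iff[OF factors_relevant[OF f(1)] factors_relevant[OF kS[OF h]]] f(2) by simp
    ultimately have "f \<in> tau_star (k, Fin l)"
      using factors_Rnat[OF f(1)] h by (auto simp: tau_star_def tau_def)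
    then show "f \<in> k" using k fc by blast
  qed
  then show "B \<in> (\<lambda>v. (open_class l v, Fin l)) ` open_traces l ` contact_class l f0"
    using Bk h kc by blast
next
  fix B assume "B \<in> (\<lambda>v. (open_class l v, Fin l)) ` open_traces l ` contact_class l f0"
  then obtain h where h: "h \<in> contact_class l f0" and B: "B = (open_class l (open_traces l h), Fin l)" by auto
  define k where "k = open_class l (open_traces l h)"
  have hS: "h \<in> factors" using h by (simp add: contact_class_def)
  have hk: "h \<in> k" using hS by (simp add: k_def open_class_def)
  have kS: "f \<in> k \<Longrightarrow> f \<in> factors" for f by (simp add: k_def open_class_def)
  have gt: "noc f x > Fin l" if "f \<in> k" "x \<in> k" for f x
    using gt_iff[OF factors_relevant[OF kS[OF that(1)]] factors_relevant[OF kS[OF that(2)]]] that by (simp add: k_def open_class_def)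
  have kc: "k \<subseteq> contact_class l f0"
  proof
    fix f assume f: "f \<in> k"
    then have "closed_traces l f = closed_traces l h"
      using closed_traces_if_open_traces[OF factors_relevant[OF kS[OF f]] factors_relevant[OF hS]] by (simp add: k_def open_class_def)
    then show "f \<in> contact_class l f0" using h kS[OF f] by (simp add: contact_class_def)
  qed
  have "is_strict_bud (k, Fin l)"
    using gt hk kS factors_Rnat by (auto simp: is_strict_bud_def is_bud_def intro: less_imp_le)
  moreover have "k = tau_star (k, Fin l) \<inter> contact_class l f0"
  proof (intro equalityI subsetI)
    fix f assume f: "f \<in> k"
    then have "f \<in> tau_star (k, Fin l)"
      using gt factors_Rnat[OF kS[OF f]] by (auto simp: tau_star_def tau_def intro: less_imp_le)
    then show "f \<in> tau_star (k, Fin l) \<inter> contact_class l f0" using f kc by blast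
  next
    fix f assume "f \<in> tau_star (k, Fin l) \<inter> contact_class l f0"
    then obtain x where x: "x \<in> k" "noc f x > Fin l" and fS: "f \<in> factors"
      by (auto simp: tau_star_def contact_class_def)
    then have "open_traces l f = open_traces l x" using gt_iff[OF factors_relevant factors_relevant] kS by blast
    then show "f \<in> k" using x(1) fS by (simp add: k_def open_class_def)
  qed
  ultimately show "B \<in> R_star (contact_class l f0, Fin l)" by (simp add: B R_star_def k_def)
qed

lemma D_star_bud_open_class:
  assumes h: "h \<in> factors"
  shows "D_star_bud (open_class l (open_traces l h), Fin l) = int (card (open_traces l h))"
proof -
  let ?k = "open_class l (open_traces l h)"
  have "\<forall>f\<in>tau_star (?k, Fin l). D_star_poly f (Fin l) = int (card (open_traces l h))"
  proof
    fix f assume "f \<in> tau_star (?k, Fin l)"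
    then obtain x where fx: "f \<in> Rnat" "x \<in> ?k" "noc f x > Fin l"
      by (auto simp: tau_star_def tau_def)
    then have x: "x \<in> factors" "open_traces l x = open_traces l h" by (auto simp: open_class_def)
    show "D_star_poly f (Fin l) = int (card (open_traces l h))"
      using D_star_poly_cong[OF fx(1) factors_Rnat[OF x(1)] fx(3)] D_star_poly_open_traces[OF factors_relevant[OF x(1)]] x(2) by simp
  qed
  moreover have "h \<in> tau_star (?k, Fin l)"
  proof -
    have gt: "noc h x > Fin l" if "x \<in> ?k" for x
      using gt_iff[OF factors_relevant[OF h] factors_relevant] that by (auto simp: open_class_def)
    moreover have "h \<in> ?k" using h by (simp add: open_class_def)
    ultimately show ?thesis using factors_Rnat[OF h] by (auto simp: tau_star_def tau_def intro: less_imp_le)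
  qed
  ultimately show ?thesis unfolding D_star_bud_def by (intro the_equality) auto
qed

lemma finite_open_traces: "f \<in> relevant \<Longrightarrow> finite (open_traces l f)"
  unfolding open_traces_def traces_def
  by (intro finite_imageI ramified_roots_splitting(3)[OF relevant_Rnat relevant_dvd N_pos])

lemma sum_D_star_bud:
  assumes f0: "f0 \<in> factors"
  shows "(\<Sum>B\<in>R_star (contact_class l f0, Fin l). D_star_bud B) = int (card (\<Union>h\<in>contact_class l f0. open_traces l h))"
proof -
  have inj: "inj_on (\<lambda>v. (open_class l v, Fin l)) (open_traces l ` contact_class l f0)"
  proof (rule inj_onI)
    fix v w assume vw: "v \<in> open_traces l ` contact_class l f0" "(open_class l v, Fin l) = (open_class l w, Fin l)"
    then obtain h where "h \<in> factors" "v = open_traces l h" by (auto simp: contact_class_def)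
    then have "h \<in> open_class l w" using vw(2) by (auto simp: open_class_def)
    then show "v = w" using \<open>v = _\<close> by (simp add: open_class_def)
  qed
  have "(\<Sum>B\<in>R_star (contact_class l f0, Fin l). D_star_bud B) = (\<Sum>v\<in>open_traces l ` contact_class l f0. int (card v))"
    unfolding R_star_contact_class[OF f0] sum.reindex[OF inj] o_def
    by (rule sum.cong[OF refl]) (auto simp: contact_class_def D_star_bud_open_class)
  also have "\<dots> = int (card (\<Union> (open_traces l ` contact_class l f0)))"
  proof (subst card_Union_disjoint)
    show "pairwise disjnt (open_traces l ` contact_class l f0)"
    proof (rule pairwiseI)
      fix v w assume "v \<in> open_traces l ` contact_class l f0" "w \<in> open_traces l ` contact_class l f0" "v \<noteq> w"
      then obtain f h where fh: "f \<in> factors" "h \<in> factors" "v = open_traces l f" "w = open_traces l h" "v \<noteq> w"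
        by (auto simp: contact_class_def)
      then show "disjnt v w"
        using traces_eq_if_meet[OF relevant_Rnat[OF factors_relevant] relevant_dvd[OF factors_relevant] relevant_Rnat[OF factors_relevant] relevant_dvd[OF factors_relevant] N_pos]
        unfolding open_traces_def disjnt_def by metis
    qed
    show "\<And>v. v \<in> open_traces l ` contact_class l f0 \<Longrightarrow> finite v"
      using finite_open_traces factors_relevant by (auto simp: contact_class_def)
  qed simp
  finally show ?thesis .
qed

lemma degrees_contact_class:
  assumes f0: "f0 \<in> factors"
  shows "int (degree (slice (contact_class l f0, Fin l) (pderiv F))) = D_prime2_bud (contact_class l f0, Fin l)"
    and "int (degree (slice_prime (contact_class l f0, Fin l) (pderiv F))) = D_prime_bud (contact_class l f0, Fin l)"
proof -
  have "int (degree (slice (contact_class l f0, Fin l) (pderiv F)) + card (closed_traces l f0)) = int (\<Sum>f\<in>contact_class l f0. degree f)"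
    by (simp only: degree_slice_contact_class[OF f0])
  then show "int (degree (slice (contact_class l f0, Fin l) (pderiv F))) = D_prime2_bud (contact_class l f0, Fin l)"
    by (simp add: D_prime2_bud_def D_bud_contact_class[OF f0])
  have "int (degree (slice_prime (contact_class l f0, Fin l) (pderiv F)) + card (closed_traces l f0)) =
      int (card (\<Union>h\<in>contact_class l f0. open_traces l h))"
    by (simp only: degree_slice_prime_contact_class[OF f0])
  then show "int (degree (slice_prime (contact_class l f0, Fin l) (pderiv F))) = D_prime_bud (contact_class l f0, Fin l)"
    by (simp add: D_prime_bud_def D_bud_contact_class[OF f0] sum_D_star_bud[OF f0])
qed

end

lemma prod_filter_partition:
  fixes M :: "'b::comm_monoid_mult multiset"
  assumes I: "finite I"
    and ex: "\<And>g. g \<in># M \<Longrightarrow> P g \<longleftrightarrow> (\<exists>i\<in>I. Q i g)"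
    and uniq: "\<And>g i j. g \<in># M \<Longrightarrow> i \<in> I \<Longrightarrow> j \<in> I \<Longrightarrow> Q i g \<Longrightarrow> Q j g \<Longrightarrow> i = j"
  shows "prod_mset {#g\<in>#M. P g#} = (\<Prod>i\<in>I. prod_mset {#g\<in>#M. Q i g#})"
  using ex uniq
proof (induction M)
  case (add g M)
  have g: "(\<Prod>i\<in>I. if Q i g then g else 1) = (if P g then g else 1)"
  proof (cases "P g")
    case True
    then obtain i where i: "i \<in> I" "Q i g" using add.prems(1)[of g] by auto
    have "(\<Prod>j\<in>I. if Q j g then g else 1) = (\<Prod>j\<in>I. if j = i then g else 1)"
      using add.prems(2)[of g] i by (intro prod.cong refl) auto
    then show ?thesis using True I i by simp
  next
    case False
    then have "(\<Prod>j\<in>I. if Q j g then g else 1) = (\<Prod>j\<in>I. 1)"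
      using add.prems(1)[of g] by (intro prod.cong refl) auto
    then show ?thesis using False by simp
  qed
  have "(\<Prod>i\<in>I. prod_mset {#x\<in>#add_mset g M. Q i x#}) =
      (\<Prod>i\<in>I. (if Q i g then g else 1) * prod_mset {#x\<in>#M. Q i x#})"
    by (intro prod.cong refl) simp
  also have "\<dots> = (if P g then g else 1) * prod_mset {#x\<in>#M. P x#}"
  proof -
    have "prod_mset {#x\<in>#M. P x#} = (\<Prod>i\<in>I. prod_mset {#x\<in>#M. Q i x#})"
    proof (rule add.IH)
      show "P h \<longleftrightarrow> (\<exists>i\<in>I. Q i h)" if "h \<in># M" for h using add.prems(1)[of h] that by simp
      show "i = j" if "h \<in># M" "i \<in> I" "j \<in> I" "Q i h" "Q j h" for h i j
        using add.prems(2)[of h i j] that by simp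
    qed
    then show ?thesis unfolding prod.distrib g by simp
  qed
  finally show ?case by simp
qed simp

context squarefree_polynomial
begin

lemma root_stem_F: "root_stem F = factors"
  using factors_nonempty by (auto simp: root_stem_def factors_def)

lemma tree_iff:
  "B \<in> tree F \<longleftrightarrow> B = (factors, Minf) \<or> (\<exists>l\<in>contact_set F. \<exists>f0\<in>factors. B = (contact_class l f0, Fin l))"
proof -
  have im: "{(f, f'). f \<in> factors \<and> f' \<in> factors \<and> noc f f' \<ge> Fin l} `` {f0} = contact_class l f0" if "f0 \<in> factors" for l f0
    using that ge_iff[OF factors_relevant[OF that] factors_relevant] by (auto simp: contact_class_def)
  have "(\<exists>s l. B = (s, Fin l) \<and> l \<in> contact_set F \<and>
      s \<in> factors // {(f, f'). f \<in> factors \<and> f' \<in> factors \<and> noc f f' \<ge> Fin l}) \<longleftrightarrow>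
    (\<exists>l\<in>contact_set F. \<exists>f0\<in>factors. B = (contact_class l f0, Fin l))"
    unfolding quotient_def using im by auto
  then show ?thesis by (simp add: tree_def tree_root_def root_stem_F)
qed

lemma char_c_contact:
  "f \<in> factors \<Longrightarrow> i \<in> {1..char_h f} \<Longrightarrow> char_c f i \<notin> \<int> \<Longrightarrow> char_c f i \<in> contact_set F"
  unfolding contact_set_def factors_def by blast

lemma noc_contact:
  "f \<in> factors \<Longrightarrow> h \<in> factors \<Longrightarrow> f \<noteq> h \<Longrightarrow> noc f h = Fin l \<Longrightarrow> l \<in> contact_set F"
  unfolding contact_set_def factors_def by blast

lemma finite_contact_set: "finite (contact_set F)"
proof -
  define pick where "pick x = (case x of Fin l \<Rightarrow> l | _ \<Rightarrow> 0)" for x :: "rat extended"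
  have "contact_set F \<subseteq> (\<Union>f\<in>factors. char_c f ` {1..char_h f}) \<union> (\<lambda>(f, f'). pick (noc f f')) ` (factors \<times> factors)"
  proof
    fix l assume "l \<in> contact_set F"
    then consider f i where "f \<in> factors" "i \<in> {1..char_h f}" "l = char_c f i"
      | f f' where "f \<in> factors" "f' \<in> factors" "noc f f' = Fin l"
      unfolding contact_set_def factors_def by blast
    then show "l \<in> (\<Union>f\<in>factors. char_c f ` {1..char_h f}) \<union> (\<lambda>(f, f'). pick (noc f f')) ` (factors \<times> factors)"
    proof cases
      case 2
      then have "l = (\<lambda>(f, f'). pick (noc f f')) (f, f')" by (simp add: pick_def)
      then show ?thesis using 2(1,2) by blast
    qed blast
  qed
  then show ?thesis by (rule finite_subset) (use finite_factors in auto)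
qed

lemma finite_tree: "finite (tree F)"
proof -
  have "tree F \<subseteq> insert (factors, Minf) ((\<lambda>(l, f0). (contact_class l f0, Fin l)) ` (contact_set F \<times> factors))"
    using tree_iff by auto
  then show ?thesis by (rule finite_subset) (simp add: finite_factors finite_contact_set)
qed

lemma root_buds:
  "tau (factors, Minf) = Rnat" "tau_star (factors, Minf) = Rnat" "R_star (factors, Minf) = {(factors, Minf)}"
proof -
  have tau: "tau (s, Minf) = Rnat" for s :: "'a fls poly set" by (auto simp: tau_def)
  have tau_star: "tau_star (s, Minf) = Rnat" if s: "s \<noteq> {}" "s \<subseteq> Rnat" for s :: "'a fls poly set"
  proof -
    obtain f where f: "f \<in> s" using s(1) by blast
    then have "noc g f > Minf" if "g \<in> Rnat" for g using noc_Minf[OF that] s(2) by blast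
    then show ?thesis using f by (auto simp: tau_star_def tau)
  qed
  have factors: "factors \<noteq> {}" "factors \<subseteq> Rnat" using factors_nonempty factors_Rnat by auto
  show "tau (factors, Minf) = Rnat" "tau_star (factors, Minf) = Rnat" by (rule tau, rule tau_star[OF factors])
  show "R_star (factors, Minf) = {(factors, Minf)}"
  proof (intro equalityI subsetI)
    fix B :: "'a bud"
    assume B: "B \<in> R_star (factors, Minf)"
    then obtain k where k: "B = (k, Minf)" by (cases B) (auto simp: R_star_def)
    then have "k \<noteq> {}" "k \<subseteq> Rnat" "k = tau_star (k, Minf) \<inter> factors"
      using B by (auto simp: R_star_def is_strict_bud_def is_bud_def is_improper_bud_def)
    then have "k = factors" using tau_star factors(2) by blast
    then show "B \<in> {(factors, Minf)}" by (simp add: k)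
  next
    fix B :: "'a bud"
    assume "B \<in> {(factors, Minf)}"
    then show "B \<in> R_star (factors, Minf)"
      using factors tau_star[OF factors] by (auto simp: R_star_def is_improper_bud_def)
  qed
qed

lemma slice_root: "slice (factors, Minf) (pderiv F) = prod_mset critical"
proof -
  have "{#g\<in>#critical. g \<in> tau (factors, Minf)#} = critical"
    using critical_Rnat by (simp add: root_buds filter_mset_eq_conv)
  then show ?thesis by (simp add: slice_eq)
qed

lemma slice_prime_root: "slice_prime (factors, Minf) (pderiv F) = 1"
  by (simp add: slice_prime_eq tau_prime_def root_buds)

lemma degrees_root:
  "int (degree (slice (factors, Minf) (pderiv F))) = D_prime2_bud (factors, Minf)"
  "int (degree (slice_prime (factors, Minf) (pderiv F))) = D_prime_bud (factors, Minf)"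
proof -
  have "degree (prod_mset critical) = degree (pderiv F)"
    using pderiv_F monic_factors(2)[OF pderiv_F] unfolding critical_def
    by (metis degree_smult_eq leading_coeff_0_iff)
  also have "\<dots> = degree F - 1" by (rule degree_pderiv)
  finally have 1: "degree (prod_mset critical) = degree F - 1" .
  have "degree F = degree (prod_mset (monic_factors F))"
    using F_nonzero monic_factors(2)[OF F_nonzero] by (metis degree_smult_eq leading_coeff_0_iff)
  also have "\<dots> = (\<Sum>f\<in>factors. degree f)" using degree_factors_F[of "\<lambda>_. True"] by simp
  finally have "int (degree (prod_mset critical)) + 1 = (\<Sum>f\<in>factors. int (degree f))"
    using 1 degree_F by (simp add: of_nat_diff)
  then show "int (degree (slice (factors, Minf) (pderiv F))) = D_prime2_bud (factors, Minf)"
    by (simp add: slice_root D_prime2_bud_def)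
  show "int (degree (slice_prime (factors, Minf) (pderiv F))) = D_prime_bud (factors, Minf)"
    by (simp add: slice_prime_root D_prime_bud_def root_buds)
qed

lemma critical_max_contact:
  assumes g: "g \<in># critical"
  shows "\<exists>f0\<in>factors. \<exists>l. noc g f0 = Fin l \<and> (\<forall>f\<in>factors. noc g f \<le> Fin l)"
proof -
  define m where "m = Max (noc g ` factors)"
  have "m \<in> noc g ` factors" unfolding m_def using finite_factors factors_nonempty by (intro Max_in) auto
  then obtain f0 where f0: "f0 \<in> factors" "m = noc g f0" by blast
  have "g \<noteq> f0" using critical_not_factors[OF g] f0(1) by blast
  then obtain l where l: "noc g f0 = Fin l"
    using noc_finite_or_eq[OF critical_Rnat[OF g] factors_Rnat[OF f0(1)]] by blast
  have "noc g f \<le> Fin l" if "f \<in> factors" for f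
    using Max_ge[of "noc g ` factors" "noc g f"] finite_factors that by (simp add: m_def[symmetric] f0(2) l)
  then show ?thesis using f0(1) l by blast
qed

context
  fixes g f0 l
  assumes g: "g \<in># critical" and f0: "f0 \<in> factors" and l: "noc g f0 = Fin l"
    and max: "\<And>f. f \<in> factors \<Longrightarrow> noc g f \<le> Fin l"
begin

private lemma gE: "g \<in> relevant" using critical_relevant[OF g] .

private lemma gf0: "closed_traces l g = closed_traces l f0"
  using ge_iff[OF gE factors_relevant[OF f0], of l] l by simp

lemma critical_tau_prime: "g \<in> tau_prime (contact_class l f0, Fin l)"
proof -
  have "open_traces l g \<noteq> open_traces l h" if "h \<in> contact_class l f0" for h
    using gt_iff[OF gE factors_relevant, of h l] max[of h] that by (auto simp: contact_class_def)
  then show ?thesis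
    using gf0 tau_contact_class[OF f0 gE, of l] tau_star_contact_class[OF f0 gE, of l] unfolding tau_prime_def by blast
qed

text \<open>
  Were \<open>l\<close> not in the contact set, any two members of the class of \<open>f0\<close> would have contact greater than \<open>l\<close>
  and \<open>D(f0,l) = D\<^sup>*(f0,l)\<close> would hold. So the stem would meet as many open as closed balls, and no factor of
  the derivative would be left in \<open>\<tau>'\<close>, where \<open>g\<close> is.
\<close>

lemma critical_contact_in_contact_set: "l \<in> contact_set F"
proof (rule ccontr)
  assume notin: "l \<notin> contact_set F"
  have gt: "noc f h > Fin l" if f: "f \<in> contact_class l f0" and h: "h \<in> contact_class l f0" for f h
  proof (cases "f = h")
    case True
    then show ?thesis using noc_self[OF factors_Rnat] f by (auto simp: contact_class_def)
  next
    case False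
    have fh: "f \<in> factors" "h \<in> factors" "closed_traces l f = closed_traces l h" using f h by (auto simp: contact_class_def)
    then have "noc f h \<ge> Fin l" using ge_iff[OF factors_relevant factors_relevant] by blast
    moreover have "noc f h \<noteq> Fin l" using notin noc_contact[OF fh(1,2) False] by blast
    ultimately show ?thesis by simp
  qed
  have star: "open_traces l h = open_traces l f0" if h: "h \<in> contact_class l f0" for h
  proof -
    have "h \<in> factors" using h by (simp add: contact_class_def)
    then show ?thesis using gt_iff[OF factors_relevant factors_relevant[OF f0], of h l] gt[OF h contact_class_self[OF f0]] by blast
  qed
  have "D_poly f0 (Fin l) = D_star_poly f0 (Fin l)"
  proof (rule ccontr)
    assume ne: "D_poly f0 (Fin l) \<noteq> D_star_poly f0 (Fin l)"
    obtain i where i: "i \<in> {1..char_h f0}" "char_c f0 i = l \<and> l \<notin> \<int>"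
      using D_jump_char_c[OF factors_Rnat[OF f0] ne] by (elim bexE)
    then have "char_c f0 i \<in> contact_set F" using char_c_contact[OF f0 i(1)] by simp
    then show False using i(2) notin by simp
  qed
  then have card: "card (closed_traces l f0) = card (open_traces l f0)"
    by (simp add: D_poly_closed_traces[OF factors_relevant[OF f0]] D_star_poly_open_traces[OF factors_relevant[OF f0]])
  have U: "(\<Union>h\<in>contact_class l f0. open_traces l h) = open_traces l f0"
  proof -
    have "(\<Union>h\<in>contact_class l f0. open_traces l h) = (\<Union>h\<in>contact_class l f0. open_traces l f0)"
      by (rule SUP_cong[OF refl star])
    then show ?thesis using contact_class_self[OF f0, of l] by auto
  qed
  have "degree (slice_prime (contact_class l f0, Fin l) (pderiv F)) = 0"
    using degree_slice_prime_contact_class[OF f0, of l] by (simp add: U card)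
  then have "(\<Sum>f\<in>#{#f\<in>#critical. f \<in> tau_prime (contact_class l f0, Fin l)#}. degree f) = 0"
    by (simp only: slice_prime_eq degree_critical)
  then have "degree g = 0" using g critical_tau_prime by (auto simp: sum_mset_0_iff)
  then show False using Rnat_degree_pos[OF critical_Rnat[OF g]] by simp
qed

lemma critical_tau_level:
  assumes "f1 \<in> factors" "g \<in> tau (contact_class l' f1, Fin l')"
  shows "l' \<le> l" "l' = l \<Longrightarrow> contact_class l' f1 = contact_class l f0"
proof -
  have eq: "closed_traces l' g = closed_traces l' f1" using tau_contact_class[OF assms(1) gE] assms(2) by simp
  then have "noc g f1 \<ge> Fin l'" using ge_iff[OF gE factors_relevant[OF assms(1)]] by simp
  then have "Fin l' \<le> Fin l" using max[OF assms(1)] by (rule order_trans)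
  then show "l' \<le> l" by simp
  show "contact_class l' f1 = contact_class l f0" if "l' = l" using eq gf0 that by (simp add: contact_class_def)
qed

text \<open>
  At a level below the maximal contact \<open>l\<close>, the factor \<open>g\<close> is in \<open>\<tau>\<^sup>*\<close> because of \<open>f0\<close>; above \<open>l\<close> it is not even in
  \<open>\<tau>\<close>.
\<close>

lemma critical_tau_prime_unique:
  assumes B: "B \<in> tree F" "g \<in> tau_prime B"
  shows "B = (contact_class l f0, Fin l)"
proof -
  have "B \<noteq> (factors, Minf)" using B(2) by (auto simp: tau_prime_def root_buds)
  then obtain l' f1 where f1: "f1 \<in> factors" and Beq: "B = (contact_class l' f1, Fin l')"
    using B(1) tree_iff by blast
  have tau: "g \<in> tau (contact_class l' f1, Fin l')" and notstar: "g \<notin> tau_star (contact_class l' f1, Fin l')"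
    using B(2) by (auto simp: tau_prime_def Beq)
  have "\<not> l' < l"
  proof
    assume lt: "l' < l"
    have 1: "noc g f0 > Fin l'" using l lt by simp
    then have "closed_traces l' g = closed_traces l' f0"
      using closed_traces_if_open_traces[OF gE factors_relevant[OF f0]] gt_iff[OF gE factors_relevant[OF f0]] by blast
    moreover have "closed_traces l' g = closed_traces l' f1" using tau_contact_class[OF f1 gE] tau by simp
    ultimately have "f0 \<in> contact_class l' f1" using f0 by (simp add: contact_class_def)
    moreover have "open_traces l' g = open_traces l' f0" using gt_iff[OF gE factors_relevant[OF f0]] 1 by blast
    ultimately show False using notstar tau_star_contact_class[OF f1 gE] by blast
  qed
  then show ?thesis using critical_tau_level[OF f1 tau] by (simp add: Beq)
qed

lemma critical_tau_pi:
  assumes B: "B \<in> tree F" "g \<in> tau B"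
  shows "(contact_class l f0, Fin l) \<in> insert B (pi_tree (tree F) B)"
proof -
  have T: "(contact_class l f0, Fin l) \<in> tree F"
    using critical_contact_in_contact_set f0 tree_iff by blast
  consider "B = (factors, Minf)" | l' f1 where "f1 \<in> factors" "B = (contact_class l' f1, Fin l')"
    using B(1) tree_iff by blast
  then show ?thesis
  proof cases
    case 1
    have "tau (contact_class l f0, Fin l) \<subseteq> Rnat" by (auto simp: tau_def)
    then show ?thesis using T by (simp add: 1 pi_tree_def root_buds)
  next
    case 2
    have lev: "l' \<le> l" "l' = l \<Longrightarrow> contact_class l' f1 = contact_class l f0"
      using critical_tau_level[OF 2(1)] B(2) by (simp_all add: 2(2))
    show ?thesis
    proof (cases "l' = l")
      case True
      then show ?thesis using lev(2) by (simp add: 2(2))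
    next
      case False
      have gR: "g \<in> Rnat" and f0R: "f0 \<in> Rnat" using critical_Rnat[OF g] factors_Rnat[OF f0] by auto
      have gtau: "\<forall>h\<in>contact_class l' f1. noc g h \<ge> Fin l'" using B(2) by (simp add: 2(2) tau_def)
      have le: "Fin l' \<le> x" if "Fin l \<le> x" for x :: "rat extended"
        using that lev(1) by (meson order_trans less_eq_extended.simps(1))
      have "noc g f0 \<ge> Fin l'" using l lev(1) by simp
      then have f0g: "noc f0 g \<ge> Fin l'" using noc_sym(1)[OF gR f0R] by blast
      have "tau (contact_class l f0, Fin l) \<subseteq> tau (contact_class l' f1, Fin l')"
      proof
        fix x assume "x \<in> tau (contact_class l f0, Fin l)"
        then have x: "x \<in> Rnat" "noc x f0 \<ge> Fin l'" using contact_class_self[OF f0] le by (auto simp: tau_def)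
        have "noc x h \<ge> Fin l'" if h: "h \<in> contact_class l' f1" for h
        proof -
          have hR: "h \<in> Rnat" using h factors_Rnat by (auto simp: contact_class_def)
          have "noc f0 h \<ge> Fin l'" using noc_trans(1)[OF f0R gR hR f0g] gtau h by blast
          then show ?thesis by (rule noc_trans(1)[OF x(1) f0R hR x(2)])
        qed
        then show "x \<in> tau (contact_class l' f1, Fin l')" using x(1) by (simp add: tau_def)
      qed
      then show ?thesis using T False lev(1) by (simp add: 2(2) pi_tree_def)
    qed
  qed
qed

end

text \<open>
  Every factor of the derivative that lies in \<open>\<tau>(B)\<close> lies in \<open>\<tau>'\<close> of exactly one bud among \<open>B\<close> and those
  of \<open>\<pi>(T,B)\<close>.
\<close>

lemma slice_factorization:
  assumes B: "B \<in> tree F"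
  shows "slice B (pderiv F) =
    slice_prime B (pderiv F) * (\<Prod>B'\<in>pi_tree (tree F) B. slice_prime B' (pderiv F))"
proof -
  let ?P = "pi_tree (tree F) B"
  have fin: "finite ?P" using finite_tree by (simp add: pi_tree_def)
  have notin: "B \<notin> ?P" by (simp add: pi_tree_def)
  have sub: "B' \<in> tree F" "tau_prime B' \<subseteq> tau B" if "B' \<in> insert B ?P" for B'
    using that B by (auto simp: pi_tree_def tau_prime_def)
  have "prod_mset {#g\<in>#critical. g \<in> tau B#} =
      (\<Prod>B'\<in>insert B ?P. prod_mset {#g\<in>#critical. g \<in> tau_prime B'#})"
  proof (rule prod_filter_partition)
    show "finite (insert B ?P)" using fin by simp
    fix g assume g: "g \<in># critical"
    obtain f0 l where f0: "f0 \<in> factors" "noc g f0 = Fin l" "\<And>f. f \<in> factors \<Longrightarrow> noc g f \<le> Fin l"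
      using critical_max_contact[OF g] by blast
    show "g \<in> tau B \<longleftrightarrow> (\<exists>B'\<in>insert B ?P. g \<in> tau_prime B')"
      using critical_tau_pi[OF g f0 B] critical_tau_prime[OF g f0] sub(2) by blast
    show "B1 = B2" if "B1 \<in> insert B ?P" "B2 \<in> insert B ?P" "g \<in> tau_prime B1" "g \<in> tau_prime B2" for B1 B2
      using critical_tau_prime_unique[OF g f0] sub(1) that by metis
  qed
  then show ?thesis using fin notin by (simp add: slice_eq slice_prime_eq)
qed

lemma degrees_tree:
  assumes B: "B \<in> tree F"
  shows "int (degree (slice B (pderiv F))) = D_prime2_bud B"
    and "int (degree (slice_prime B (pderiv F))) = D_prime_bud B"
  using B degrees_root degrees_contact_class unfolding tree_iff by auto

lemma pi_tree_root: "pi_tree (tree F) (factors, Minf) = tree F - {(factors, Minf)}"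
proof -
  have "level B > Minf \<and> tau B \<subseteq> Rnat" if "B \<in> tree F" "B \<noteq> (factors, Minf)" for B
    using that tree_iff by (auto simp: tau_def)
  then show ?thesis by (auto simp: pi_tree_def root_buds)
qed

end

theorem mainTheorem1:
  fixes F :: "'a::{alg_closed_field, field_char_0} fls poly"
  assumes "F \<notin> range (\<lambda>c. [:c:])"
    and "devoid_of_multiple_factors F"
  shows "(\<forall>B\<in>tree F.
            int (degree (slice B (pderiv F))) = D_prime2_bud B \<and>
            int (degree (slice_prime B (pderiv F))) = D_prime_bud B \<and>
            slice B (pderiv F) =
              slice_prime B (pderiv F) * (\<Prod>B'\<in>pi_tree (tree F) B. slice_prime B' (pderiv F)) \<and>
            (\<forall>B'\<in>pi_tree (tree F) B.
               int (degree (slice B' (pderiv F))) = D_prime2_bud B' \<and>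
               int (degree (slice_prime B' (pderiv F))) = D_prime_bud B')) \<and>
         monic_part (pderiv F) = (\<Prod>B\<in>tree F - {tree_root F}. slice_prime B (pderiv F))"
proof -
  interpret squarefree_polynomial F by unfold_locales (rule assms)+
  have root: "(factors, Minf) \<in> tree F" by (simp add: tree_iff)
  have "monic_part (pderiv F) = slice (factors, Minf) (pderiv F)"
    by (simp add: slice_root monic_part_def critical_def)
  also have "\<dots> = (\<Prod>B\<in>tree F - {tree_root F}. slice_prime B (pderiv F))"
    using slice_factorization[OF root]
    by (simp add: slice_prime_root pi_tree_root tree_root_def root_stem_F)
  finally show ?thesis
    using degrees_tree slice_factorization by (simp add: pi_tree_def)
qed

end
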